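(* Let $R$ be a graded-commutative noetherian ring and $\mathsf T$ a compactly generated $R$-linear triangulated category with arbitrary coproducts. If $\mathsf T$ is stratified by $R$, then the maps $$\mathsf S\longmapsto\operatorname{supp}_R\mathsf S=\bigcup_{X\in\mathsf S}\operatorname{supp}_RX,\qquad\mathcal U\longmapsto\operatorname{supp}_R^{-1}\mathcal U=\{X\in\mathsf T\mid\operatorname{supp}_RX\subseteq\mathcal U\}$$ are inclusion preserving, mutually inverse bijections between the localizing subcategories of $\mathsf T$ and the subsets of $\operatorname{supp}_R\mathsf T$. Conversely, if the map $\operatorname{supp}_R$ from localizing subcategories of $\mathsf T$ to subsets of $\operatorname{supp}_R\mathsf T$ is injective, then $\mathsf T$ must be stratified by $R$.
   Context: Graded-commutative: $R$ is $\mathbb Z$-graded with $rs=(-1)^{|r||s|}sr$ for homogeneous $r,s$. $\operatorname{Spec}R$ is the set of homogeneous prime ideals; $\mathcal V(\mathfrak a)=\{\mathfrak p\in\operatorname{Spec}R\mid\mathfrak p\supseteq\mathfrak a\}$ for a homogeneous ideal $\mathfrak a$. $R$-modules are graded and $M_{\mathfrak p}$ is homogeneous localization. A subset $\mathcal V\subseteq\operatorname{Spec}R$ is specialization closed if $\mathfrak p\in\mathcal V$, $\mathfrak p\subseteq\mathfrak q$ imply $\mathfrak q\in\mathcal V$. $\mathsf T$ has suspension $\Sigma$. A localizing subcategory is a full triangulated subcategory closed under coproducts; $\operatorname{Loc}_{\mathsf T}(\mathsf C)$ is the smallest one containing $\mathsf C$. An object $C$ is compact if $\operatorname{Hom}_{\mathsf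 T}(C,-)$ commutes with coproducts; $\mathsf T^c$ is the full subcategory of compact objects. $\mathsf T$ is compactly generated if $\mathsf T=\operatorname{Loc}_{\mathsf T}(\mathsf G)$ for a set $\mathsf G$ of compact objects. $\mathsf T$ is $R$-linear if there is given a homomorphism of graded rings $R\to Z^*(\mathsf T)$ to the graded center ($Z^n(\mathsf T)$ consists of natural transformations $\eta\colon\mathrm{Id}\to\Sigma^n$ with $\eta\Sigma=(-1)^n\Sigma\eta$); then $\operatorname{Hom}^*_{\mathsf T}(X,Y)=\bigoplus_i\operatorname{Hom}_{\mathsf T}(X,\Sigma^iY)$ is a graded $R$-module. For specialization closed $\mathcal V$, let $\mathsf T_{\mathcal V}=\{X\in\mathsf T\mid\operatorname{Hom}^*_{\mathsf T}(C,X)_{\mathfrak p}=0\text{ for all }C\in\mathsf T^c,\ \mathfrak p\in\operatorname{Spec}R\setminus\mathcal V\}$. This is a localizing subcategory and there is a localization functor $L_{\mathcal V}\colon\mathsf T\to\mathsf T$ with $\operatorname{Ker}L_{\mathcal V}=\mathsf T_{\mathcal V}$, giving functorial exact triangles $\varGamma_{\mathcal V}X\to X\to L_{\mathcal V}X\to$ with $\varGamma_{\mathcal V}X\in\mathsf T_{\mathcal V}$ and $\operatorname{Hom}_{\mathsf T}(\mathsf T_{\mathcal V},L_{\mathcal V}X)=0$. For $\mathfrak p\in\operatorname{Spec}R$ put $\mathcal Z(\mathfrak p)=\{\mathfrak q\in\operatorname{Spec}R\mid\mathfrak q\not\subseteq\mathfrak p\}$, $X_{\mathfrak p}=L_{\mathcal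 Z(\mathfrak p)}X$, $\varGamma_{\mathfrak p}X=\varGamma_{\mathcal V(\mathfrak p)}(X_{\mathfrak p})$. $\varGamma_{\mathfrak p}\mathsf T$ is the essential image of $\varGamma_{\mathfrak p}$, a localizing subcategory of $\mathsf T$. The support of $X$ is $\operatorname{supp}_RX=\{\mathfrak p\in\operatorname{Spec}R\mid\varGamma_{\mathfrak p}X\neq0\}$. $\mathsf T$ is stratified by $R$ if (S1) the local-global principle holds, i.e. $\operatorname{Loc}_{\mathsf T}(X)=\operatorname{Loc}_{\mathsf T}(\{\varGamma_{\mathfrak p}X\mid\mathfrak p\in\operatorname{Spec}R\})$ for every object $X$; and (S2) for each $\mathfrak p\in\operatorname{Spec}R$ the localizing subcategory $\varGamma_{\mathfrak p}\mathsf T$ is either zero or minimal (nonzero with no proper nonzero localizing subcategories). *)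

theory Defs
  imports "HOL-Algebra.Product_Groups" "HOL-Algebra.Ring_Divisibility" "HOL-Library.Countable_Set"
begin

unbundle cardinal_syntax

section \<open>Size\<close>

text \<open>
  ``Set'' as opposed to ``class'' refers to a fixed Grothendieck universe, given by a set \<open>U\<close>
  whose cardinality is strongly inaccessible: the small sets are those of cardinality less
  than \<open>|U|\<close>.  The objects of a category may form an arbitrarily large set.  Every small set is
  in bijection with a subset of \<open>U\<close>, so families indexed by sets of the element type
  of \<open>U\<close> are all small families.
\<close>

locale universe =
  fixes U :: "'u set"
  assumes uncountable_U: "uncountable U"
    and regular_U: "regularCard |U|"
    and strong_limit_U: "\<And>A. A \<subseteq> U \<Longrightarrow> |A| <o |U| \<Longrightarrow> |Pow A| <o |U|"

definition small :: "'u set \<Rightarrow> 'a set \<Rightarrow> bool" where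
  "small U A \<longleftrightarrow> |A| <o |U|"


section \<open>Categories\<close>

record ('o, 'm) category =
  Ob :: "'o set"
  Arr :: "'m set"
  Dom :: "'m \<Rightarrow> 'o"
  Cod :: "'m \<Rightarrow> 'o"
  Idn :: "'o \<Rightarrow> 'm"
  Cmp :: "'m \<Rightarrow> 'm \<Rightarrow> 'm"  (infixl \<open>\<bullet>\<index>\<close> 70)

definition Hom :: "('o, 'm, 'z) category_scheme \<Rightarrow> 'o \<Rightarrow> 'o \<Rightarrow> 'm set" where
  "Hom T X Y = {f \<in> Arr T. Dom T f = X \<and> Cod T f = Y}"

locale category =
  fixes T :: "('o, 'm, 'z) category_scheme" (structure)
  assumes dom_closed: "f \<in> Arr T \<Longrightarrow> Dom T f \<in> Ob T"
    and cod_closed: "f \<in> Arr T \<Longrightarrow> Cod T f \<in> Ob T"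
    and idn_closed: "X \<in> Ob T \<Longrightarrow> Idn T X \<in> Hom T X X"
    and cmp_closed: "f \<in> Hom T X Y \<Longrightarrow> g \<in> Hom T Y Z \<Longrightarrow> g \<bullet> f \<in> Hom T X Z"
    and cmp_assoc: "f \<in> Hom T W X \<Longrightarrow> g \<in> Hom T X Y \<Longrightarrow> h \<in> Hom T Y Z
      \<Longrightarrow> (h \<bullet> g) \<bullet> f = h \<bullet> (g \<bullet> f)"
    and idn_right: "f \<in> Hom T X Y \<Longrightarrow> f \<bullet> Idn T X = f"
    and idn_left: "f \<in> Hom T X Y \<Longrightarrow> Idn T Y \<bullet> f = f"

definition is_iso_arr :: "('o, 'm, 'z) category_scheme \<Rightarrow> 'o \<Rightarrow> 'o \<Rightarrow> 'm \<Rightarrow> bool" where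
  "is_iso_arr T X Y f \<longleftrightarrow> f \<in> Hom T X Y \<and>
     (\<exists>g \<in> Hom T Y X. g \<bullet>\<^bsub>T\<^esub> f = Idn T X \<and> f \<bullet>\<^bsub>T\<^esub> g = Idn T Y)"

definition iso_obj :: "('o, 'm, 'z) category_scheme \<Rightarrow> 'o \<Rightarrow> 'o \<Rightarrow> bool" where
  "iso_obj T X Y \<longleftrightarrow> (\<exists>f. is_iso_arr T X Y f)"

definition zero_obj :: "('o, 'm, 'z) category_scheme \<Rightarrow> 'o \<Rightarrow> bool" where
  "zero_obj T Z \<longleftrightarrow> Z \<in> Ob T \<and>
     (\<forall>X \<in> Ob T. (\<exists>!f. f \<in> Hom T X Z) \<and> (\<exists>!f. f \<in> Hom T Z X))"

definition is_coproduct ::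
  "('o, 'm, 'z) category_scheme \<Rightarrow> 'i set \<Rightarrow> ('i \<Rightarrow> 'o) \<Rightarrow> 'o \<Rightarrow> ('i \<Rightarrow> 'm) \<Rightarrow> bool" where
  "is_coproduct T I X S \<iota> \<longleftrightarrow>
     S \<in> Ob T \<and> (\<forall>i \<in> I. X i \<in> Ob T \<and> \<iota> i \<in> Hom T (X i) S) \<and>
     (\<forall>Y \<in> Ob T. \<forall>g. (\<forall>i \<in> I. g i \<in> Hom T (X i) Y) \<longrightarrow>
        (\<exists>!h. h \<in> Hom T S Y \<and> (\<forall>i \<in> I. h \<bullet>\<^bsub>T\<^esub> \<iota> i = g i)))"

definition has_coproducts :: "'u set \<Rightarrow> ('o, 'm, 'z) category_scheme \<Rightarrow> bool" where
  "has_coproducts U T \<longleftrightarrow>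
     (\<forall>(I :: 'u set) X. small U I \<and> (\<forall>i \<in> I. X i \<in> Ob T) \<longrightarrow> (\<exists>S \<iota>. is_coproduct T I X S \<iota>))"

definition locally_small :: "'u set \<Rightarrow> ('o, 'm, 'z) category_scheme \<Rightarrow> bool" where
  "locally_small U T \<longleftrightarrow> (\<forall>X \<in> Ob T. \<forall>Y \<in> Ob T. small U (Hom T X Y))"


section \<open>Additive and triangulated categories\<close>

record ('o, 'm) additive_category = "('o, 'm) category" +
  Add :: "'m \<Rightarrow> 'm \<Rightarrow> 'm"
  Nul :: "'o \<Rightarrow> 'o \<Rightarrow> 'm"

definition hom_group :: "('o, 'm, 'z) additive_category_scheme \<Rightarrow> 'o \<Rightarrow> 'o \<Rightarrow> 'm monoid" where
  "hom_group T X Y = \<lparr>carrier = Hom T X Y, monoid.mult = Add T, one = Nul T X Y\<rparr>"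

definition Neg :: "('o, 'm, 'z) additive_category_scheme \<Rightarrow> 'm \<Rightarrow> 'm" where
  "Neg T f = inv\<^bsub>hom_group T (Dom T f) (Cod T f)\<^esub> f"

locale additive_category = category T
  for T :: "('o, 'm, 'z) additive_category_scheme" (structure) +
  assumes hom_comm_group: "X \<in> Ob T \<Longrightarrow> Y \<in> Ob T \<Longrightarrow> comm_group (hom_group T X Y)"
    and cmp_add_right: "f \<in> Hom T X Y \<Longrightarrow> f' \<in> Hom T X Y \<Longrightarrow> g \<in> Hom T Y Z
      \<Longrightarrow> g \<bullet> Add T f f' = Add T (g \<bullet> f) (g \<bullet> f')"
    and cmp_add_left: "f \<in> Hom T X Y \<Longrightarrow> g \<in> Hom T Y Z \<Longrightarrow> g' \<in> Hom T Y Z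
      \<Longrightarrow> Add T g g' \<bullet> f = Add T (g \<bullet> f) (g' \<bullet> f)"
    and ex_zero_obj: "\<exists>Z. zero_obj T Z"
    and ex_biproduct: "X \<in> Ob T \<Longrightarrow> Y \<in> Ob T \<Longrightarrow>
      \<exists>S \<in> Ob T. \<exists>i \<in> Hom T X S. \<exists>j \<in> Hom T Y S. \<exists>p \<in> Hom T S X. \<exists>q \<in> Hom T S Y.
        p \<bullet> i = Idn T X \<and> q \<bullet> j = Idn T Y \<and> p \<bullet> j = Nul T Y X \<and> q \<bullet> i = Nul T X Y \<and>
        Add T (i \<bullet> p) (j \<bullet> q) = Idn T S"

text \<open>
  As usual, the suspension is an automorphism of the category (not just an
  autoequivalence), so that \<open>\<Sigma>\<^sup>n\<close> is defined for all integers \<open>n\<close>.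
  \<open>Tri\<close> is the set of exact triangles \<open>X \<rightarrow> Y \<rightarrow> Z \<rightarrow> \<Sigma>X\<close>, each given by its three arrows.
\<close>

record ('o, 'm) triangulated_category = "('o, 'm) additive_category" +
  Susp :: "'o \<Rightarrow> 'o"
  SuspA :: "'m \<Rightarrow> 'm"
  Tri :: "('m \<times> 'm \<times> 'm) set"

definition triangle ::
  "('o, 'm, 'z) triangulated_category_scheme \<Rightarrow> 'o \<Rightarrow> 'o \<Rightarrow> 'o \<Rightarrow> 'm \<Rightarrow> 'm \<Rightarrow> 'm \<Rightarrow> bool" where
  "triangle T X Y Z f g h \<longleftrightarrow> f \<in> Hom T X Y \<and> g \<in> Hom T Y Z \<and> h \<in> Hom T Z (Susp T X)"

definition exact_triangle ::
  "('o, 'm, 'z) triangulated_category_scheme \<Rightarrow> 'o \<Rightarrow> 'o \<Rightarrow> 'o \<Rightarrow> 'm \<Rightarrow> 'm \<Rightarrow> 'm \<Rightarrow> bool" where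
  "exact_triangle T X Y Z f g h \<longleftrightarrow> triangle T X Y Z f g h \<and> (f, g, h) \<in> Tri T"

locale triangulated_category = additive_category T
  for T :: "('o, 'm, 'z) triangulated_category_scheme" (structure) +
  assumes susp_bij: "bij_betw (Susp T) (Ob T) (Ob T)"
    and suspA_bij: "bij_betw (SuspA T) (Arr T) (Arr T)"
    and suspA_hom: "f \<in> Hom T X Y \<Longrightarrow> SuspA T f \<in> Hom T (Susp T X) (Susp T Y)"
    and suspA_idn: "X \<in> Ob T \<Longrightarrow> SuspA T (Idn T X) = Idn T (Susp T X)"
    and suspA_cmp: "f \<in> Hom T X Y \<Longrightarrow> g \<in> Hom T Y Z
      \<Longrightarrow> SuspA T (g \<bullet> f) = SuspA T g \<bullet> SuspA T f"
    and suspA_add: "f \<in> Hom T X Y \<Longrightarrow> f' \<in> Hom T X Y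
      \<Longrightarrow> SuspA T (Add T f f') = Add T (SuspA T f) (SuspA T f')"
    and tri_typed: "(f, g, h) \<in> Tri T \<Longrightarrow> \<exists>X Y Z. triangle T X Y Z f g h"
    and tri_iso: "exact_triangle T X Y Z f g h \<Longrightarrow> triangle T X' Y' Z' f' g' h'
      \<Longrightarrow> is_iso_arr T X X' a \<Longrightarrow> is_iso_arr T Y Y' b \<Longrightarrow> is_iso_arr T Z Z' c
      \<Longrightarrow> b \<bullet> f = f' \<bullet> a \<Longrightarrow> c \<bullet> g = g' \<bullet> b \<Longrightarrow> SuspA T a \<bullet> h = h' \<bullet> c
      \<Longrightarrow> exact_triangle T X' Y' Z' f' g' h'"
    and tri_idn: "X \<in> Ob T \<Longrightarrow> zero_obj T Z
      \<Longrightarrow> exact_triangle T X X Z (Idn T X) (Nul T X Z) (Nul T Z (Susp T X))"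
    and tri_cone: "f \<in> Hom T X Y \<Longrightarrow> \<exists>Z g h. exact_triangle T X Y Z f g h"
    and tri_rotate: "triangle T X Y Z f g h
      \<Longrightarrow> exact_triangle T X Y Z f g h \<longleftrightarrow>
          exact_triangle T Y Z (Susp T X) g h (Neg T (SuspA T f))"
    and tri_morphism: "exact_triangle T X Y Z f g h \<Longrightarrow> exact_triangle T X' Y' Z' f' g' h'
      \<Longrightarrow> a \<in> Hom T X X' \<Longrightarrow> b \<in> Hom T Y Y' \<Longrightarrow> b \<bullet> f = f' \<bullet> a
      \<Longrightarrow> \<exists>c \<in> Hom T Z Z'. c \<bullet> g = g' \<bullet> b \<and> SuspA T a \<bullet> h = h' \<bullet> c"
    and tri_octahedral: "exact_triangle T X Y Z' f f' f'' \<Longrightarrow> exact_triangle T Y Z X' g g' g''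
      \<Longrightarrow> exact_triangle T X Z Y' (g \<bullet> f) k k'
      \<Longrightarrow> \<exists>a b. exact_triangle T Z' Y' X' a b (SuspA T f' \<bullet> g'') \<and>
            a \<bullet> f' = k \<bullet> g \<and> k' \<bullet> a = f'' \<and> b \<bullet> k = g' \<and> g'' \<bullet> b = SuspA T f \<bullet> k'"

definition shift :: "('o, 'm, 'z) triangulated_category_scheme \<Rightarrow> int \<Rightarrow> 'o \<Rightarrow> 'o" where
  "shift T n = (if 0 \<le> n then Susp T ^^ nat n else inv_into (Ob T) (Susp T) ^^ nat (- n))"

definition shiftA :: "('o, 'm, 'z) triangulated_category_scheme \<Rightarrow> int \<Rightarrow> 'm \<Rightarrow> 'm" where
  "shiftA T n = (if 0 \<le> n then SuspA T ^^ nat n else inv_into (Arr T) (SuspA T) ^^ nat (- n))"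

text \<open>
  Full subcategories are identified with their sets of objects.  They are automatically closed
  under isomorphism here, since \<open>X \<rightarrow> X' \<rightarrow> 0 \<rightarrow> \<Sigma>X\<close> is exact for every isomorphism \<open>X \<rightarrow> X'\<close>.
\<close>

definition triangulated_subcategory ::
  "('o, 'm, 'z) triangulated_category_scheme \<Rightarrow> 'o set \<Rightarrow> bool" where
  "triangulated_subcategory T S \<longleftrightarrow>
     S \<subseteq> Ob T \<and> (\<forall>Z. zero_obj T Z \<longrightarrow> Z \<in> S) \<and>
     (\<forall>X \<in> Ob T. X \<in> S \<longleftrightarrow> Susp T X \<in> S) \<and>
     (\<forall>X Y Z f g h. exact_triangle T X Y Z f g h \<longrightarrow>
        (X \<in> S \<and> Y \<in> S \<longrightarrow> Z \<in> S) \<and> (Y \<in> S \<and> Z \<in> S \<longrightarrow> X \<in> S) \<and> (X \<in> S \<and> Z \<in> S \<longrightarrow> Y \<in> S))"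

definition localizing :: "'u set \<Rightarrow> ('o, 'm, 'z) triangulated_category_scheme \<Rightarrow> 'o set \<Rightarrow> bool" where
  "localizing U T S \<longleftrightarrow> triangulated_subcategory T S \<and>
     (\<forall>(I :: 'u set) X C \<iota>. small U I \<and> (\<forall>i \<in> I. X i \<in> S) \<and> is_coproduct T I X C \<iota> \<longrightarrow> C \<in> S)"

definition Loc :: "'u set \<Rightarrow> ('o, 'm, 'z) triangulated_category_scheme \<Rightarrow> 'o set \<Rightarrow> 'o set" where
  "Loc U T \<C> = \<Inter>{S. localizing U T S \<and> \<C> \<subseteq> S}"

text \<open>
  \<open>C\<close> is compact if for each coproduct \<open>S\<close> of a small family \<open>X\<close> the canonical map
  \<open>(f\<^sub>i) \<mapsto> \<Sum>\<^sub>i \<iota>\<^sub>i f\<^sub>i\<close> from the direct sum of the groups \<open>Hom(C, X\<^sub>i)\<close> to \<open>Hom(C, S)\<close> is bijective.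
\<close>

definition compact_objects :: "'u set \<Rightarrow> ('o, 'm, 'z) triangulated_category_scheme \<Rightarrow> 'o set" where
  "compact_objects U T = {C \<in> Ob T.
     \<forall>(I :: 'u set) X S \<iota>. small U I \<and> is_coproduct T I X S \<iota> \<longrightarrow>
       (\<lambda>f. finprod (hom_group T C S) (\<lambda>i. \<iota> i \<bullet>\<^bsub>T\<^esub> f i) {i \<in> I. f i \<noteq> Nul T C (X i)})
         \<in> iso (sum_group I (\<lambda>i. hom_group T C (X i))) (hom_group T C S)}"

definition compactly_generated :: "'u set \<Rightarrow> ('o, 'm, 'z) triangulated_category_scheme \<Rightarrow> bool" where
  "compactly_generated U T \<longleftrightarrow>
     (\<exists>G. small U G \<and> G \<subseteq> compact_objects U T \<and> Ob T = Loc U T G)"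


section \<open>Graded-commutative rings\<close>

record 'r graded_ring = "'r ring" +
  grade :: "int \<Rightarrow> 'r set"

locale graded_commutative_ring = ring R
  for R :: "('r, 'z) graded_ring_scheme" (structure) +
  assumes grade_subgroup: "additive_subgroup (grade R n) R"
    and direct_sum: "(\<lambda>f. finsum R f {n. f n \<noteq> \<zero>})
      \<in> iso (sum_group UNIV (\<lambda>n. add_monoid R\<lparr>carrier := grade R n\<rparr>)) (add_monoid R)"
    and one_grade: "\<one> \<in> grade R 0"
    and mult_grade: "r \<in> grade R m \<Longrightarrow> s \<in> grade R n \<Longrightarrow> r \<otimes> s \<in> grade R (m + n)"
    and graded_commute: "r \<in> grade R m \<Longrightarrow> s \<in> grade R n
      \<Longrightarrow> r \<otimes> s = (if even (m * n) then s \<otimes> r else \<ominus> (s \<otimes> r))"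

definition homogeneous_ideal :: "('r, 'z) graded_ring_scheme \<Rightarrow> 'r set \<Rightarrow> bool" where
  "homogeneous_ideal R I \<longleftrightarrow> (\<exists>H \<subseteq> (\<Union>n. grade R n). I = Idl\<^bsub>R\<^esub> H)"

text \<open>
  \<open>primeideal\<close> of the library is restricted to commutative rings; the primality condition
  below is the same.
\<close>

definition Spec :: "('r, 'z) graded_ring_scheme \<Rightarrow> 'r set set" where
  "Spec R = {p. ideal p R \<and> homogeneous_ideal R p \<and> p \<noteq> carrier R \<and>
     (\<forall>a \<in> carrier R. \<forall>b \<in> carrier R. a \<otimes>\<^bsub>R\<^esub> b \<in> p \<longrightarrow> a \<in> p \<or> b \<in> p)}"

definition Vset :: "('r, 'z) graded_ring_scheme \<Rightarrow> 'r set \<Rightarrow> 'r set set" where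
  "Vset R \<aa> = {p \<in> Spec R. \<aa> \<subseteq> p}"

definition Zset :: "('r, 'z) graded_ring_scheme \<Rightarrow> 'r set \<Rightarrow> 'r set set" where
  "Zset R p = {q \<in> Spec R. \<not> q \<subseteq> p}"

text \<open>
  Homogeneous localization of a graded left module at \<open>p\<close>.  The module has components \<open>M i\<close>,
  and \<open>act n i r\<close> is multiplication by \<open>r \<in> R\<^sub>n\<close> as a map from \<open>M i\<close> to \<open>M (n + i)\<close>.
  A triple \<open>(n, x, s)\<close> stands for the fraction \<open>s\<^sup>-\<^sup>1 x\<close> with \<open>s \<in> R\<^sub>n - p\<close>.  Two fractions are
  equal if they agree after expansion to a common denominator \<open>a s = b t\<close>; this
  form of the relation is free of the signs coming from graded commutativity.
\<close>

definition fractions :: "('r, 'z) graded_ring_scheme \<Rightarrow> 'r set \<Rightarrow> (int \<Rightarrow> 'm monoid)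
    \<Rightarrow> int \<Rightarrow> (int \<times> 'm \<times> 'r) set" where
  "fractions R p M d = {(n, x, s). s \<in> grade R n - p \<and> x \<in> carrier (M (d + n))}"

definition fraction_rel :: "('r, 'z) graded_ring_scheme \<Rightarrow> 'r set \<Rightarrow> (int \<Rightarrow> 'm monoid)
    \<Rightarrow> (int \<Rightarrow> int \<Rightarrow> 'r \<Rightarrow> 'm \<Rightarrow> 'm) \<Rightarrow> int
    \<Rightarrow> ((int \<times> 'm \<times> 'r) \<times> (int \<times> 'm \<times> 'r)) set" where
  "fraction_rel R p M act d = {((n, x, s), (k, y, t)).
     (n, x, s) \<in> fractions R p M d \<and> (k, y, t) \<in> fractions R p M d \<and>
     (\<exists>l j. \<exists>a \<in> grade R l. \<exists>b \<in> grade R j. l + n = j + k \<and>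
        a \<otimes>\<^bsub>R\<^esub> s = b \<otimes>\<^bsub>R\<^esub> t \<and> a \<otimes>\<^bsub>R\<^esub> s \<notin> p \<and> act l (d + n) a x = act j (d + k) b y)}"

definition localization :: "('r, 'z) graded_ring_scheme \<Rightarrow> 'r set \<Rightarrow> (int \<Rightarrow> 'm monoid)
    \<Rightarrow> (int \<Rightarrow> int \<Rightarrow> 'r \<Rightarrow> 'm \<Rightarrow> 'm) \<Rightarrow> int \<Rightarrow> (int \<times> 'm \<times> 'r) set set" where
  "localization R p M act d = fractions R p M d // fraction_rel R p M act d"

definition localization_is_zero :: "('r, 'z) graded_ring_scheme \<Rightarrow> 'r set \<Rightarrow> (int \<Rightarrow> 'm monoid)
    \<Rightarrow> (int \<Rightarrow> int \<Rightarrow> 'r \<Rightarrow> 'm \<Rightarrow> 'm) \<Rightarrow> bool" where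
  "localization_is_zero R p M act \<longleftrightarrow> (\<forall>d. localization R p M act d =
     {fraction_rel R p M act d `` {(0, \<one>\<^bsub>M d\<^esub>, \<one>\<^bsub>R\<^esub>)}})"


section \<open>Linear triangulated categories\<close>

definition center :: "('o, 'm, 'z) triangulated_category_scheme \<Rightarrow> int \<Rightarrow> ('o \<Rightarrow> 'm) set" where
  "center T n = {\<eta> \<in> (\<Pi>\<^sub>E X \<in> Ob T. Hom T X (shift T n X)).
     (\<forall>X Y f. f \<in> Hom T X Y \<longrightarrow> shiftA T n f \<bullet>\<^bsub>T\<^esub> \<eta> X = \<eta> Y \<bullet>\<^bsub>T\<^esub> f) \<and>
     (\<forall>X \<in> Ob T. \<eta> (Susp T X) = (if even n then SuspA T (\<eta> X) else Neg T (SuspA T (\<eta> X))))}"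

definition center_add ::
  "('o, 'm, 'z) triangulated_category_scheme \<Rightarrow> ('o \<Rightarrow> 'm) \<Rightarrow> ('o \<Rightarrow> 'm) \<Rightarrow> 'o \<Rightarrow> 'm" where
  "center_add T \<eta> \<zeta> = (\<lambda>X \<in> Ob T. Add T (\<eta> X) (\<zeta> X))"

text \<open>
  The product of \<open>\<eta>\<close> with \<open>\<zeta>\<close> of degree \<open>n\<close> is the composite of \<open>\<zeta> : Id \<rightarrow> \<Sigma>\<^sup>n\<close> and
  \<open>\<Sigma>\<^sup>n\<eta>\<close>, in accordance with the product \<open>g f = \<Sigma>\<^sup>n(g) \<circ> f\<close> of graded endomorphisms,
  \<open>n\<close> being the degree of \<open>f\<close>.
\<close>

definition center_mult ::
  "('o, 'm, 'z) triangulated_category_scheme \<Rightarrow> int \<Rightarrow> ('o \<Rightarrow> 'm) \<Rightarrow> ('o \<Rightarrow> 'm) \<Rightarrow> 'o \<Rightarrow> 'm" where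
  "center_mult T n \<eta> \<zeta> = (\<lambda>X \<in> Ob T. shiftA T n (\<eta> X) \<bullet>\<^bsub>T\<^esub> \<zeta> X)"

definition center_one :: "('o, 'm, 'z) triangulated_category_scheme \<Rightarrow> 'o \<Rightarrow> 'm" where
  "center_one T = (\<lambda>X \<in> Ob T. Idn T X)"

text \<open>
  A homomorphism of graded rings from \<open>R\<close> to the graded center, given by its homogeneous
  components \<open>\<phi> n : R\<^sub>n \<rightarrow> Z\<^sup>n(T)\<close>.
\<close>

locale linear_structure =
  fixes T :: "('o, 'm, 'z) triangulated_category_scheme"
    and R :: "('r, 'y) graded_ring_scheme"
    and \<phi> :: "int \<Rightarrow> 'r \<Rightarrow> 'o \<Rightarrow> 'm"
  assumes center_closed: "r \<in> grade R n \<Longrightarrow> \<phi> n r \<in> center T n"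
    and map_add: "r \<in> grade R n \<Longrightarrow> s \<in> grade R n
      \<Longrightarrow> \<phi> n (r \<oplus>\<^bsub>R\<^esub> s) = center_add T (\<phi> n r) (\<phi> n s)"
    and map_mult: "r \<in> grade R m \<Longrightarrow> s \<in> grade R n
      \<Longrightarrow> \<phi> (m + n) (r \<otimes>\<^bsub>R\<^esub> s) = center_mult T n (\<phi> m r) (\<phi> n s)"
    and map_one: "\<phi> 0 \<one>\<^bsub>R\<^esub> = center_one T"

definition Hom_star :: "('o, 'm, 'z) triangulated_category_scheme \<Rightarrow> 'o \<Rightarrow> 'o \<Rightarrow> int \<Rightarrow> 'm monoid" where
  "Hom_star T X Y i = hom_group T X (shift T i Y)"

definition Hom_star_act :: "('o, 'm, 'z) triangulated_category_scheme \<Rightarrow> (int \<Rightarrow> 'r \<Rightarrow> 'o \<Rightarrow> 'm)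
    \<Rightarrow> 'o \<Rightarrow> int \<Rightarrow> int \<Rightarrow> 'r \<Rightarrow> 'm \<Rightarrow> 'm" where
  "Hom_star_act T \<phi> Y n i r f = shiftA T i (\<phi> n r Y) \<bullet>\<^bsub>T\<^esub> f"


section \<open>Local cohomology, support and stratification\<close>

definition torsion_objects :: "'u set \<Rightarrow> ('o, 'm, 'z) triangulated_category_scheme
    \<Rightarrow> ('r, 'y) graded_ring_scheme \<Rightarrow> (int \<Rightarrow> 'r \<Rightarrow> 'o \<Rightarrow> 'm) \<Rightarrow> 'r set set \<Rightarrow> 'o set" where
  "torsion_objects U T R \<phi> \<V> = {X \<in> Ob T. \<forall>C \<in> compact_objects U T. \<forall>p \<in> Spec R - \<V>.
     localization_is_zero R p (Hom_star T C X) (Hom_star_act T \<phi> X)}"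

text \<open>
  The localization triangle \<open>G \<rightarrow> X \<rightarrow> L \<rightarrow> \<Sigma>G\<close> of \<open>X\<close> determines the objects \<open>G\<close> and \<open>L\<close> up to
  isomorphism; the two functors below are given on objects by a choice of such a triangle.
  Their values on arrows, which are then determined, play no role in what follows.
\<close>

definition localization_triangle :: "'u set \<Rightarrow> ('o, 'm, 'z) triangulated_category_scheme
    \<Rightarrow> ('r, 'y) graded_ring_scheme \<Rightarrow> (int \<Rightarrow> 'r \<Rightarrow> 'o \<Rightarrow> 'm) \<Rightarrow> 'r set set \<Rightarrow> 'o \<Rightarrow> 'o \<times> 'o \<Rightarrow> bool" where
  "localization_triangle U T R \<phi> \<V> X = (\<lambda>(G, L).
     (\<exists>f g h. exact_triangle T G X L f g h) \<and> G \<in> torsion_objects U T R \<phi> \<V> \<and>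
     (\<forall>Y \<in> torsion_objects U T R \<phi> \<V>. Hom T Y L = {Nul T Y L}))"

definition Gam :: "'u set \<Rightarrow> ('o, 'm, 'z) triangulated_category_scheme
    \<Rightarrow> ('r, 'y) graded_ring_scheme \<Rightarrow> (int \<Rightarrow> 'r \<Rightarrow> 'o \<Rightarrow> 'm) \<Rightarrow> 'r set set \<Rightarrow> 'o \<Rightarrow> 'o" where
  "Gam U T R \<phi> \<V> X = fst (SOME P. localization_triangle U T R \<phi> \<V> X P)"

definition Lfun :: "'u set \<Rightarrow> ('o, 'm, 'z) triangulated_category_scheme
    \<Rightarrow> ('r, 'y) graded_ring_scheme \<Rightarrow> (int \<Rightarrow> 'r \<Rightarrow> 'o \<Rightarrow> 'm) \<Rightarrow> 'r set set \<Rightarrow> 'o \<Rightarrow> 'o" where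
  "Lfun U T R \<phi> \<V> X = snd (SOME P. localization_triangle U T R \<phi> \<V> X P)"

definition Gam_at :: "'u set \<Rightarrow> ('o, 'm, 'z) triangulated_category_scheme
    \<Rightarrow> ('r, 'y) graded_ring_scheme \<Rightarrow> (int \<Rightarrow> 'r \<Rightarrow> 'o \<Rightarrow> 'm) \<Rightarrow> 'r set \<Rightarrow> 'o \<Rightarrow> 'o" where
  "Gam_at U T R \<phi> p X = Gam U T R \<phi> (Vset R p) (Lfun U T R \<phi> (Zset R p) X)"

definition Gam_at_image :: "'u set \<Rightarrow> ('o, 'm, 'z) triangulated_category_scheme
    \<Rightarrow> ('r, 'y) graded_ring_scheme \<Rightarrow> (int \<Rightarrow> 'r \<Rightarrow> 'o \<Rightarrow> 'm) \<Rightarrow> 'r set \<Rightarrow> 'o set" where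
  "Gam_at_image U T R \<phi> p = {Y \<in> Ob T. \<exists>X \<in> Ob T. iso_obj T Y (Gam_at U T R \<phi> p X)}"

definition supp :: "'u set \<Rightarrow> ('o, 'm, 'z) triangulated_category_scheme
    \<Rightarrow> ('r, 'y) graded_ring_scheme \<Rightarrow> (int \<Rightarrow> 'r \<Rightarrow> 'o \<Rightarrow> 'm) \<Rightarrow> 'o \<Rightarrow> 'r set set" where
  "supp U T R \<phi> X = {p \<in> Spec R. \<not> zero_obj T (Gam_at U T R \<phi> p X)}"

definition supp_subcat :: "'u set \<Rightarrow> ('o, 'm, 'z) triangulated_category_scheme
    \<Rightarrow> ('r, 'y) graded_ring_scheme \<Rightarrow> (int \<Rightarrow> 'r \<Rightarrow> 'o \<Rightarrow> 'm) \<Rightarrow> 'o set \<Rightarrow> 'r set set" where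
  "supp_subcat U T R \<phi> S = (\<Union>X \<in> S. supp U T R \<phi> X)"

definition supp_inv :: "'u set \<Rightarrow> ('o, 'm, 'z) triangulated_category_scheme
    \<Rightarrow> ('r, 'y) graded_ring_scheme \<Rightarrow> (int \<Rightarrow> 'r \<Rightarrow> 'o \<Rightarrow> 'm) \<Rightarrow> 'r set set \<Rightarrow> 'o set" where
  "supp_inv U T R \<phi> \<U> = {X \<in> Ob T. supp U T R \<phi> X \<subseteq> \<U>}"

definition local_global_principle :: "'u set \<Rightarrow> ('o, 'm, 'z) triangulated_category_scheme
    \<Rightarrow> ('r, 'y) graded_ring_scheme \<Rightarrow> (int \<Rightarrow> 'r \<Rightarrow> 'o \<Rightarrow> 'm) \<Rightarrow> bool" where
  "local_global_principle U T R \<phi> \<longleftrightarrow>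
     (\<forall>X \<in> Ob T. Loc U T {X} = Loc U T {Gam_at U T R \<phi> p X | p. p \<in> Spec R})"

definition zero_subcat :: "('o, 'm, 'z) category_scheme \<Rightarrow> 'o set \<Rightarrow> bool" where
  "zero_subcat T S \<longleftrightarrow> (\<forall>X \<in> S. zero_obj T X)"

definition minimal_subcat :: "'u set \<Rightarrow> ('o, 'm, 'z) triangulated_category_scheme \<Rightarrow> 'o set \<Rightarrow> bool" where
  "minimal_subcat U T S \<longleftrightarrow> localizing U T S \<and> \<not> zero_subcat T S \<and>
     (\<forall>S'. localizing U T S' \<and> S' \<subseteq> S \<and> \<not> zero_subcat T S' \<longrightarrow> S' = S)"

definition stratified :: "'u set \<Rightarrow> ('o, 'm, 'z) triangulated_category_scheme
    \<Rightarrow> ('r, 'y) graded_ring_scheme \<Rightarrow> (int \<Rightarrow> 'r \<Rightarrow> 'o \<Rightarrow> 'm) \<Rightarrow> bool" where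
  "stratified U T R \<phi> \<longleftrightarrow> local_global_principle U T R \<phi> \<and>
     (\<forall>p \<in> Spec R. zero_subcat T (Gam_at_image U T R \<phi> p) \<or>
        minimal_subcat U T (Gam_at_image U T R \<phi> p))"

end

theory Submission
  imports Defs
begin

text \<open>
  An arrow \<open>x\<close> is \<open>p\<close>-torsion if a homogeneous \<open>s \<notin> p\<close> annihilates it.  Everything is
  reduced to torsion of arrows out of Koszul objects, that is, iterated cones of homogeneous
  elements on the compact generators.  They form a small set, and those contained in \<open>T\<^sub>V\<close>
  generate \<open>T\<^sub>V\<close>: given a nonzero arrow \<open>D \<rightarrow> L\<close> with \<open>L \<in> T\<^sub>V\<close> and \<open>D \<notin> T\<^sub>V\<close>, some \<open>s\<close>
  outside a prime \<open>q \<notin> V\<close> in the support of \<open>D\<close> annihilates it, so that it factors through the cone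
  of \<open>s\<close> on \<open>D\<close>; the noetherian condition stops this process.  A telescope then gives
  the localization triangles.  The vanishing of the local cohomology of \<open>X\<close> at \<open>p\<close> turns out to
  mean that every arrow to \<open>X\<close> from a Koszul object in \<open>T\<^bsub>V(p)\<^esub>\<close> is \<open>p\<close>-torsion.  Hence it is a
  localizing condition on \<open>X\<close>, and the objects in the image of local cohomology at \<open>p\<close>, which
  are the \<open>p\<close>-local objects of \<open>T\<^bsub>V(p)\<^esub>\<close>, have support \<open>{p}\<close> or are zero.  The theorem
  follows formally from these two facts.
\<close>

section \<open>Additive categories\<close>

text \<open>The obstacle is that \<open>Gam_at\<close> is only a choice of objects. It has no values
  on arrows, so neither exactness nor compatibility with coproducts is available to show that the
  objects \<open>X\<close> with \<open>Gam_at U T R \<phi> p X\<close> zero form a localizing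
  subcategory. The criterion \<open>zero_Gam_at_iff\<close> replaces both: passing from
  \<open>X\<close> to its localization at \<open>Zset R p\<close> does not change whether arrows
  from Koszul objects are \<open>p\<close>-torsion, and an arrow into a \<open>p\<close>-local
  object is \<open>p\<close>-torsion only if it is zero. Torsion is a property of single arrows, so
  no localized modules are carried along and the signs of graded commutativity disappear: an arrow
  and its negative have the same annihilators. Koszul objects with chosen cones replace the compact
  objects because the latter, with all their isomorphic copies, need not form a small set, while the
  telescope needs coproducts indexed by all arrows out of the test objects. Smallness of
  \<open>carrier R\<close> enters here. Compactness of the generators is used in the form
  \<open>finitary\<close>, which is inherited by shifts and cones.\<close>

context category
begin

lemma Hom_dom: "f \<in> Hom T X Y \<Longrightarrow> X \<in> Ob T"
  and Hom_cod: "f \<in> Hom T X Y \<Longrightarrow> Y \<in> Ob T"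
  and Hom_arr: "f \<in> Hom T X Y \<Longrightarrow> f \<in> Arr T"
  unfolding Hom_def using dom_closed cod_closed by auto

end

context additive_category
begin

lemma carrier_hom_group [simp]: "carrier (hom_group T X Y) = Hom T X Y"
  and mult_hom_group [simp]: "monoid.mult (hom_group T X Y) = Add T"
  and one_hom_group [simp]: "one (hom_group T X Y) = Nul T X Y"
  by (simp_all add: hom_group_def)

lemma nul_closed: assumes "X \<in> Ob T" "Y \<in> Ob T" shows "Nul T X Y \<in> Hom T X Y"
proof -
  interpret H: comm_group "hom_group T X Y" using assms hom_comm_group by blast
  show ?thesis using H.one_closed by simp
qed

lemma hom_abelian: "f \<in> Hom T X Y \<Longrightarrow> comm_group (hom_group T X Y)"
  using hom_comm_group Hom_dom Hom_cod by metis

lemma add_closed: 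
  assumes "f \<in> Hom T X Y" "g \<in> Hom T X Y" shows "Add T f g \<in> Hom T X Y"
proof -
  interpret H: comm_group "hom_group T X Y" using assms hom_abelian by blast
  show ?thesis using H.m_closed assms by simp
qed

lemma add_comm: 
  assumes "f \<in> Hom T X Y" "g \<in> Hom T X Y" shows "Add T f g = Add T g f"
proof -
  interpret H: comm_group "hom_group T X Y" using assms hom_abelian by blast
  show ?thesis using H.m_comm assms by simp
qed

lemma add_nul: 
  assumes "f \<in> Hom T X Y"
  shows "Add T f (Nul T X Y) = f" "Add T (Nul T X Y) f = f"
proof -
  interpret H: comm_group "hom_group T X Y" using assms hom_abelian by blast
  show "Add T f (Nul T X Y) = f" "Add T (Nul T X Y) f = f"
    using H.r_one H.l_one assms by simp_all
qed

lemma Neg_eq: "f \<in> Hom T X Y \<Longrightarrow> Neg T f = inv\<^bsub>hom_group T X Y\<^esub> f"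
  by (auto simp: Neg_def Hom_def)

lemma neg_closed:
  assumes "f \<in> Hom T X Y" shows "Neg T f \<in> Hom T X Y"
proof -
  interpret H: comm_group "hom_group T X Y" using assms hom_abelian by blast
  show ?thesis using H.inv_closed assms by (simp add: Neg_eq)
qed

lemma add_neg:
  assumes "f \<in> Hom T X Y"
  shows "Add T f (Neg T f) = Nul T X Y"
proof -
  interpret H: comm_group "hom_group T X Y" using assms hom_abelian by blast
  show ?thesis using H.r_inv[of f] assms by (simp add: Neg_eq)
qed

lemma add_eq_nul_imp_neg:
  assumes "f \<in> Hom T X Y" "g \<in> Hom T X Y" "Add T f g = Nul T X Y"
  shows "f = Neg T g"
proof -
  interpret H: comm_group "hom_group T X Y" using assms hom_abelian by blast
  show ?thesis using H.inv_equality[of f g] assms by (simp add: Neg_eq)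
qed

lemma add_eq_self:
  assumes "f \<in> Hom T X Y" "g \<in> Hom T X Y" "Add T f g = f"
  shows "g = Nul T X Y"
proof -
  interpret H: comm_group "hom_group T X Y" using assms hom_abelian by blast
  show ?thesis using H.l_cancel_one[of f g] assms H.r_cancel_one[of f g] H.m_comm[of f g] by simp
qed

lemma neg_neg: assumes "f \<in> Hom T X Y" shows "Neg T (Neg T f) = f"
  by (metis add_comm add_eq_nul_imp_neg add_neg assms neg_closed)

lemma neg_nul: assumes "X \<in> Ob T" "Y \<in> Ob T" shows "Neg T (Nul T X Y) = Nul T X Y"
  by (metis add_eq_nul_imp_neg add_nul(1) assms nul_closed)

lemma neg_eq_nul: "f \<in> Hom T X Y \<Longrightarrow> Neg T f = Nul T X Y \<Longrightarrow> f = Nul T X Y"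
  by (metis neg_neg neg_nul Hom_dom Hom_cod)

lemma diff_eq_nul: 
  assumes "f \<in> Hom T X Y" "g \<in> Hom T X Y" "Add T f (Neg T g) = Nul T X Y"
  shows "f = g"
  using add_eq_nul_imp_neg[OF assms(1) neg_closed[OF assms(2)] assms(3)] neg_neg[OF assms(2)] by simp

lemma cmp_nul: assumes "g \<in> Hom T Y Z" "X \<in> Ob T" shows "g \<bullet> Nul T X Y = Nul T X Z"
proof -
  have n: "Nul T X Y \<in> Hom T X Y" using assms nul_closed Hom_dom by blast
  have "Add T (g \<bullet> Nul T X Y) (g \<bullet> Nul T X Y) = g \<bullet> Nul T X Y"
    using cmp_add_right[OF n n assms(1)] add_nul(1)[OF n] by simp
  then show ?thesis using add_eq_self cmp_closed[OF n assms(1)] by blast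
qed

lemma nul_cmp: assumes "f \<in> Hom T X Y" "Z \<in> Ob T" shows "Nul T Y Z \<bullet> f = Nul T X Z"
proof -
  have n: "Nul T Y Z \<in> Hom T Y Z" using assms nul_closed Hom_cod by blast
  have "Add T (Nul T Y Z \<bullet> f) (Nul T Y Z \<bullet> f) = Nul T Y Z \<bullet> f"
    using cmp_add_left[OF assms(1) n n] add_nul(1)[OF n] by simp
  then show ?thesis using add_eq_self cmp_closed[OF assms(1) n] by blast
qed

lemma cmp_neg: assumes "f \<in> Hom T X Y" "g \<in> Hom T Y Z" shows "g \<bullet> Neg T f = Neg T (g \<bullet> f)"
proof -
  have "Add T (g \<bullet> f) (g \<bullet> Neg T f) = Nul T X Z"
    using cmp_add_right[OF assms(1) neg_closed[OF assms(1)] assms(2)] assms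
    by (metis add_neg cmp_nul Hom_dom)
  then show ?thesis
    by (metis add_comm add_eq_nul_imp_neg assms cmp_closed neg_closed)
qed

lemma neg_cmp: assumes "f \<in> Hom T X Y" "g \<in> Hom T Y Z" shows "Neg T g \<bullet> f = Neg T (g \<bullet> f)"
proof -
  have "Add T (g \<bullet> f) (Neg T g \<bullet> f) = Nul T X Z"
    using cmp_add_left[OF assms(1) assms(2) neg_closed[OF assms(2)]] assms
    by (metis add_neg nul_cmp Hom_cod)
  then show ?thesis
    by (metis add_comm add_eq_nul_imp_neg assms cmp_closed neg_closed)
qed

lemma zero_obj_ob: "zero_obj T Z \<Longrightarrow> Z \<in> Ob T"
  by (simp add: zero_obj_def)

lemma into_zero: assumes "zero_obj T Z" "f \<in> Hom T X Z" shows "f = Nul T X Z"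
proof -
  have X: "X \<in> Ob T" and "Nul T X Z \<in> Hom T X Z" using assms nul_closed Hom_dom Hom_cod by blast+
  moreover have "\<exists>!f. f \<in> Hom T X Z" using assms(1) X by (simp add: zero_obj_def)
  ultimately show ?thesis using assms(2) by auto
qed

lemma from_zero: assumes "zero_obj T Z" "f \<in> Hom T Z X" shows "f = Nul T Z X"
proof -
  have X: "X \<in> Ob T" and "Nul T Z X \<in> Hom T Z X" using assms nul_closed Hom_dom Hom_cod by blast+
  moreover have "\<exists>!f. f \<in> Hom T Z X" using assms(1) X by (simp add: zero_obj_def)
  ultimately show ?thesis using assms(2) by auto
qed

lemma zero_objI: 
  assumes Z: "Z \<in> Ob T" and eq: "Idn T Z = Nul T Z Z" shows "zero_obj T Z"
proof -
  have "f = Nul T X Z" if "f \<in> Hom T X Z" for f X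
    using that eq idn_left nul_cmp Z by metis
  moreover have "f = Nul T Z X" if "f \<in> Hom T Z X" for f X
    using that eq idn_right cmp_nul Z by metis
  ultimately show ?thesis unfolding zero_obj_def using Z nul_closed by blast
qed

lemma zero_obj_iff: "Z \<in> Ob T \<Longrightarrow> zero_obj T Z \<longleftrightarrow> Idn T Z = Nul T Z Z"
  using zero_objI into_zero idn_closed by blast

end

section \<open>Triangulated categories\<close>

context triangulated_category
begin

section \<open>The suspension on objects and typed arrows\<close>

lemma susp_ob: "X \<in> Ob T \<Longrightarrow> Susp T X \<in> Ob T"
  using susp_bij by (auto simp: bij_betw_def)

lemma susp_inj: "X \<in> Ob T \<Longrightarrow> Y \<in> Ob T \<Longrightarrow> Susp T X = Susp T Y \<Longrightarrow> X = Y"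
  using susp_bij by (auto simp: bij_betw_def inj_on_def)

lemma susp_surj: assumes "Z \<in> Ob T" obtains W where "W \<in> Ob T" "Susp T W = Z"
proof -
  have "Z \<in> Susp T ` Ob T" using bij_betw_imp_surj_on[OF susp_bij] assms by simp
  then show ?thesis using that by blast
qed

lemma suspA_inj: "f \<in> Arr T \<Longrightarrow> g \<in> Arr T \<Longrightarrow> SuspA T f = SuspA T g \<Longrightarrow> f = g"
  using suspA_bij by (auto simp: bij_betw_def inj_on_def)

text \<open>\<open>SuspA\<close> is only assumed bijective on the set of all arrows; injectivity of
  \<open>Susp\<close> on objects recovers the domain and codomain of a preimage.\<close>

lemma suspA_reflect: 
  assumes "g \<in> Arr T" "SuspA T g \<in> Hom T (Susp T X) (Susp T Y)" "X \<in> Ob T" "Y \<in> Ob T" 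
  shows "g \<in> Hom T X Y"
proof -
  have g: "g \<in> Hom T (Dom T g) (Cod T g)" using assms by (simp add: Hom_def)
  then have "SuspA T g \<in> Hom T (Susp T (Dom T g)) (Susp T (Cod T g))" by (rule suspA_hom)
  with assms(2) have "Susp T X = Susp T (Dom T g)" "Susp T Y = Susp T (Cod T g)" 
    by (auto simp: Hom_def)
  then show ?thesis using g susp_inj assms Hom_dom Hom_cod by metis
qed

lemma suspA_surj:
  assumes "f \<in> Hom T (Susp T X) (Susp T Y)" "X \<in> Ob T" "Y \<in> Ob T"
  obtains g where "g \<in> Hom T X Y" "SuspA T g = f"
proof -
  have "f \<in> SuspA T ` Arr T" using suspA_bij assms(1) by (auto simp: bij_betw_def Hom_def)
  then show ?thesis using suspA_reflect assms that by blast
qed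

lemma suspA_nul: assumes "X \<in> Ob T" "Y \<in> Ob T"
  shows "SuspA T (Nul T X Y) = Nul T (Susp T X) (Susp T Y)"
proof -
  have n: "Nul T X Y \<in> Hom T X Y" using assms nul_closed by blast
  have "Add T (SuspA T (Nul T X Y)) (SuspA T (Nul T X Y)) = SuspA T (Nul T X Y)"
    using suspA_add[OF n n] add_nul(1)[OF n] by simp
  then show ?thesis using add_eq_self suspA_hom[OF n] by blast
qed

lemma suspA_neg: assumes "f \<in> Hom T X Y" shows "SuspA T (Neg T f) = Neg T (SuspA T f)"
proof -
  have "Add T (SuspA T f) (SuspA T (Neg T f)) = Nul T (Susp T X) (Susp T Y)"
    using suspA_add[OF assms neg_closed[OF assms]] add_neg[OF assms] suspA_nul Hom_dom Hom_cod assms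
    by metis
  then show ?thesis 
    by (metis add_comm add_eq_nul_imp_neg assms suspA_hom neg_closed)
qed

lemma suspA_eq_nul: "f \<in> Hom T X Y \<Longrightarrow> SuspA T f = Nul T (Susp T X) (Susp T Y) \<Longrightarrow> f = Nul T X Y"
  by (metis suspA_inj suspA_nul Hom_arr Hom_dom Hom_cod nul_closed)

lemma susp_zero_iff: assumes "X \<in> Ob T" shows "zero_obj T (Susp T X) \<longleftrightarrow> zero_obj T X"
  using assms
  by (metis idn_closed suspA_eq_nul suspA_idn suspA_nul susp_ob zero_obj_iff)

section \<open>Exactness of Hom along a triangle\<close>

lemma exact_triangleD:
  assumes "exact_triangle T X Y Z f g h"
  shows "f \<in> Hom T X Y" "g \<in> Hom T Y Z" "h \<in> Hom T Z (Susp T X)"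
    "X \<in> Ob T" "Y \<in> Ob T" "Z \<in> Ob T"
  using assms Hom_dom Hom_cod by (auto simp: exact_triangle_def triangle_def)

lemma tri_rot: "exact_triangle T X Y Z f g h \<Longrightarrow> exact_triangle T Y Z (Susp T X) g h (Neg T (SuspA T f))"
  using tri_rotate exact_triangle_def by metis

lemma tri_rot_back:
  assumes e: "exact_triangle T X Y Z f g h"
  obtains W k where "W \<in> Ob T" "Susp T W = Z" "k \<in> Hom T W X" "SuspA T k = Neg T h"
    "exact_triangle T W X Y k f g"
proof -
  note d = exact_triangleD[OF e]
  obtain W where W: "W \<in> Ob T" "Susp T W = Z" using susp_surj d by metis
  obtain k where k: "k \<in> Hom T W X" "SuspA T k = Neg T h" 
    using suspA_surj[of "Neg T h" W X] neg_closed[OF d(3)] W d by blast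
  have "triangle T W X Y k f g" using k d W by (simp add: triangle_def)
  then have "exact_triangle T W X Y k f g" 
    using tri_rotate[of W X Y k f g] e k W neg_neg[OF d(3)] by simp
  then show ?thesis using that W k by blast
qed

text \<open>The pair (identity, \<open>f\<close>) extends to a morphism from the triangle on
  \<open>Idn T X\<close>, whose third object is zero; hence \<open>g \<bullet> f\<close> factors
  through zero.\<close>

lemma tri_comp_zero: 
  assumes e: "exact_triangle T X Y Z f g h" shows "g \<bullet> f = Nul T X Z"
proof -
  note d = exact_triangleD[OF e]
  obtain Z0 where Z0: "zero_obj T Z0" using ex_zero_obj by blast
  have i: "exact_triangle T X X Z0 (Idn T X) (Nul T X Z0) (Nul T Z0 (Susp T X))" 
    using tri_idn Z0 d by blast
  obtain c where c: "c \<in> Hom T Z0 Z" "c \<bullet> Nul T X Z0 = g \<bullet> f"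
    using tri_morphism[OF i e idn_closed[OF d(4)] d(1)] by blast
  then show ?thesis using cmp_nul d by metis
qed

text \<open>\<open>tri_morphism\<close> completes the third arrow, whereas \<open>y\<close> belongs
  in the first place. Both triangles are therefore rotated: \<open>C\<close> is compared with
  \<open>Y\<close> and zero with \<open>Z\<close>, and the completing arrow is the suspension of
  \<open>y\<close>.\<close>

lemma tri_cov:
  assumes e: "exact_triangle T X Y Z f g h" and x: "x \<in> Hom T C Y" and 0: "g \<bullet> x = Nul T C Z"
  obtains y where "y \<in> Hom T C X" "x = f \<bullet> y"
proof -
  note d = exact_triangleD[OF e]
  have C: "C \<in> Ob T" using x Hom_dom by blast
  obtain Z0 where Z0: "zero_obj T Z0" using ex_zero_obj by blast
  have i: "exact_triangle T C Z0 (Susp T C) (Nul T C Z0) (Nul T Z0 (Susp T C)) (Neg T (SuspA T (Idn T C)))" 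
    using tri_rot tri_idn Z0 C by blast
  have OZ: "Nul T Z0 Z \<in> Hom T Z0 Z" using nul_closed Z0 d zero_obj_ob by blast
  have "Nul T Z0 Z \<bullet> Nul T C Z0 = g \<bullet> x" using cmp_nul[OF OZ C] 0 by simp
  then obtain c where c: "c \<in> Hom T (Susp T C) (Susp T X)" 
      "SuspA T x \<bullet> Neg T (SuspA T (Idn T C)) = Neg T (SuspA T f) \<bullet> c"
    using tri_morphism[OF i tri_rot[OF e] x OZ] by blast
  obtain y where y: "y \<in> Hom T C X" "SuspA T y = c" using suspA_surj[OF c(1)] C d by blast
  have "SuspA T x \<bullet> Neg T (SuspA T (Idn T C)) = Neg T (SuspA T x)"
    using cmp_neg[OF suspA_hom[OF idn_closed[OF C]] suspA_hom[OF x]] suspA_cmp[OF idn_closed[OF C] x]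
      idn_right[OF x] by simp
  moreover have "Neg T (SuspA T f) \<bullet> c = Neg T (SuspA T (f \<bullet> y))"
    using neg_cmp[OF c(1) suspA_hom[OF d(1)]] suspA_cmp[OF y(1) d(1)] y(2) by simp
  ultimately have "Neg T (SuspA T x) = Neg T (SuspA T (f \<bullet> y))" using c(2) by simp
  then have "SuspA T x = SuspA T (f \<bullet> y)" 
    using neg_neg suspA_hom x y d cmp_closed by metis
  then have "x = f \<bullet> y" using suspA_inj Hom_arr x y d cmp_closed by metis
  then show ?thesis using that y by blast
qed

lemma tri_contra:
  assumes e: "exact_triangle T X Y Z f g h" and x: "x \<in> Hom T Y W" and 0: "x \<bullet> f = Nul T X W"
  obtains y where "y \<in> Hom T Z W" "x = y \<bullet> g"
proof -
  note d = exact_triangleD[OF e]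
  have W: "W \<in> Ob T" using x Hom_cod by blast
  obtain Z0 where Z0: "zero_obj T Z0" using ex_zero_obj by blast
  \<comment> \<open>The identity of \<open>W\<close> has to be the second arrow of the comparison
    triangle, so the triangle of \<open>Idn T W\<close> is rotated back; its first object is a
    desuspension of zero.\<close>
  obtain Z0' where Z0': "zero_obj T Z0'" "Susp T Z0' = Z0"
    using Z0 susp_zero_iff susp_surj zero_obj_ob by metis
  have i: "exact_triangle T W W (Susp T Z0') (Idn T W) (Nul T W Z0) (Nul T Z0 (Susp T W))"
    using tri_idn[OF W Z0] Z0' by simp
  obtain k where k: "k \<in> Hom T Z0' W" "exact_triangle T Z0' W W k (Idn T W) (Nul T W Z0)"
    using tri_rot_back[OF i] Z0' susp_inj zero_obj_ob by metis
  have XO: "Nul T X Z0' \<in> Hom T X Z0'" using nul_closed d Z0' zero_obj_ob by blast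
  have "x \<bullet> f = k \<bullet> Nul T X Z0'" using 0 cmp_nul[OF k(1) d(4)] by simp
  then obtain c where "c \<in> Hom T Z W" "c \<bullet> g = Idn T W \<bullet> x"
    using tri_morphism[OF e k(2) XO x] by blast
  then show ?thesis using that idn_left[OF x] by metis
qed

lemma tri_fiber:
  assumes "f \<in> Hom T X Y"
  obtains W k h where "exact_triangle T W X Y k f h"
  using tri_cone[OF assms] tri_rot_back by metis

lemma tri_iso_cone_zero:
  assumes e: "exact_triangle T X Y Z f g h" and Z: "zero_obj T Z"
  shows "is_iso_arr T X Y f"
proof -
  note d = exact_triangleD[OF e]
  have "g \<bullet> Idn T Y = Nul T Y Z" using into_zero[OF Z] cmp_closed idn_closed d by blast
  then obtain y where y: "y \<in> Hom T Y X" "Idn T Y = f \<bullet> y"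
    using tri_cov[OF e idn_closed] d by metis
  obtain W k where W: "W \<in> Ob T" "Susp T W = Z" "k \<in> Hom T W X" "exact_triangle T W X Y k f g"
    using tri_rot_back[OF e] by blast
  have "zero_obj T W" using Z W susp_zero_iff by blast
  then have "Idn T X \<bullet> k = Nul T W X" using from_zero cmp_closed idn_closed d W by blast
  then obtain y' where y': "y' \<in> Hom T Y X" "Idn T X = y' \<bullet> f"
    using tri_contra[OF W(4) idn_closed] d by metis
  have "y' = y" using y y' d
    by (metis cmp_assoc idn_left idn_right)
  then show ?thesis using y y' d by (auto simp: is_iso_arr_def)
qed

lemma tri_iso_fiber_zero:
  assumes e: "exact_triangle T X Y Z f g h" and X: "zero_obj T X"
  shows "is_iso_arr T Y Z g"
  using tri_iso_cone_zero[OF tri_rot[OF e]] susp_zero_iff X zero_obj_ob by blast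

lemma iso_triangle: 
  assumes "is_iso_arr T X Y f" "zero_obj T Z"
  shows "exact_triangle T X Y Z f (Nul T Y Z) (Nul T Z (Susp T X))"
proof -
  have f: "f \<in> Hom T X Y" using assms by (simp add: is_iso_arr_def)
  have ob: "X \<in> Ob T" "Y \<in> Ob T" "Z \<in> Ob T" "Susp T X \<in> Ob T" 
    using f assms Hom_dom Hom_cod zero_obj_ob susp_ob by blast+
  have id: "is_iso_arr T A A (Idn T A)" if "A \<in> Ob T" for A 
    using that idn_closed idn_left unfolding is_iso_arr_def by blast
  have "exact_triangle T X X Z (Idn T X) (Nul T X Z) (Nul T Z (Susp T X))"
    using tri_idn ob assms by blast
  then show ?thesis
    by (rule tri_iso[OF _ _ id assms(1) id])
      (use ob f in \<open>simp_all add: triangle_def nul_closed nul_cmp cmp_nul[OF idn_closed] suspA_idn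
         idn_right[OF nul_closed] cmp_nul[OF suspA_hom, OF idn_closed] idn_closed susp_ob\<close>)
qed

text \<open>Closure under extensions suffices: rotation puts each of the three objects of a triangle
  in the middle, up to a suspension.\<close>

lemma localizingI:
  fixes U :: "'u set"
  assumes "S \<subseteq> Ob T" and zero: "\<And>Z. zero_obj T Z \<Longrightarrow> Z \<in> S"
    and susp: "\<And>X. X \<in> Ob T \<Longrightarrow> X \<in> S \<longleftrightarrow> Susp T X \<in> S"
    and ext: "\<And>X Y Z f g h. exact_triangle T X Y Z f g h \<Longrightarrow> X \<in> S \<Longrightarrow> Z \<in> S \<Longrightarrow> Y \<in> S"
    and cop: "\<And>(I :: 'u set) X C \<iota>. small U I \<Longrightarrow> \<forall>i \<in> I. X i \<in> S \<Longrightarrow> is_coproduct T I X C \<iota> \<Longrightarrow> C \<in> S"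
  shows "localizing U T S"
proof -
  have "triangulated_subcategory T S"
    unfolding triangulated_subcategory_def
  proof (intro conjI allI ballI impI)
    fix X Y Z f g h assume e: "exact_triangle T X Y Z f g h"
    note d = exact_triangleD[OF e]
    show "Z \<in> S" if "X \<in> S \<and> Y \<in> S" using ext[OF tri_rot[OF e]] that susp d by blast
    show "Y \<in> S" if "X \<in> S \<and> Z \<in> S" using ext[OF e] that by blast
    obtain W k where W: "W \<in> Ob T" "Susp T W = Z" "exact_triangle T W X Y k f g"
      using tri_rot_back[OF e] by blast
    show "X \<in> S" if "Y \<in> S \<and> Z \<in> S" using ext[OF W(3)] that W susp by blast
  qed (use assms(1) zero susp in auto)
  then show ?thesis unfolding localizing_def using cop by blast
qed

end

section \<open>Iterated suspensions\<close>

text \<open>The common shape of \<open>shift\<close> and \<open>shiftA\<close>, so that the laws of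
  integer powers are proved once for objects and arrows.\<close>

definition ziter :: "('a \<Rightarrow> 'a) \<Rightarrow> 'a set \<Rightarrow> int \<Rightarrow> 'a \<Rightarrow> 'a" where
  "ziter f A n = (if 0 \<le> n then f ^^ nat n else inv_into A f ^^ nat (- n))"

lemma ziter_0: "ziter f A 0 x = x"
  by (simp add: ziter_def)

lemma ziter_closed: 
  assumes "bij_betw f A A" "x \<in> A" shows "ziter f A n x \<in> A"
proof -
  have f: "f y \<in> A" and g: "inv_into A f y \<in> A" if "y \<in> A" for y
    using assms(1) that bij_betw_apply bij_betw_inv_into by fast+
  have "(f ^^ k) x \<in> A" "(inv_into A f ^^ k) x \<in> A" for k
    using assms(2) f g by (induction k) auto
  then show ?thesis by (simp add: ziter_def)
qed

lemma ziter_Suc: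
  assumes "bij_betw f A A" "x \<in> A" shows "ziter f A (n + 1) x = f (ziter f A n x)"
proof (cases "0 \<le> n")
  case True
  then have "nat (n + 1) = Suc (nat n)" by simp
  then show ?thesis using True by (simp add: ziter_def)
next
  case False
  define m where "m = nat (- (n + 1))"
  have m: "nat (- n) = Suc m" "n + 1 = - int m" using False by (auto simp: m_def)
  have 1: "ziter f A (n + 1) x = (inv_into A f ^^ m) x" using False m by (auto simp: ziter_def)
  have "ziter f A n x = inv_into A f (ziter f A (n + 1) x)"
    unfolding 1 using m False by (simp add: ziter_def)
  moreover have "ziter f A (n + 1) x \<in> A" using ziter_closed assms by metis
  ultimately show ?thesis using f_inv_into_f assms(1) by (metis bij_betw_imp_surj_on)
qed

text \<open>The equivalence serves as induction step in both directions, which spares a separate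
  treatment of negative shifts.\<close>

lemma int_shift_induct:
  fixes P :: "int \<Rightarrow> bool"
  assumes "P 0" "\<And>n. P n \<longleftrightarrow> P (n + 1)" shows "P n"
proof (induction n rule: int_induct[where k = 0])
  case (step2 i) then show ?case using assms(2)[of "i - 1"] by simp
qed (use assms in auto)

lemma ziter_add:
  assumes "bij_betw f A A" "x \<in> A" shows "ziter f A (m + n) x = ziter f A m (ziter f A n x)"
proof (induction m rule: int_shift_induct)
  case (2 m)
  have "ziter f A (m + 1 + n) x = f (ziter f A (m + n) x)"
    using ziter_Suc[OF assms, of "m + n"] by (simp add: algebra_simps)
  moreover have "ziter f A (m + 1) (ziter f A n x) = f (ziter f A m (ziter f A n x))"
    using ziter_Suc[OF assms(1) ziter_closed[OF assms]] .
  ultimately show ?case using ziter_closed assms 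
    by (metis (no_types, lifting) bij_betw_inv_into_left)
qed (simp add: ziter_0)

context triangulated_category
begin

lemma shift_eq: "shift T n = ziter (Susp T) (Ob T) n"
  and shiftA_eq: "shiftA T n = ziter (SuspA T) (Arr T) n"
  by (simp_all add: shift_def shiftA_def ziter_def)

lemma shift_ob: "X \<in> Ob T \<Longrightarrow> shift T n X \<in> Ob T"
  and shift_0: "shift T 0 X = X"
  and shift_Suc: "X \<in> Ob T \<Longrightarrow> shift T (n + 1) X = Susp T (shift T n X)"
  and shift_add: "X \<in> Ob T \<Longrightarrow> shift T (m + n) X = shift T m (shift T n X)"
  unfolding shift_eq using ziter_closed ziter_0 ziter_Suc ziter_add susp_bij by metis+

lemma shiftA_arr: "f \<in> Arr T \<Longrightarrow> shiftA T n f \<in> Arr T"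
  and shiftA_0: "shiftA T 0 f = f"
  and shiftA_Suc: "f \<in> Arr T \<Longrightarrow> shiftA T (n + 1) f = SuspA T (shiftA T n f)"
  and shiftA_add: "f \<in> Arr T \<Longrightarrow> shiftA T (m + n) f = shiftA T m (shiftA T n f)"
  unfolding shiftA_eq using ziter_closed ziter_0 ziter_Suc ziter_add suspA_bij by metis+

lemma shift_1: "X \<in> Ob T \<Longrightarrow> shift T 1 X = Susp T X"
  using shift_Suc[of X 0] by (simp add: shift_0)

lemma shiftA_1: "f \<in> Arr T \<Longrightarrow> shiftA T 1 f = SuspA T f"
  using shiftA_Suc[of f 0] by (simp add: shiftA_0)

lemma shift_cancel: "X \<in> Ob T \<Longrightarrow> shift T (- n) (shift T n X) = X" "X \<in> Ob T \<Longrightarrow> shift T n (shift T (- n) X) = X"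
  using shift_add[of X "- n" n] shift_add[of X n "- n"] by (simp_all add: shift_0)

lemma shiftA_cancel: "f \<in> Arr T \<Longrightarrow> shiftA T (- n) (shiftA T n f) = f" "f \<in> Arr T \<Longrightarrow> shiftA T n (shiftA T (- n) f) = f"
  using shiftA_add[of f "- n" n] shiftA_add[of f n "- n"] by (simp_all add: shiftA_0)

lemma shift_susp: "X \<in> Ob T \<Longrightarrow> shift T n (Susp T X) = Susp T (shift T n X)"
  using shift_add[of X n 1] shift_Suc shift_1 by simp

lemma shiftA_hom: assumes "f \<in> Hom T X Y" shows "shiftA T n f \<in> Hom T (shift T n X) (shift T n Y)"
proof (induction n rule: int_shift_induct)
  case (2 n)
  have ob: "X \<in> Ob T" "Y \<in> Ob T" "f \<in> Arr T" using assms Hom_dom Hom_cod Hom_arr by blast+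
  show ?case unfolding shift_Suc[OF ob(1)] shift_Suc[OF ob(2)] shiftA_Suc[OF ob(3)]
    using suspA_hom suspA_reflect shift_ob shiftA_arr ob by blast
qed (simp add: shift_0 shiftA_0 assms)

lemma shiftA_cmp: assumes "f \<in> Hom T X Y" "g \<in> Hom T Y Z" 
  shows "shiftA T n (g \<bullet> f) = shiftA T n g \<bullet> shiftA T n f"
proof (induction n rule: int_shift_induct)
  case (2 n)
  have gf: "g \<bullet> f \<in> Hom T X Z" using assms cmp_closed by blast
  have ar: "f \<in> Arr T" "g \<in> Arr T" "g \<bullet> f \<in> Arr T" using assms Hom_arr gf by blast+
  have h: "shiftA T n f \<in> Hom T (shift T n X) (shift T n Y)" "shiftA T n g \<in> Hom T (shift T n Y) (shift T n Z)"
    using assms shiftA_hom by blast+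
  show ?case unfolding ar[THEN shiftA_Suc] suspA_cmp[OF h, symmetric]
    using suspA_inj shiftA_arr[OF ar(3)] Hom_arr cmp_closed h by metis
qed (simp add: shiftA_0)

lemma shiftA_idn: assumes "X \<in> Ob T" shows "shiftA T n (Idn T X) = Idn T (shift T n X)"
proof (induction n rule: int_shift_induct)
  case (2 n)
  show ?case using assms
    by (metis Hom_arr idn_closed shiftA_Suc shiftA_arr shift_Suc shift_ob suspA_idn suspA_inj)
qed (simp add: shiftA_0 shift_0)

lemma shiftA_nul: assumes "X \<in> Ob T" "Y \<in> Ob T" shows "shiftA T n (Nul T X Y) = Nul T (shift T n X) (shift T n Y)"
proof (induction n rule: int_shift_induct)
  case (2 n)
  show ?case using assms
    by (metis Hom_arr nul_closed shiftA_Suc shiftA_arr shift_Suc shift_ob suspA_nul suspA_inj)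
qed (simp add: shiftA_0 shift_0)

lemma shiftA_inj: "f \<in> Arr T \<Longrightarrow> g \<in> Arr T \<Longrightarrow> shiftA T n f = shiftA T n g \<Longrightarrow> f = g"
  by (metis shiftA_cancel(1))

lemma shiftA_eq_nul: "f \<in> Hom T X Y \<Longrightarrow> shiftA T n f = Nul T (shift T n X) (shift T n Y) \<longleftrightarrow> f = Nul T X Y"
  by (metis shiftA_inj shiftA_nul Hom_arr Hom_dom Hom_cod nul_closed)

lemma shiftA_surj:
  assumes "f \<in> Hom T (shift T n X) Y" "X \<in> Ob T"
  obtains g where "g \<in> Hom T X (shift T (- n) Y)" "shiftA T n g = f"
proof -
  have "shiftA T (- n) f \<in> Hom T X (shift T (- n) Y)" 
    using shiftA_hom[OF assms(1), of "- n"] shift_cancel assms by simp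
  then show ?thesis using that shiftA_cancel Hom_arr assms by metis
qed

lemma shift_induct:
  assumes "X \<in> Ob T" "P X" "\<And>Y. Y \<in> Ob T \<Longrightarrow> P Y \<longleftrightarrow> P (Susp T Y)" shows "P (shift T n X)"
  by (induction n rule: int_shift_induct) (use assms shift_ob in \<open>simp_all add: shift_0 shift_Suc\<close>)

lemma localizing_shift: "localizing U T S \<Longrightarrow> X \<in> S \<Longrightarrow> shift T n X \<in> S"
  using shift_induct[of X "\<lambda>X. X \<in> S"] 
  unfolding localizing_def triangulated_subcategory_def by blast

end

section \<open>Small sets\<close>

context universe
begin

lemma infinite_U: "infinite U"
  by (rule uncountable_infinite[OF uncountable_U])

lemma small_subset: "small U A \<Longrightarrow> B \<subseteq> A \<Longrightarrow> small U B"
  unfolding small_def using card_of_mono1 ordLeq_ordLess_trans by blast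

lemma small_image: "small U A \<Longrightarrow> small U (f ` A)"
  unfolding small_def using card_of_image ordLeq_ordLess_trans by blast

lemma small_embed: assumes "small U J" obtains e where "inj_on e J" "e ` J \<subseteq> U"
  using assms ordLess_imp_ordLeq card_of_ordLeq unfolding small_def by metis

lemma small_countable: assumes "countable A" shows "small U A"
proof -
  have "\<not> |U| \<le>o |UNIV :: nat set|"
    using uncountable_U by (auto simp: card_of_ordLeq[symmetric] countable_def)
  then have "|UNIV :: nat set| <o |U|"
    using not_ordLeq_iff_ordLess[OF card_of_Well_order card_of_Well_order, of U "UNIV :: nat set"] by simp
  moreover have "|A| \<le>o |UNIV :: nat set|"
    using assms by (auto simp: card_of_ordLeq[symmetric] countable_def)
  ultimately show ?thesis unfolding small_def using ordLeq_ordLess_trans by blast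
qed

text \<open>This is regularity of \<open>|U|\<close>.\<close>

lemma small_UN: 
  assumes "small U I" "\<And>i. i \<in> I \<Longrightarrow> small U (A i)" shows "small U (\<Union>i \<in> I. A i)"
proof -
  have "Cinfinite |U|" using infinite_U by (simp add: cinfinite_def Field_card_of card_of_card_order_on)
  then show ?thesis using regularCard_UNION_bound[OF _ regular_U] assms unfolding small_def by blast
qed

lemma small_Sigma: 
  assumes "small U I" "\<And>i. i \<in> I \<Longrightarrow> small U (A i)" shows "small U (Sigma I A)"
proof -
  have "Sigma I A = (\<Union>i \<in> I. Pair i ` A i)" by auto
  moreover have "small U (\<Union>i \<in> I. Pair i ` A i)" 
    by (rule small_UN[OF assms(1)]) (rule small_image[OF assms(2)])
  ultimately show ?thesis by simp
qed

lemma small_Un: assumes "small U A" "small U B" shows "small U (A \<union> B)"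
proof -
  have "A \<union> B = (\<Union>b \<in> (UNIV :: bool set). if b then A else B)" by auto
  then show ?thesis 
    using small_UN[of "UNIV :: bool set" "\<lambda>b. if b then A else B"] assms small_countable[of "UNIV :: bool set"] 
    by simp
qed

end

section \<open>Coproducts\<close>

context category
begin

lemma coproductD:
  assumes "is_coproduct T I X S \<iota>"
  shows "S \<in> Ob T" "\<And>i. i \<in> I \<Longrightarrow> X i \<in> Ob T" "\<And>i. i \<in> I \<Longrightarrow> \<iota> i \<in> Hom T (X i) S"
  using assms by (auto simp: is_coproduct_def)

lemma coproduct_map:
  assumes "is_coproduct T I X S \<iota>" "Y \<in> Ob T" "\<And>i. i \<in> I \<Longrightarrow> g i \<in> Hom T (X i) Y"
  obtains h where "h \<in> Hom T S Y" "\<And>i. i \<in> I \<Longrightarrow> h \<bullet> \<iota> i = g i"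
proof -
  have "\<exists>!h. h \<in> Hom T S Y \<and> (\<forall>i \<in> I. h \<bullet> \<iota> i = g i)" using assms by (simp add: is_coproduct_def)
  then show ?thesis using that by auto
qed

lemma coproduct_eqI:
  assumes "is_coproduct T I X S \<iota>" "h \<in> Hom T S Y" "h' \<in> Hom T S Y" 
    "\<And>i. i \<in> I \<Longrightarrow> h \<bullet> \<iota> i = h' \<bullet> \<iota> i"
  shows "h = h'"
proof -
  have "\<forall>i \<in> I. h' \<bullet> \<iota> i \<in> Hom T (X i) Y" using cmp_closed[OF coproductD(3)[OF assms(1)] assms(3)] by simp
  moreover have "\<forall>g. (\<forall>i \<in> I. g i \<in> Hom T (X i) Y) \<longrightarrow> (\<exists>!k. k \<in> Hom T S Y \<and> (\<forall>i \<in> I. k \<bullet> \<iota> i = g i))"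
    using assms(1) Hom_cod[OF assms(2)] by (simp add: is_coproduct_def)
  ultimately have "\<exists>!k. k \<in> Hom T S Y \<and> (\<forall>i \<in> I. k \<bullet> \<iota> i = h' \<bullet> \<iota> i)" by simp
  moreover have "h \<in> Hom T S Y \<and> (\<forall>i \<in> I. h \<bullet> \<iota> i = h' \<bullet> \<iota> i)" using assms by simp
  moreover have "h' \<in> Hom T S Y \<and> (\<forall>i \<in> I. h' \<bullet> \<iota> i = h' \<bullet> \<iota> i)" using assms by simp
  ultimately show ?thesis by (rule Uniq_D[OF conjunct2[OF ex1_iff_ex_Uniq[THEN iffD1]]])
qed

text \<open>The definitions speak of index sets of the element type of \<open>U\<close>. The index
  sets met later are natural numbers or sets of pairs; this transports coproducts between them and
  their copies in \<open>U\<close>.\<close>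

lemma coproduct_reindex:
  assumes c: "is_coproduct T J X S \<iota>" and \<sigma>: "bij_betw \<sigma> I J"
  shows "is_coproduct T I (X \<circ> \<sigma>) S (\<iota> \<circ> \<sigma>)"
  unfolding is_coproduct_def
proof (intro conjI ballI allI impI)
  show "S \<in> Ob T" using coproductD c by blast
  show "(X \<circ> \<sigma>) i \<in> Ob T" "(\<iota> \<circ> \<sigma>) i \<in> Hom T ((X \<circ> \<sigma>) i) S" if "i \<in> I" for i
    using coproductD[OF c] bij_betwE[OF \<sigma>] that by auto
next
  fix Y g assume Y: "Y \<in> Ob T" and g: "\<forall>i \<in> I. g i \<in> Hom T ((X \<circ> \<sigma>) i) Y"
  have g': "(g \<circ> inv_into I \<sigma>) j \<in> Hom T (X j) Y" if "j \<in> J" for j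
    using g that bij_betwE[OF bij_betw_inv_into[OF \<sigma>]] bij_betw_inv_into_right[OF \<sigma>] by force
  obtain h where h: "h \<in> Hom T S Y" "\<And>j. j \<in> J \<Longrightarrow> h \<bullet> \<iota> j = (g \<circ> inv_into I \<sigma>) j"
    using coproduct_map[OF c Y, of "g \<circ> inv_into I \<sigma>"] g' by blast
  show "\<exists>!h. h \<in> Hom T S Y \<and> (\<forall>i \<in> I. h \<bullet> (\<iota> \<circ> \<sigma>) i = g i)"
  proof (rule ex1I[of _ h])
    show "h \<in> Hom T S Y \<and> (\<forall>i \<in> I. h \<bullet> (\<iota> \<circ> \<sigma>) i = g i)"
      using h bij_betwE[OF \<sigma>] bij_betw_inv_into_left[OF \<sigma>] by auto
    fix k assume k: "k \<in> Hom T S Y \<and> (\<forall>i \<in> I. k \<bullet> (\<iota> \<circ> \<sigma>) i = g i)"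
    show "k = h"
    proof (rule coproduct_eqI[OF c])
      fix j assume j: "j \<in> J"
      then obtain i where i: "i \<in> I" "j = \<sigma> i" using bij_betw_imp_surj_on[OF \<sigma>] by blast
      show "k \<bullet> \<iota> j = h \<bullet> \<iota> j" using i k h(2)[OF j] bij_betw_inv_into_left[OF \<sigma>] by simp
    qed (use h k in auto)
  qed
qed

end

context additive_category
begin

text \<open>The idempotent of the coproduct \<open>S\<close> that keeps the summands with index in
  \<open>A\<close> and annihilates the others. It stands in for the subcoproduct over
  \<open>A\<close>, which then need not be constructed.\<close>

definition part :: "'i set \<Rightarrow> ('i \<Rightarrow> 'o) \<Rightarrow> 'o \<Rightarrow> ('i \<Rightarrow> 'm) \<Rightarrow> 'i set \<Rightarrow> 'm" where
  "part I X S \<iota> A = 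
     (THE h. h \<in> Hom T S S \<and> (\<forall>i \<in> I. h \<bullet> \<iota> i = (if i \<in> A then \<iota> i else Nul T (X i) S)))"

context
  fixes I X S and \<iota> :: "'i \<Rightarrow> 'm"
  assumes c: "is_coproduct T I X S \<iota>"
begin

lemma part: 
  shows part_closed: "part I X S \<iota> A \<in> Hom T S S"
    and part_incl: "i \<in> I \<Longrightarrow> part I X S \<iota> A \<bullet> \<iota> i = (if i \<in> A then \<iota> i else Nul T (X i) S)"
proof -
  have "\<exists>!h. h \<in> Hom T S S \<and> (\<forall>i \<in> I. h \<bullet> \<iota> i = (if i \<in> A then \<iota> i else Nul T (X i) S))"
    using c nul_closed unfolding is_coproduct_def by (auto intro: nul_closed)
  from theI'[OF this] show "part I X S \<iota> A \<in> Hom T S S"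
    "i \<in> I \<Longrightarrow> part I X S \<iota> A \<bullet> \<iota> i = (if i \<in> A then \<iota> i else Nul T (X i) S)"
    unfolding part_def by blast+
qed

lemma part_eqI:
  assumes "h \<in> Hom T S S" "\<And>i. i \<in> I \<Longrightarrow> h \<bullet> \<iota> i = (if i \<in> A then \<iota> i else Nul T (X i) S)"
  shows "h = part I X S \<iota> A"
  using coproduct_eqI[OF c assms(1) part_closed] assms(2) part_incl by simp

lemma part_all: "part I X S \<iota> I = Idn T S"
  using part_eqI[OF idn_closed] coproductD[OF c] idn_left by metis

lemma part_empty: "part I X S \<iota> {} = Nul T S S"
  by (rule part_eqI[symmetric]) (use coproductD[OF c] nul_closed nul_cmp in auto)

lemma part_cmp: "part I X S \<iota> A \<bullet> part I X S \<iota> B = part I X S \<iota> (A \<inter> B)"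
proof (rule part_eqI)
  show "part I X S \<iota> A \<bullet> part I X S \<iota> B \<in> Hom T S S" using part_closed cmp_closed by blast
  fix i assume i: "i \<in> I"
  have "(part I X S \<iota> A \<bullet> part I X S \<iota> B) \<bullet> \<iota> i = part I X S \<iota> A \<bullet> (part I X S \<iota> B \<bullet> \<iota> i)"
    using cmp_assoc[OF coproductD(3)[OF c i] part_closed part_closed] .
  then show "(part I X S \<iota> A \<bullet> part I X S \<iota> B) \<bullet> \<iota> i = (if i \<in> A \<inter> B then \<iota> i else Nul T (X i) S)"
    using i part_incl cmp_nul[OF part_closed coproductD(2)[OF c i]] by simp
qed

lemma part_add: assumes "A \<inter> B = {}"
  shows "Add T (part I X S \<iota> A) (part I X S \<iota> B) = part I X S \<iota> (A \<union> B)"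
proof (rule part_eqI)
  show "Add T (part I X S \<iota> A) (part I X S \<iota> B) \<in> Hom T S S" using part_closed add_closed by blast
  fix i assume i: "i \<in> I"
  show "Add T (part I X S \<iota> A) (part I X S \<iota> B) \<bullet> \<iota> i = (if i \<in> A \<union> B then \<iota> i else Nul T (X i) S)"
    using cmp_add_left[OF coproductD(3)[OF c i] part_closed part_closed] part_incl[OF i] assms
      add_nul nul_closed coproductD(1)[OF c] coproductD(2,3)[OF c i] by auto
qed

lemma coproduct_proj: assumes j: "j \<in> I"
  obtains \<pi> where "\<pi> \<in> Hom T S (X j)" "\<pi> \<bullet> \<iota> j = Idn T (X j)"
    "\<And>i. i \<in> I \<Longrightarrow> i \<noteq> j \<Longrightarrow> \<pi> \<bullet> \<iota> i = Nul T (X i) (X j)" "\<iota> j \<bullet> \<pi> = part I X S \<iota> {j}"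
proof -
  have ex: "(if i = j then Idn T (X j) else Nul T (X i) (X j)) \<in> Hom T (X i) (X j)" if "i \<in> I" for i
    using that j coproductD[OF c] nul_closed idn_closed by simp
  obtain \<pi> where \<pi>: "\<pi> \<in> Hom T S (X j)" 
      "\<And>i. i \<in> I \<Longrightarrow> \<pi> \<bullet> \<iota> i = (if i = j then Idn T (X j) else Nul T (X i) (X j))"
    using coproduct_map[OF c coproductD(2)[OF c j], of "\<lambda>i. if i = j then Idn T (X j) else Nul T (X i) (X j)"] ex 
    by blast
  have "\<iota> j \<bullet> \<pi> = part I X S \<iota> {j}"
  proof (rule part_eqI)
    show "\<iota> j \<bullet> \<pi> \<in> Hom T S S" using \<pi>(1) coproductD(3)[OF c j] cmp_closed by blast
    fix i assume i: "i \<in> I"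
    show "(\<iota> j \<bullet> \<pi>) \<bullet> \<iota> i = (if i \<in> {j} then \<iota> i else Nul T (X i) S)"
      using cmp_assoc[OF coproductD(3)[OF c i] \<pi>(1) coproductD(3)[OF c j]] \<pi>(2)[OF i]
        idn_right[OF coproductD(3)[OF c j]] cmp_nul[OF coproductD(3)[OF c j] coproductD(2)[OF c i]] by simp
  qed
  then show ?thesis using that[of \<pi>] \<pi> j by auto
qed

text \<open>Such an \<open>f\<close> is the finite sum of the arrows
  \<open>\<iota> j \<bullet> (\<pi> \<bullet> f)\<close> over \<open>j\<close> in \<open>F\<close>,
  with \<open>\<pi>\<close> the projection to \<open>X j\<close>.\<close>

lemma finite_part_induct:
  assumes f: "f \<in> Hom T D S" and F: "finite F" "F \<subseteq> I" "part I X S \<iota> (I - F) \<bullet> f = Nul T D S"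
    and nul: "P (Nul T D S)"
    and add: "\<And>x y. x \<in> Hom T D S \<Longrightarrow> y \<in> Hom T D S \<Longrightarrow> P x \<Longrightarrow> P y \<Longrightarrow> P (Add T x y)"
    and incl: "\<And>i x. i \<in> I \<Longrightarrow> x \<in> Hom T D (X i) \<Longrightarrow> P (\<iota> i \<bullet> x)"
  shows "P f"
proof -
  have D: "D \<in> Ob T" using f Hom_dom by blast
  have pf: "part I X S \<iota> A \<bullet> f \<in> Hom T D S" for A using cmp_closed[OF f part_closed] .
  have "P (part I X S \<iota> F \<bullet> f)" using F(1,2)
  proof (induction F rule: finite_induct)
    case empty
    then show ?case using part_empty nul_cmp[OF f] nul coproductD(1)[OF c] by simp
  next
    case (insert j F)
    then have j: "j \<in> I" by blast
    obtain \<pi> where \<pi>: "\<pi> \<in> Hom T S (X j)" "\<iota> j \<bullet> \<pi> = part I X S \<iota> {j}"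
      using coproduct_proj[OF j] by metis
    have "part I X S \<iota> {j} \<bullet> f = \<iota> j \<bullet> (\<pi> \<bullet> f)"
      using cmp_assoc[OF f \<pi>(1) coproductD(3)[OF c j]] \<pi>(2) by simp
    then have "P (part I X S \<iota> {j} \<bullet> f)" using incl[OF j cmp_closed[OF f \<pi>(1)]] by simp
    moreover have "part I X S \<iota> (insert j F) \<bullet> f = Add T (part I X S \<iota> {j} \<bullet> f) (part I X S \<iota> F \<bullet> f)"
      using part_add[of "{j}" F] insert.hyps cmp_add_left[OF f part_closed[of "{j}"] part_closed[of F]] by simp
    ultimately show ?case using add[OF pf pf] insert by simp
  qed
  moreover have "f = Add T (part I X S \<iota> F \<bullet> f) (part I X S \<iota> (I - F) \<bullet> f)"
    using part_add[of F "I - F"] F(2) part_all idn_left[OF f] cmp_add_left[OF f part_closed[of F] part_closed[of "I - F"]]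
    by (simp add: Un_absorb1)
  ultimately show ?thesis using F(3) add_nul(1)[OF pf] by simp
qed

end

end

context triangulated_category
begin

text \<open>The universal property is carried back along the inverse shift, which is an automorphism
  of the category.\<close>

lemma shift_coproduct:
  assumes c: "is_coproduct T I X S \<iota>"
  shows "is_coproduct T I (\<lambda>i. shift T n (X i)) (shift T n S) (\<lambda>i. shiftA T n (\<iota> i))"
  unfolding is_coproduct_def
proof (intro conjI ballI allI impI)
  note d = coproductD[OF c]
  show "shift T n S \<in> Ob T" using d(1) shift_ob by blast
  show "shift T n (X i) \<in> Ob T" if "i \<in> I" for i using d(2) that shift_ob by blast
  show "shiftA T n (\<iota> i) \<in> Hom T (shift T n (X i)) (shift T n S)" if "i \<in> I" for i
    using d(3)[OF that] shiftA_hom by blast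
  fix Y g assume Y: "Y \<in> Ob T" and g: "\<forall>i \<in> I. g i \<in> Hom T (shift T n (X i)) Y"
  have g': "shiftA T (- n) (g i) \<in> Hom T (X i) (shift T (- n) Y)" if "i \<in> I" for i
    using shiftA_hom[of "g i" _ _ "- n"] g that shift_cancel(1)[OF d(2)[OF that]] by metis
  obtain h where h: "h \<in> Hom T S (shift T (- n) Y)" "\<And>i. i \<in> I \<Longrightarrow> h \<bullet> \<iota> i = shiftA T (- n) (g i)"
    using coproduct_map[OF c shift_ob[OF Y], of "\<lambda>i. shiftA T (- n) (g i)" "- n"] g' by blast
  have nh: "shiftA T n h \<in> Hom T (shift T n S) Y" 
    using shiftA_hom[OF h(1), of n] shift_cancel(2)[OF Y] by simp
  show "\<exists>!h. h \<in> Hom T (shift T n S) Y \<and> (\<forall>i \<in> I. h \<bullet> shiftA T n (\<iota> i) = g i)"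
  proof (rule ex1I[of _ "shiftA T n h"])
    have "shiftA T n h \<bullet> shiftA T n (\<iota> i) = g i" if i: "i \<in> I" for i
      using shiftA_cmp[OF d(3)[OF i] h(1), of n] h(2)[OF i] shiftA_cancel(2)[of "g i"] g i Hom_arr by metis
    with nh show "shiftA T n h \<in> Hom T (shift T n S) Y \<and> (\<forall>i \<in> I. shiftA T n h \<bullet> shiftA T n (\<iota> i) = g i)"
      by blast
    fix k assume k: "k \<in> Hom T (shift T n S) Y \<and> (\<forall>i \<in> I. k \<bullet> shiftA T n (\<iota> i) = g i)"
    then obtain k' where k': "k' \<in> Hom T S (shift T (- n) Y)" "shiftA T n k' = k"
      using shiftA_surj d(1) by metis
    have "k' = h"
    proof (rule coproduct_eqI[OF c k'(1) h(1)])
      fix i assume i: "i \<in> I"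
      have a: "k' \<bullet> \<iota> i \<in> Arr T" using cmp_closed[OF d(3)[OF i] k'(1)] Hom_arr by blast
      have "shiftA T n (k' \<bullet> \<iota> i) = g i" using shiftA_cmp[OF d(3)[OF i] k'(1), of n] k k'(2) i by simp
      then show "k' \<bullet> \<iota> i = h \<bullet> \<iota> i" using h(2)[OF i] shiftA_cancel(1)[OF a, of n] by simp
    qed
    then show "k = shiftA T n h" using k' by simp
  qed
qed

lemma shift_part:
  assumes c: "is_coproduct T I X S \<iota>"
  shows "part I (\<lambda>i. shift T n (X i)) (shift T n S) (\<lambda>i. shiftA T n (\<iota> i)) A = shiftA T n (part I X S \<iota> A)"
proof (rule part_eqI[OF shift_coproduct[OF c], symmetric])
  note d = coproductD[OF c]
  show "shiftA T n (part I X S \<iota> A) \<in> Hom T (shift T n S) (shift T n S)"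
    using part_closed[OF c] shiftA_hom by blast
  show "shiftA T n (part I X S \<iota> A) \<bullet> shiftA T n (\<iota> i) = 
      (if i \<in> A then shiftA T n (\<iota> i) else Nul T (shift T n (X i)) (shift T n S))" if i: "i \<in> I" for i
    using shiftA_cmp[OF d(3)[OF i] part_closed[OF c], of n A] part_incl[OF c i, of A] shiftA_nul[OF d(2)[OF i] d(1)]
    by (cases "i \<in> A") simp_all
qed

end

section \<open>Compact objects\<close>

locale small_triangulated_category = triangulated_category T + universe U
  for U :: "'u set" and T :: "('o, 'm, 'z) triangulated_category_scheme" (structure) +
  assumes locally_small: "locally_small U T" and has_coproducts: "has_coproducts U T"
begin

lemma ex_coproduct:
  assumes "small U J" "\<And>j. j \<in> J \<Longrightarrow> X j \<in> Ob T"
  obtains S \<iota> where "is_coproduct T J X S \<iota>"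
proof -
  obtain e where e: "inj_on e J" "e ` J \<subseteq> U" using small_embed[OF assms(1)] .
  have b: "bij_betw e J (e ` J)" using e(1) by (simp add: bij_betw_def)
  have "small U (e ` J)" using small_image assms(1) by blast
  moreover have "\<forall>i \<in> e ` J. X (inv_into J e i) \<in> Ob T" using e(1) assms(2) by simp
  ultimately obtain S \<iota> where c: "is_coproduct T (e ` J) (\<lambda>i. X (inv_into J e i)) S \<iota>"
    using has_coproducts[unfolded has_coproducts_def, rule_format, of "e ` J" "\<lambda>i. X (inv_into J e i)"] by auto
  have "is_coproduct T J X S (\<iota> \<circ> e)"
    using coproduct_reindex[OF c b] e(1) by (auto simp: is_coproduct_def)
  then show ?thesis using that by blast
qed

lemma localizing_coproduct:
  assumes S: "localizing U T S" and J: "small U J" "\<And>j. j \<in> J \<Longrightarrow> X j \<in> S" and c: "is_coproduct T J X C \<iota>"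
  shows "C \<in> S"
proof -
  obtain e where e: "inj_on e J" "e ` J \<subseteq> U" using small_embed[OF J(1)] .
  have b: "bij_betw (inv_into J e) (e ` J) J" by (rule bij_betw_inv_into[OF inj_on_imp_bij_betw[OF e(1)]])
  have "small U (e ` J)" using small_image J by blast
  moreover have "\<forall>i \<in> e ` J. (X \<circ> inv_into J e) i \<in> S" using e(1) J(2) by simp
  ultimately show ?thesis using S coproduct_reindex[OF c b] unfolding localizing_def by blast
qed

text \<open>
  For \<open>F\<close> a finite subset of \<open>I\<close>, an arrow annihilated by the idempotent \<open>part (I - F)\<close> is one that factors through
  the subcoproduct indexed by \<open>F\<close>.  This form of compactness passes to cones by composing idempotents.
\<close>

definition finitary :: "'o \<Rightarrow> bool" where
  "finitary C \<longleftrightarrow> C \<in> Ob T \<and> (\<forall>(I :: 'u set) X S \<iota> f. small U I \<longrightarrow> is_coproduct T I X S \<iota> \<longrightarrow> f \<in> Hom T C S \<longrightarrow>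
     (\<exists>F. finite F \<and> F \<subseteq> I \<and> part I X S \<iota> (I - F) \<bullet> f = Nul T C S))"

lemma finitary_ob: "finitary C \<Longrightarrow> C \<in> Ob T"
  by (simp add: finitary_def)

lemma finitaryD:
  fixes I :: "'u set"
  assumes "finitary C" "small U I" "is_coproduct T I X S \<iota>" "f \<in> Hom T C S"
  obtains F where "finite F" "F \<subseteq> I" "part I X S \<iota> (I - F) \<bullet> f = Nul T C S"
  using assms unfolding finitary_def by metis

text \<open>An arrow from a finitary object to a coproduct is a finite sum of arrows through single
  summands. The index type is arbitrary; an injection into \<open>U\<close> reduces to the
  definition.\<close>

lemma finitary_induct:
  assumes D: "finitary D" and J: "small U J" and c: "is_coproduct T J X S \<iota>" and f: "f \<in> Hom T D S"
    and nul: "P (Nul T D S)"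
    and add: "\<And>x y. x \<in> Hom T D S \<Longrightarrow> y \<in> Hom T D S \<Longrightarrow> P x \<Longrightarrow> P y \<Longrightarrow> P (Add T x y)"
    and incl: "\<And>i x. i \<in> J \<Longrightarrow> x \<in> Hom T D (X i) \<Longrightarrow> P (\<iota> i \<bullet> x)"
  shows "P f"
proof -
  obtain e where e: "inj_on e J" "e ` J \<subseteq> U" using small_embed[OF J(1)] .
  have b: "bij_betw (inv_into J e) (e ` J) J" by (rule bij_betw_inv_into[OF inj_on_imp_bij_betw[OF e(1)]])
  note c' = coproduct_reindex[OF c b]
  have "small U (e ` J)" using small_image J by blast
  then obtain F where F: "finite F" "F \<subseteq> e ` J" 
    "part (e ` J) (X \<circ> inv_into J e) S (\<iota> \<circ> inv_into J e) (e ` J - F) \<bullet> f = Nul T D S"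
    using finitaryD[OF D _ c' f] by blast
  show ?thesis
  proof (rule finite_part_induct[where P = P, OF c' f F nul add])
    fix i x assume "i \<in> e ` J" "x \<in> Hom T D ((X \<circ> inv_into J e) i)"
    then show "P ((\<iota> \<circ> inv_into J e) i \<bullet> x)" using incl[of "inv_into J e i" x] bij_betwE[OF b] by simp
  qed
qed

text \<open>For an arbitrary source the projections need not detect zero arrows into a coproduct.
  Here \<open>f\<close> lives on a finite set of summands and is the sum of its components there.
  The projections are described by their equations because they are only known to exist.\<close>

lemma finitary_proj_eq_nul:
  assumes D: "finitary D" and J: "small U J" and c: "is_coproduct T J X S \<iota>" and f: "f \<in> Hom T D S"
    and 0: "\<And>j \<pi>. j \<in> J \<Longrightarrow> \<pi> \<in> Hom T S (X j) \<Longrightarrow> \<pi> \<bullet> \<iota> j = Idn T (X j) \<Longrightarrow>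
      (\<And>i. i \<in> J \<Longrightarrow> i \<noteq> j \<Longrightarrow> \<pi> \<bullet> \<iota> i = Nul T (X i) (X j)) \<Longrightarrow> \<pi> \<bullet> f = Nul T D (X j)"
  shows "f = Nul T D S"
proof -
  obtain e where e: "inj_on e J" "e ` J \<subseteq> U" using small_embed[OF J(1)] .
  have b: "bij_betw (inv_into J e) (e ` J) J" by (rule bij_betw_inv_into[OF inj_on_imp_bij_betw[OF e(1)]])
  note c' = coproduct_reindex[OF c b]
  define p where "p = part (e ` J) (X \<circ> inv_into J e) S (\<iota> \<circ> inv_into J e)"
  note pc = part_closed[OF c', folded p_def]
  note p_add = part_add[OF c', folded p_def] and p_empty = part_empty[OF c', folded p_def]
    and p_all = part_all[OF c', folded p_def]
  have fin: "p F \<bullet> f = Nul T D S" if "finite F" "F \<subseteq> e ` J" for F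
    using that
  proof (induction F rule: finite_induct)
    case empty
    then show ?case using p_empty nul_cmp[OF f] coproductD(1)[OF c] by metis
  next
    case (insert k F)
    then have k: "k \<in> e ` J" by blast
    let ?j = "inv_into J e k"
    have j: "?j \<in> J" using k bij_betwE[OF b] by blast
    obtain \<pi> where \<pi>: "\<pi> \<in> Hom T S ((X \<circ> inv_into J e) k)" "\<pi> \<bullet> (\<iota> \<circ> inv_into J e) k = Idn T ((X \<circ> inv_into J e) k)"
      "\<And>i. i \<in> e ` J \<Longrightarrow> i \<noteq> k \<Longrightarrow> \<pi> \<bullet> (\<iota> \<circ> inv_into J e) i = Nul T ((X \<circ> inv_into J e) i) ((X \<circ> inv_into J e) k)"
      "(\<iota> \<circ> inv_into J e) k \<bullet> \<pi> = p {k}"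
      unfolding p_def by (rule coproduct_proj[OF c' k]) blast
    have "\<pi> \<bullet> \<iota> i = Nul T (X i) (X ?j)" if "i \<in> J" "i \<noteq> ?j" for i
    proof -
      have i: "e i \<in> e ` J" "e i \<noteq> k" "inv_into J e (e i) = i" using that e(1) by (auto simp: inv_into_f_f)
      show ?thesis using \<pi>(3)[OF i(1,2)] i(3) by simp
    qed
    then have "\<pi> \<bullet> f = Nul T D (X ?j)" using 0[of ?j \<pi>] \<pi> j by simp
    then have "p {k} \<bullet> f = Nul T D S"
      using cmp_assoc[OF f \<pi>(1) coproductD(3)[OF c' k]] \<pi>(4) cmp_nul[OF coproductD(3)[OF c j] Hom_dom[OF f]] by simp
    then show ?case 
      using p_add[of "{k}" F] insert cmp_add_left[OF f pc[of "{k}"] pc[of F]]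
        add_nul(1)[OF nul_closed[OF Hom_dom[OF f] Hom_cod[OF f]]] by simp
  qed
  have "small U (e ` J)" using small_image J by blast
  then obtain F where F: "finite F" "F \<subseteq> e ` J" "p (e ` J - F) \<bullet> f = Nul T D S"
    using finitaryD[OF D _ c' f, folded p_def] by blast
  have "f = Add T (p F \<bullet> f) (p (e ` J - F) \<bullet> f)"
    using p_add[of F "e ` J - F"] F(2) p_all idn_left[OF f]
      cmp_add_left[OF f pc[of F] pc[of "e ` J - F"]]
    by (simp add: Un_absorb1)
  then show ?thesis using F(3) fin[OF F(1,2)] add_nul(1)[OF nul_closed[OF Hom_dom[OF f] Hom_cod[OF f]]] by simp
qed

lemma finitary_shift: assumes C: "finitary C" shows "finitary (shift T n C)"
  unfolding finitary_def
proof (intro conjI allI impI)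
  show "shift T n C \<in> Ob T" using finitary_ob C shift_ob by blast
  fix I :: "'u set" and X S \<iota> f
  assume I: "small U I" and c: "is_coproduct T I X S \<iota>" and f: "f \<in> Hom T (shift T n C) S"
  obtain f' where f': "f' \<in> Hom T C (shift T (- n) S)" "shiftA T n f' = f"
    using shiftA_surj[OF f finitary_ob[OF C]] .
  obtain F where F: "finite F" "F \<subseteq> I" 
    "shiftA T (- n) (part I X S \<iota> (I - F)) \<bullet> f' = Nul T C (shift T (- n) S)"
    using finitaryD[OF C I shift_coproduct[OF c] f'(1)] shift_part[OF c] by metis
  have p: "shiftA T (- n) (part I X S \<iota> (I - F)) \<in> Hom T (shift T (- n) S) (shift T (- n) S)"
    using part_closed[OF c] shiftA_hom by blast
  have "part I X S \<iota> (I - F) \<bullet> f = shiftA T n (shiftA T (- n) (part I X S \<iota> (I - F)) \<bullet> f')"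
    using shiftA_cmp[OF f'(1) p, of n] f'(2) shiftA_cancel(2) Hom_arr part_closed[OF c] by metis
  also have "\<dots> = Nul T (shift T n C) S"
    using F(3) shiftA_nul shift_cancel(2) shift_ob finitary_ob[OF C] coproductD(1)[OF c] by metis
  finally show "\<exists>F. finite F \<and> F \<subseteq> I \<and> part I X S \<iota> (I - F) \<bullet> f = Nul T (shift T n C) S" using F by blast
qed

lemma finitary_susp: "finitary C \<Longrightarrow> finitary (Susp T C)"
  using finitary_shift[of C 1] shift_1 finitary_ob by metis

text \<open>A cofinite part of \<open>x\<close> vanishes on \<open>B\<close>, so it factors through
  \<open>Susp T A\<close>; a second cofinite part annihilates that factor. The composite of the two
  idempotents is again a cofinite part.\<close>

lemma finitary_cone:
  assumes e: "exact_triangle T A B D f g h" and A: "finitary A" and B: "finitary B"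
  shows "finitary D"
  unfolding finitary_def
proof (intro conjI allI impI)
  note d = exact_triangleD[OF e]
  show "D \<in> Ob T" by (rule d)
  fix I :: "'u set" and X S \<iota> x
  assume I: "small U I" and c: "is_coproduct T I X S \<iota>" and x: "x \<in> Hom T D S"
  let ?p = "part I X S \<iota>"
  note pc = part_closed[OF c]
  obtain F where F: "finite F" "F \<subseteq> I" "?p (I - F) \<bullet> (x \<bullet> g) = Nul T B S"
    using finitaryD[OF B I c cmp_closed[OF d(2) x]] .
  have px: "?p (I - F) \<bullet> x \<in> Hom T D S" using cmp_closed[OF x pc] .
  have "(?p (I - F) \<bullet> x) \<bullet> g = Nul T B S" using cmp_assoc[OF d(2) x pc] F(3) by simp
  then obtain y where y: "y \<in> Hom T (Susp T A) S" "?p (I - F) \<bullet> x = y \<bullet> h"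
    using tri_contra[OF tri_rot[OF e] px] by blast
  obtain F' where F': "finite F'" "F' \<subseteq> I" "?p (I - F') \<bullet> y = Nul T (Susp T A) S"
    using finitaryD[OF finitary_susp[OF A] I c y(1)] .
  have "?p (I - (F' \<union> F)) = ?p (I - F') \<bullet> ?p (I - F)" using part_cmp[OF c, of "I - F'" "I - F"]
    by (metis Diff_Un)
  then have "?p (I - (F' \<union> F)) \<bullet> x = ?p (I - F') \<bullet> (y \<bullet> h)"
    using cmp_assoc[OF x pc pc] y(2) by simp
  also have "\<dots> = Nul T D S" using cmp_assoc[OF d(3) y(1) pc] F'(3) nul_cmp[OF d(3) coproductD(1)[OF c]] by metis
  finally show "\<exists>F. finite F \<and> F \<subseteq> I \<and> ?p (I - F) \<bullet> x = Nul T D S" using F F' by blast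
qed

text \<open>Surjectivity of the canonical map writes \<open>x\<close> as a finite sum over the
  support \<open>F\<close> of a preimage, and the idempotent of the complement of \<open>F\<close>
  annihilates every summand.\<close>

lemma compact_imp_finitary: assumes C: "C \<in> compact_objects U T" shows "finitary C"
  unfolding finitary_def
proof (intro conjI allI impI)
  show Cob: "C \<in> Ob T" using C by (simp add: compact_objects_def)
  fix I :: "'u set" and X S \<iota> x
  assume I: "small U I" and c: "is_coproduct T I X S \<iota>" and x: "x \<in> Hom T C S"
  note d = coproductD[OF c]
  let ?H = "hom_group T C S" and ?p = "part I X S \<iota>"
  interpret H: comm_group ?H using hom_comm_group Cob d(1) by blast
  let ?\<Phi> = "\<lambda>f. finprod ?H (\<lambda>i. \<iota> i \<bullet> f i) {i \<in> I. f i \<noteq> Nul T C (X i)}"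
  have "?\<Phi> \<in> iso (sum_group I (\<lambda>i. hom_group T C (X i))) ?H"
    using C I c unfolding compact_objects_def by blast
  then have "?\<Phi> ` carrier (sum_group I (\<lambda>i. hom_group T C (X i))) = carrier ?H"
    by (auto simp: iso_def bij_betw_def)
  then obtain f where f: "f \<in> carrier (sum_group I (\<lambda>i. hom_group T C (X i)))" "x = ?\<Phi> f"
    using x by (metis (no_types, lifting) carrier_hom_group imageE)
  have grp: "group (hom_group T C (X i))" if "i \<in> I" for i
    using hom_comm_group[OF Cob d(2)[OF that]] comm_group_def by blast
  define F where "F = {i \<in> I. f i \<noteq> Nul T C (X i)}"
  have F: "finite F" "F \<subseteq> I" and fi: "\<And>i. i \<in> I \<Longrightarrow> f i \<in> Hom T C (X i)"
    using f(1) by (auto simp: carrier_sum_group[OF grp] F_def)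
  have ifi: "\<iota> i \<bullet> f i \<in> Hom T C S" if "i \<in> I" for i using cmp_closed[OF fi[OF that] d(3)[OF that]] .
  have "?p (I - F) \<bullet> finprod ?H (\<lambda>i. \<iota> i \<bullet> f i) A = Nul T C S" if "finite A" "A \<subseteq> F" for A
    using that
  proof (induction A rule: finite_induct)
    case empty
    then show ?case using cmp_nul[OF part_closed[OF c] Cob] by simp
  next
    case (insert j A)
    then have j: "j \<in> I" "j \<in> F" and A: "A \<subseteq> I" using F by auto
    have Pi: "(\<lambda>i. \<iota> i \<bullet> f i) \<in> A \<rightarrow> carrier ?H" using ifi A by auto
    then have fA: "finprod ?H (\<lambda>i. \<iota> i \<bullet> f i) A \<in> Hom T C S" using H.finprod_closed[OF Pi] by simp
    have "?p (I - F) \<bullet> (\<iota> j \<bullet> f j) = Nul T C S"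
      using cmp_assoc[OF fi[OF j(1)] d(3)[OF j(1)] part_closed[OF c], of "I - F"]
        part_incl[OF c j(1), of "I - F"] j(2) nul_cmp[OF fi[OF j(1)] d(1)] by simp
    moreover have "finprod ?H (\<lambda>i. \<iota> i \<bullet> f i) (insert j A) = Add T (\<iota> j \<bullet> f j) (finprod ?H (\<lambda>i. \<iota> i \<bullet> f i) A)"
      using H.finprod_insert[OF insert(1,2) Pi] ifi[OF j(1)] by simp
    ultimately show ?case 
      using cmp_add_right[OF ifi[OF j(1)] fA part_closed[OF c]] insert add_nul(1)[OF nul_closed[OF Cob d(1)]] by simp
  qed
  then have "?p (I - F) \<bullet> x = Nul T C S" using f(2) F by (simp add: F_def)
  then show "\<exists>F. finite F \<and> F \<subseteq> I \<and> ?p (I - F) \<bullet> x = Nul T C S" using F by blast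
qed

end

section \<open>Localizing subcategories\<close>

context small_triangulated_category
begin

lemma localizing_sub: "localizing U T S \<Longrightarrow> S \<subseteq> Ob T"
  and localizing_zero: "localizing U T S \<Longrightarrow> zero_obj T Z \<Longrightarrow> Z \<in> S"
  and localizing_susp: "localizing U T S \<Longrightarrow> X \<in> Ob T \<Longrightarrow> X \<in> S \<longleftrightarrow> Susp T X \<in> S"
  and localizing_third: "localizing U T S \<Longrightarrow> exact_triangle T X Y Z f g h \<Longrightarrow> X \<in> S \<Longrightarrow> Y \<in> S \<Longrightarrow> Z \<in> S"
  and localizing_first: "localizing U T S \<Longrightarrow> exact_triangle T X Y Z f g h \<Longrightarrow> Y \<in> S \<Longrightarrow> Z \<in> S \<Longrightarrow> X \<in> S"
  and localizing_second: "localizing U T S \<Longrightarrow> exact_triangle T X Y Z f g h \<Longrightarrow> X \<in> S \<Longrightarrow> Z \<in> S \<Longrightarrow> Y \<in> S"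
  unfolding localizing_def triangulated_subcategory_def by blast+

lemma localizing_iso:
  assumes S: "localizing U T S" and X: "X \<in> S" and f: "is_iso_arr T X Y f" shows "Y \<in> S"
proof -
  obtain Z where Z: "zero_obj T Z" using ex_zero_obj by blast
  show ?thesis using localizing_second[OF S iso_triangle[OF f Z] X localizing_zero[OF S Z]] .
qed

lemma iso_arr_sym: assumes "is_iso_arr T X Y f" obtains g where "is_iso_arr T Y X g"
  using assms unfolding is_iso_arr_def by blast

lemma localizing_Ob: "localizing U T (Ob T)"
  by (rule localizingI) (use exact_triangleD susp_ob coproductD zero_obj_ob in auto)

lemma localizing_Inter:
  assumes "F \<noteq> {}" "\<And>S. S \<in> F \<Longrightarrow> localizing U T S" shows "localizing U T (\<Inter>F)"
proof (rule localizingI)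
  show "\<Inter>F \<subseteq> Ob T" using assms localizing_sub by blast
  show "Z \<in> \<Inter>F" if "zero_obj T Z" for Z using assms localizing_zero that by blast
  show "X \<in> \<Inter>F \<longleftrightarrow> Susp T X \<in> \<Inter>F" if "X \<in> Ob T" for X using assms(2) localizing_susp that by blast
  show "Y \<in> \<Inter>F" if "exact_triangle T X Y Z f g h" "X \<in> \<Inter>F" "Z \<in> \<Inter>F" for X Y Z f g h
    using assms(2) localizing_second that by blast
  show "C \<in> \<Inter>F" if "small U I" "\<forall>i \<in> I. X i \<in> \<Inter>F" "is_coproduct T I X C \<iota>" for I :: "'u set" and X C \<iota>
  proof
    fix S assume S: "S \<in> F"
    show "C \<in> S" by (rule localizing_coproduct[OF assms(2)[OF S] that(1) _ that(3)]) (use that S in blast)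
  qed
qed

lemma localizing_INT:
  assumes "\<And>i. i \<in> J \<Longrightarrow> localizing U T {X \<in> Ob T. P i X}" shows "localizing U T {X \<in> Ob T. \<forall>i \<in> J. P i X}"
proof -
  have "{X \<in> Ob T. \<forall>i \<in> J. P i X} = \<Inter>(insert (Ob T) ((\<lambda>i. {X \<in> Ob T. P i X}) ` J))" by auto
  moreover have "localizing U T \<dots>" by (rule localizing_Inter) (use assms localizing_Ob in auto)
  ultimately show ?thesis by simp
qed

lemma localizing_Int: "localizing U T S \<Longrightarrow> localizing U T S' \<Longrightarrow> localizing U T (S \<inter> S')"
  using localizing_Inter[of "{S, S'}"] by auto

lemma localizing_Loc: assumes "A \<subseteq> Ob T" shows "localizing U T (Loc U T A)"
  unfolding Loc_def using localizing_Ob assms by (intro localizing_Inter) auto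

lemma Loc_incl: "A \<subseteq> Loc U T A"
  by (auto simp: Loc_def)

lemma Loc_least: "localizing U T S \<Longrightarrow> A \<subseteq> S \<Longrightarrow> Loc U T A \<subseteq> S"
  by (auto simp: Loc_def)

text \<open>
  Negligible arrows are the zero arrows in one application and the \<open>q\<close>-torsion arrows in the other.
\<close>

lemma localizing_negligible:
  assumes A: "\<And>D. D \<in> A \<Longrightarrow> finitary D"
    and nul: "\<And>X Y. X \<in> Ob T \<Longrightarrow> Y \<in> Ob T \<Longrightarrow> P (Nul T X Y)"
    and add: "\<And>X Y x y. x \<in> Hom T X Y \<Longrightarrow> y \<in> Hom T X Y \<Longrightarrow> P x \<Longrightarrow> P y \<Longrightarrow> P (Add T x y)"
    and post: "\<And>X Y Z x g. x \<in> Hom T X Y \<Longrightarrow> g \<in> Hom T Y Z \<Longrightarrow> P x \<Longrightarrow> P (g \<bullet> x)"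
    and susp: "\<And>X Y x. x \<in> Hom T X Y \<Longrightarrow> P (SuspA T x) \<longleftrightarrow> P x"
    and ext: "\<And>X Y Z f g h C x. exact_triangle T X Y Z f g h \<Longrightarrow> x \<in> Hom T C Y \<Longrightarrow> P (g \<bullet> x) \<Longrightarrow>
      (\<And>n y. y \<in> Hom T (shift T n C) X \<Longrightarrow> P y) \<Longrightarrow> P x"
  shows "localizing U T {L \<in> Ob T. \<forall>D \<in> A. \<forall>n. \<forall>x \<in> Hom T (shift T n D) L. P x}" (is "localizing U T ?S")
proof (rule localizingI)
  show "?S \<subseteq> Ob T" by blast
  show "Z \<in> ?S" if Z: "zero_obj T Z" for Z
    using into_zero[OF Z] nul zero_obj_ob[OF Z] Hom_dom by auto metis
  show "X \<in> ?S \<longleftrightarrow> Susp T X \<in> ?S" if X: "X \<in> Ob T" for X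
  proof
    assume S: "X \<in> ?S"
    have "P x" if D: "D \<in> A" and x: "x \<in> Hom T (shift T n D) (Susp T X)" for D n x
    proof -
      have D': "D \<in> Ob T" using A[OF D] finitary_ob by blast
      have "shift T n D = Susp T (shift T (n - 1) D)" using shift_Suc[OF D', of "n - 1"] by simp
      then obtain y where "y \<in> Hom T (shift T (n - 1) D) X" "SuspA T y = x"
        using suspA_surj x X shift_ob[OF D'] by metis
      then show ?thesis using S D susp by blast
    qed
    then show "Susp T X \<in> ?S" using susp_ob X by blast
  next
    assume S: "Susp T X \<in> ?S"
    have "P x" if D: "D \<in> A" and x: "x \<in> Hom T (shift T n D) X" for D n x
    proof -
      have D': "D \<in> Ob T" using A[OF D] finitary_ob by blast
      have "SuspA T x \<in> Hom T (shift T (n + 1) D) (Susp T X)" using suspA_hom[OF x] shift_Suc[OF D'] by simp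
      then show ?thesis using S D susp x by blast
    qed
    then show "X \<in> ?S" using X by blast
  qed
  show "Y \<in> ?S" if e: "exact_triangle T X Y Z f g h" and X: "X \<in> ?S" and Z: "Z \<in> ?S" for X Y Z f g h
  proof -
    have "P x" if D: "D \<in> A" and x: "x \<in> Hom T (shift T n D) Y" for D n x
    proof (rule ext[OF e x])
      have D': "D \<in> Ob T" using A[OF D] finitary_ob by blast
      show "P (g \<bullet> x)" using Z D cmp_closed[OF x exact_triangleD(2)[OF e]] by blast
      show "P y" if "y \<in> Hom T (shift T m (shift T n D)) X" for m y
        using X D that shift_add[OF D', of m n, symmetric] by auto
    qed
    then show ?thesis using exact_triangleD(5)[OF e] by blast
  qed
  show "C \<in> ?S" if I: "small U I" and X: "\<forall>i \<in> I. X i \<in> ?S" and c: "is_coproduct T I X C \<iota>" 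
    for I :: "'u set" and X C \<iota>
  proof -
    note d = coproductD[OF c]
    have "P x" if D: "D \<in> A" and x: "x \<in> Hom T (shift T n D) C" for D n x
    proof (rule finitary_induct[where P = P, OF finitary_shift[OF A[OF D]] I c x])
      show "P (Nul T (shift T n D) C)" using nul[OF Hom_dom[OF x] d(1)] .
      show "P (Add T y z)" if "y \<in> Hom T (shift T n D) C" "z \<in> Hom T (shift T n D) C" "P y" "P z" for y z
        using add[OF that] .
      show "P (\<iota> i \<bullet> y)" if i: "i \<in> I" and y: "y \<in> Hom T (shift T n D) (X i)" for i y
      proof -
        have "P y" using X i D y by simp
        then show ?thesis by (rule post[OF y d(3)[OF i]])
      qed
    qed
    then show ?thesis using d(1) by blast
  qed
qed

text \<open>A negligible arrow is described by a predicate on the arrow alone, so the zero arrow is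
  expressed through \<open>Dom\<close> and \<open>Cod\<close>.\<close>

lemma localizing_right_orth:
  assumes A: "\<And>D. D \<in> A \<Longrightarrow> finitary D"
  shows "localizing U T {L \<in> Ob T. \<forall>D \<in> A. \<forall>n. \<forall>x \<in> Hom T (shift T n D) L. x = Nul T (Dom T x) (Cod T x)}"
proof (rule localizing_negligible[OF A])
  have N: "Nul T (Dom T (Nul T X Y)) (Cod T (Nul T X Y)) = Nul T X Y" if "X \<in> Ob T" "Y \<in> Ob T" for X Y
    using nul_closed[OF that] by (simp add: Hom_def)
  have E: "x = Nul T (Dom T x) (Cod T x) \<longleftrightarrow> x = Nul T X Y" if "x \<in> Hom T X Y" for X Y x
    using that by (simp add: Hom_def)
  show "Nul T X Y = Nul T (Dom T (Nul T X Y)) (Cod T (Nul T X Y))" if "X \<in> Ob T" "Y \<in> Ob T" for X Y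
    using N[OF that] by simp
  show "Add T x y = Nul T (Dom T (Add T x y)) (Cod T (Add T x y))"
    if "x \<in> Hom T X Y" "y \<in> Hom T X Y" "x = Nul T (Dom T x) (Cod T x)" "y = Nul T (Dom T y) (Cod T y)" for X Y x y
    using E[OF add_closed[OF that(1,2)]] E[OF that(1)] E[OF that(2)] that add_nul(1)[OF that(1)] by metis
  show "g \<bullet> x = Nul T (Dom T (g \<bullet> x)) (Cod T (g \<bullet> x))"
    if "x \<in> Hom T X Y" "g \<in> Hom T Y Z" "x = Nul T (Dom T x) (Cod T x)" for X Y Z x g
    using E[OF cmp_closed[OF that(1,2)]] E[OF that(1)] that(3) cmp_nul[OF that(2) Hom_dom[OF that(1)]] by metis
  show "SuspA T x = Nul T (Dom T (SuspA T x)) (Cod T (SuspA T x)) \<longleftrightarrow> x = Nul T (Dom T x) (Cod T x)"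
    if x: "x \<in> Hom T X Y" for X Y x
    using E[OF x] E[OF suspA_hom[OF x]] suspA_eq_nul[OF x] suspA_nul[OF Hom_dom[OF x] Hom_cod[OF x]] by metis
  show "x = Nul T (Dom T x) (Cod T x)"
    if e: "exact_triangle T X Y Z f g h" and x: "x \<in> Hom T C Y" and gx: "g \<bullet> x = Nul T (Dom T (g \<bullet> x)) (Cod T (g \<bullet> x))"
      and X: "\<And>n y. y \<in> Hom T (shift T n C) X \<Longrightarrow> y = Nul T (Dom T y) (Cod T y)" for X Y Z f g h C x
  proof -
    note d = exact_triangleD[OF e]
    have "g \<bullet> x = Nul T C Z" using gx E[OF cmp_closed[OF x d(2)]] by metis
    then obtain y where y: "y \<in> Hom T C X" "x = f \<bullet> y" using tri_cov[OF e x] by blast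
    have "y = Nul T C X" using X[of y 0] E[OF y(1)] y(1) shift_0 by metis
    then have "x = Nul T C Y" using y cmp_nul[OF d(1) Hom_dom[OF x]] by simp
    then show ?thesis using E[OF x] by metis
  qed
qed

text \<open>Closure under coproducts needs no finiteness of the sources: arrows out of a coproduct
  are determined on its summands.\<close>

lemma localizing_left_orth:
  assumes L: "L \<in> Ob T"
  shows "localizing U T {Y \<in> Ob T. \<forall>n. \<forall>x \<in> Hom T (shift T n Y) L. x = Nul T (shift T n Y) L}" (is "localizing U T ?S")
proof (rule localizingI)
  show "?S \<subseteq> Ob T" by blast
  show "Z \<in> ?S" if Z: "zero_obj T Z" for Z
  proof -
    have "zero_obj T (shift T n Z)" for n
      using shift_induct[of Z "zero_obj T" n] susp_zero_iff Z zero_obj_ob by blast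
    then show ?thesis using from_zero zero_obj_ob Z by blast
  qed
  show "X \<in> ?S \<longleftrightarrow> Susp T X \<in> ?S" if X: "X \<in> Ob T" for X
  proof -
    have "(\<forall>n. Q (shift T n X)) \<longleftrightarrow> (\<forall>n. Q (shift T n (Susp T X)))" for Q
      using shift_susp[OF X] shift_Suc[OF X] by (metis diff_add_cancel)
    from this[of "\<lambda>Z. \<forall>x \<in> Hom T Z L. x = Nul T Z L"] show ?thesis using X susp_ob by simp
  qed
  have key: "x = Nul T (shift T n Y) L" 
    if e: "exact_triangle T X Y Z f g h" and X: "X \<in> ?S" and Z: "Z \<in> ?S" and x: "x \<in> Hom T (shift T n Y) L" 
    for X Y Z f g h x n
  proof -
    note d = exact_triangleD[OF e]
    \<comment> \<open>The shift is moved to the target, so that the given triangle itself, and not a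
      shift of it, can be used.\<close>
    obtain x' where x': "x' \<in> Hom T Y (shift T (- n) L)" "shiftA T n x' = x" using shiftA_surj[OF x d(5)] .
    note lc = shift_cancel(2)[OF L, of n]
    have xf: "x' \<bullet> f \<in> Hom T X (shift T (- n) L)" using cmp_closed[OF d(1) x'(1)] .
    have "shiftA T n (x' \<bullet> f) = Nul T (shift T n X) L" using shiftA_hom[OF xf, of n] lc X by auto
    then have "x' \<bullet> f = Nul T X (shift T (- n) L)" using shiftA_eq_nul[OF xf, of n] lc by simp
    then obtain y where y: "y \<in> Hom T Z (shift T (- n) L)" "x' = y \<bullet> g" using tri_contra[OF e x'(1)] by blast
    have "shiftA T n y = Nul T (shift T n Z) L" using shiftA_hom[OF y(1), of n] lc Z by auto
    then have "y = Nul T Z (shift T (- n) L)" using shiftA_eq_nul[OF y(1), of n] lc by simp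
    then have "x' = Nul T Y (shift T (- n) L)" using y(2) nul_cmp[OF d(2) shift_ob[OF L]] by simp
    then show ?thesis using x'(2) shiftA_nul[OF d(5) shift_ob[OF L]] lc by metis
  qed
  show "Y \<in> ?S" if e: "exact_triangle T X Y Z f g h" "X \<in> ?S" "Z \<in> ?S" for X Y Z f g h
    using key[OF that] exact_triangleD(5)[OF e(1)] by blast
  show "C \<in> ?S" if I: "small U I" and X: "\<forall>i \<in> I. X i \<in> ?S" and c: "is_coproduct T I X C \<iota>" 
    for I :: "'u set" and X C \<iota>
  proof -
    note d = coproductD[OF c]
    have "x = Nul T (shift T n C) L" if x: "x \<in> Hom T (shift T n C) L" for n x
    proof (rule coproduct_eqI[OF shift_coproduct[OF c] x nul_closed[OF shift_ob[OF d(1)] L]])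
      fix i assume i: "i \<in> I"
      note si = shiftA_hom[OF d(3)[OF i], of n]
      show "x \<bullet> shiftA T n (\<iota> i) = Nul T (shift T n C) L \<bullet> shiftA T n (\<iota> i)"
        using cmp_closed[OF si x] nul_cmp[OF si L] X i by auto
    qed
    then show ?thesis using d(1) by blast
  qed
qed

section \<open>Bousfield localization\<close>

text \<open>
  \<open>G\<close> is the telescope of a sequence \<open>Y\<^sub>0 \<rightarrow> Y\<^sub>1 \<rightarrow> \<dots>\<close> over \<open>X\<close>: every arrow from \<open>A\<close> to \<open>X\<close> lifts to \<open>Y\<^sub>0\<close>,
  and every arrow from \<open>A\<close> to \<open>Y\<^sub>n\<close> that vanishes in \<open>X\<close> already vanishes in the next term.
\<close>

theorem bousfield_triangle:
  assumes A: "small U A" "\<And>D. D \<in> A \<Longrightarrow> finitary D" "\<And>D n. D \<in> A \<Longrightarrow> shift T n D \<in> A"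
    and X: "X \<in> Ob T"
  obtains G L f g h where "exact_triangle T G X L f g h" "G \<in> Loc U T A" 
    "\<And>D x. D \<in> A \<Longrightarrow> x \<in> Hom T D L \<Longrightarrow> x = Nul T D L"
proof -
  have Aob: "A \<subseteq> Ob T" using A(2) finitary_ob by blast
  let ?S = "Loc U T A"
  have S: "localizing U T ?S" using localizing_Loc[OF Aob] .
  have Sob: "?S \<subseteq> Ob T" using localizing_sub[OF S] .
  \<comment> \<open>\<open>P\<close> is the coproduct of the domains of all arrows from
    \<open>A\<close> to \<open>Y\<close> selected by \<open>Q\<close>, and \<open>u\<close> is the
    induced arrow. All arrows are selected for the first stage, and the arrows that become zero in
    \<open>X\<close> for each later one.\<close>
  have cop: "\<exists>P u. P \<in> ?S \<and> u \<in> Hom T P Y \<and> (\<forall>D x. D \<in> A \<longrightarrow> x \<in> Hom T D Y \<longrightarrow> Q D x \<longrightarrow> (\<exists>z \<in> Hom T D P. x = u \<bullet> z))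
      \<and> (\<forall>W a. a \<in> Hom T Y W \<longrightarrow> (\<forall>D x. D \<in> A \<longrightarrow> x \<in> Hom T D Y \<longrightarrow> Q D x \<longrightarrow> a \<bullet> x = Nul T D W) \<longrightarrow> a \<bullet> u = Nul T P W)"
    if Y: "Y \<in> Ob T" for Y Q
  proof -
    define J where "J = (SIGMA D:A. {x \<in> Hom T D Y. Q D x})"
    have "small U J" unfolding J_def
    proof (rule small_Sigma[OF A(1)])
      fix D assume "D \<in> A"
      then have "small U (Hom T D Y)" using locally_small Aob Y unfolding locally_small_def by blast
      then show "small U {x \<in> Hom T D Y. Q D x}" by (rule small_subset) blast
    qed
    moreover have J: "fst j \<in> A" "snd j \<in> Hom T (fst j) Y" "Q (fst j) (snd j)" if "j \<in> J" for j using that by (auto simp: J_def)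
    ultimately obtain P \<iota> where c: "is_coproduct T J fst P \<iota>" using ex_coproduct[of J fst] Aob by blast
    note d = coproductD[OF c]
    obtain u where u: "u \<in> Hom T P Y" "\<And>j. j \<in> J \<Longrightarrow> u \<bullet> \<iota> j = snd j" using coproduct_map[OF c Y, of snd] J by blast
    have "P \<in> ?S" using localizing_coproduct[OF S \<open>small U J\<close> _ c] J(1) Loc_incl by blast
    moreover have "\<exists>z \<in> Hom T D P. x = u \<bullet> z" if "D \<in> A" "x \<in> Hom T D Y" "Q D x" for D x
    proof -
      have j: "(D, x) \<in> J" using that by (simp add: J_def)
      have "\<iota> (D, x) \<in> Hom T D P" "x = u \<bullet> \<iota> (D, x)" using d(3)[OF j] u(2)[OF j] by simp_all
      then show ?thesis by blast
    qed
    moreover have "a \<bullet> u = Nul T P W" if a: "a \<in> Hom T Y W" and 0: "\<forall>D x. D \<in> A \<longrightarrow> x \<in> Hom T D Y \<longrightarrow> Q D x \<longrightarrow> a \<bullet> x = Nul T D W"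
      for W a
    proof (rule coproduct_eqI[OF c cmp_closed[OF u(1) a] nul_closed[OF d(1) Hom_cod[OF a]]])
      fix j assume j: "j \<in> J"
      show "(a \<bullet> u) \<bullet> \<iota> j = Nul T P W \<bullet> \<iota> j"
        using cmp_assoc[OF d(3)[OF j] u(1) a] u(2)[OF j] 0 J[OF j] nul_cmp[OF d(3)[OF j] Hom_cod[OF a]] by simp
    qed
    ultimately show ?thesis using u(1) by blast
  qed
  define good where "good = (\<lambda>(Y, a). Y \<in> ?S \<and> a \<in> Hom T Y X)"
  define link where "link = (\<lambda>(Y, a) (Y', a') g. g \<in> Hom T Y Y' \<and> a' \<bullet> g = a \<and> 
    (\<forall>D x. D \<in> A \<longrightarrow> x \<in> Hom T D Y \<longrightarrow> a \<bullet> x = Nul T D X \<longrightarrow> g \<bullet> x = Nul T D Y'))"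
  obtain P0 a0 where P0: "good (P0, a0)" "\<And>D x. D \<in> A \<Longrightarrow> x \<in> Hom T D X \<Longrightarrow> \<exists>z \<in> Hom T D P0. x = a0 \<bullet> z"
    using cop[OF X, of "\<lambda>_ _. True"] unfolding good_def by auto
  have step: "\<exists>p'. good p' \<and> (\<exists>g. link p p' g)" if p: "good p" for p
  proof -
    obtain Y a where [simp]: "p = (Y, a)" by (cases p)
    have Y: "Y \<in> ?S" "a \<in> Hom T Y X" "Y \<in> Ob T" using p Sob by (auto simp: good_def)
    obtain P u where P: "P \<in> ?S" and u: "u \<in> Hom T P Y"
      and u1: "\<forall>D x. D \<in> A \<longrightarrow> x \<in> Hom T D Y \<longrightarrow> a \<bullet> x = Nul T D X \<longrightarrow> (\<exists>z \<in> Hom T D P. x = u \<bullet> z)"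
      and u2: "\<forall>W b. b \<in> Hom T Y W \<longrightarrow> (\<forall>D x. D \<in> A \<longrightarrow> x \<in> Hom T D Y \<longrightarrow> a \<bullet> x = Nul T D X \<longrightarrow> b \<bullet> x = Nul T D W) \<longrightarrow> b \<bullet> u = Nul T P W"
      using cop[OF Y(3), of "\<lambda>D x. a \<bullet> x = Nul T D X"] by (elim exE conjE)
    \<comment> \<open>Hence \<open>a\<close> extends over the cone \<open>Y'\<close> of
      \<open>u\<close>, and in this cone all arrows from \<open>A\<close> in the kernel of
      \<open>a\<close> die.\<close>
    have "a \<bullet> u = Nul T P X" using u2 Y(2) by simp
    moreover obtain Y' g h where e: "exact_triangle T P Y Y' u g h" using tri_cone[OF u] by blast
    ultimately obtain a' where a': "a' \<in> Hom T Y' X" "a = a' \<bullet> g" using tri_contra[OF e Y(2)] by blast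
    note d = exact_triangleD[OF e]
    have "g \<bullet> x = Nul T D Y'" if D: "D \<in> A" "x \<in> Hom T D Y" "a \<bullet> x = Nul T D X" for D x
    proof -
      obtain z where z: "z \<in> Hom T D P" "x = u \<bullet> z" using u1 D by blast
      show ?thesis using cmp_assoc[OF z(1) u d(2)] tri_comp_zero[OF e] nul_cmp[OF z(1) d(6)] z(2) by simp
    qed
    then have "link p (Y', a') g" using d(2) a' by (simp add: link_def)
    moreover have "good (Y', a')" using localizing_third[OF S e P Y(1)] a' by (simp add: good_def)
    ultimately show ?thesis by blast
  qed
  \<comment> \<open>The clause for \<open>n = 0\<close> pins the start of the chosen sequence to the
    stage through which all arrows from \<open>A\<close> to \<open>X\<close> factor.\<close>
  have "\<exists>p. \<forall>n. (good (p n) \<and> (n = 0 \<longrightarrow> p n = (P0, a0))) \<and> (\<exists>g. link (p n) (p (Suc n)) g)"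
    by (rule dependent_nat_choice[where P = "\<lambda>n p. good p \<and> (n = 0 \<longrightarrow> p = (P0, a0))" 
          and Q = "\<lambda>n p p'. \<exists>g. link p p' g"])
      (use P0(1) step in auto)
  then obtain p where p: "\<And>n. good (p n)" "p 0 = (P0, a0)" "\<And>n. \<exists>g. link (p n) (p (Suc n)) g" by blast
  define Y where "Y n = fst (p n)" for n
  define a where "a n = snd (p n)" for n
  obtain g where g: "\<And>n. link (p n) (p (Suc n)) (g n)" using p(3) by metis
  have Y: "Y n \<in> ?S" "a n \<in> Hom T (Y n) X" for n using p(1)[of n] by (auto simp: good_def Y_def a_def split: prod.splits)
  have Yob: "Y n \<in> Ob T" for n using Y(1) Sob by blast
  have g: "g n \<in> Hom T (Y n) (Y (Suc n))" "a (Suc n) \<bullet> g n = a n"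
    "\<And>D x. D \<in> A \<Longrightarrow> x \<in> Hom T D (Y n) \<Longrightarrow> a n \<bullet> x = Nul T D X \<Longrightarrow> g n \<bullet> x = Nul T D (Y (Suc n))" for n
    using g[of n] by (auto simp: link_def Y_def a_def split: prod.splits)
  have Y0: "\<exists>z \<in> Hom T D (Y 0). x = a 0 \<bullet> z" if "D \<in> A" "x \<in> Hom T D X" for D x
    using P0(2)[OF that] p(2) by (simp add: Y_def a_def)
  have smn: "small U (UNIV :: nat set)" by (rule small_countable) simp
  obtain P \<iota> where c: "is_coproduct T UNIV Y P \<iota>" by (rule ex_coproduct[OF smn, of Y]) (rule Yob)
  have Pob: "P \<in> Ob T" and \<iota>: "\<iota> n \<in> Hom T (Y n) P" for n using coproductD[OF c] by auto
  have ig: "\<iota> (Suc n) \<bullet> g n \<in> Hom T (Y n) P" for n using cmp_closed[OF g(1) \<iota>] .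
  \<comment> \<open>\<open>w\<close> is the identity minus the transition maps; its cone
    \<open>H\<close> is the telescope of the sequence.\<close>
  obtain w where w: "w \<in> Hom T P P" "\<And>n. w \<bullet> \<iota> n = Add T (\<iota> n) (Neg T (\<iota> (Suc n) \<bullet> g n))"
    using coproduct_map[OF c Pob, of "\<lambda>n. Add T (\<iota> n) (Neg T (\<iota> (Suc n) \<bullet> g n))"] add_closed[OF \<iota> neg_closed[OF ig]] by auto
  obtain \<alpha> where \<alpha>: "\<alpha> \<in> Hom T P X" "\<And>n. \<alpha> \<bullet> \<iota> n = a n" using coproduct_map[OF c X, of a] Y(2) by auto
  have diff: "y \<bullet> Add T u (Neg T v) = Nul T V Z \<longleftrightarrow> y \<bullet> u = y \<bullet> v" if "y \<in> Hom T W Z" "u \<in> Hom T V W" "v \<in> Hom T V W" for y u v V W Z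
  proof -
    have yu: "y \<bullet> u \<in> Hom T V Z" "y \<bullet> v \<in> Hom T V Z" using cmp_closed that by blast+
    have "y \<bullet> Add T u (Neg T v) = Add T (y \<bullet> u) (Neg T (y \<bullet> v))"
      using cmp_add_right[OF that(2) neg_closed[OF that(3)] that(1)] cmp_neg[OF that(3,1)] by simp
    then show ?thesis using diff_eq_nul[OF yu] add_neg[OF yu(2)] by metis
  qed
  have "\<alpha> \<bullet> w = Nul T P X"
  proof (rule coproduct_eqI[OF c cmp_closed[OF w(1) \<alpha>(1)] nul_closed[OF Pob X]])
    fix n
    have "\<alpha> \<bullet> (\<iota> (Suc n) \<bullet> g n) = \<alpha> \<bullet> \<iota> n" using cmp_assoc[OF g(1) \<iota> \<alpha>(1), of n] \<alpha>(2) g(2) by simp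
    then have "\<alpha> \<bullet> (w \<bullet> \<iota> n) = Nul T (Y n) X" using diff[OF \<alpha>(1) \<iota> ig, of n] w(2) by simp
    then show "(\<alpha> \<bullet> w) \<bullet> \<iota> n = Nul T P X \<bullet> \<iota> n"
      using cmp_assoc[OF \<iota> w(1) \<alpha>(1)] nul_cmp[OF \<iota> X] by simp
  qed
  moreover obtain H v \<delta> where e: "exact_triangle T P P H w v \<delta>" using tri_cone[OF w(1)] by blast
  ultimately obtain b where b: "b \<in> Hom T H X" "\<alpha> = b \<bullet> v" using tri_contra[OF e \<alpha>(1)] by blast
  note d = exact_triangleD[OF e]
  have "P \<in> ?S" using localizing_coproduct[OF S smn _ c] Y(1) by blast
  then have HS: "H \<in> ?S" using localizing_third[OF S e] by blast
  have vi: "v \<bullet> \<iota> n \<in> Hom T (Y n) H" for n using cmp_closed[OF \<iota> d(2)] .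
  have vg: "v \<bullet> \<iota> n = v \<bullet> (\<iota> (Suc n) \<bullet> g n)" for n
  proof -
    have "v \<bullet> (w \<bullet> \<iota> n) = Nul T (Y n) H" using cmp_assoc[OF \<iota> w(1) d(2)] tri_comp_zero[OF e] nul_cmp[OF \<iota> d(6)] by simp
    then show ?thesis using diff[OF d(2) \<iota> ig, of n] w(2) by simp
  qed
  have bvi: "b \<bullet> (v \<bullet> \<iota> n) = a n" for n using cmp_assoc[OF \<iota> d(2) b(1)] b(2) \<alpha>(2) by metis
  have surj: "\<exists>z \<in> Hom T D H. x = b \<bullet> z" if D: "D \<in> A" "x \<in> Hom T D X" for D x
  proof -
    obtain z where z: "z \<in> Hom T D (Y 0)" "x = a 0 \<bullet> z" using Y0[OF D] by blast
    have "x = b \<bullet> ((v \<bullet> \<iota> 0) \<bullet> z)" using z(2) bvi[of 0] cmp_assoc[OF z(1) vi b(1)] by simp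
    then show ?thesis using cmp_closed[OF z(1) vi] by blast
  qed
  \<comment> \<open>Componentwise, \<open>w \<bullet> k\<close> has \<open>k\<close> at
    \<open>0\<close> in place \<open>0\<close>, and in place \<open>j + 1\<close> the component of
    \<open>k\<close> minus the image under \<open>g j\<close> of the preceding one. If all vanish,
    so do the components of \<open>k\<close>, by induction.\<close>
  have winj: "k = Nul T D P" if D: "D \<in> A" and k: "k \<in> Hom T D P" and 0: "w \<bullet> k = Nul T D P" for D k
  proof (rule finitary_proj_eq_nul[OF A(2)[OF D] smn c k])
    fix j \<pi> assume "\<pi> \<in> Hom T P (Y j)" "\<pi> \<bullet> \<iota> j = Idn T (Y j)" "\<And>i. i \<in> UNIV \<Longrightarrow> i \<noteq> j \<Longrightarrow> \<pi> \<bullet> \<iota> i = Nul T (Y i) (Y j)"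
    then show "\<pi> \<bullet> k = Nul T D (Y j)"
    proof (induction j arbitrary: \<pi>)
      case 0
      \<comment> \<open>The transition maps end in stages of positive index, which the projection to
        stage \<open>0\<close> ignores.\<close>
      have "\<pi> \<bullet> w = \<pi>"
      proof (rule coproduct_eqI[OF c cmp_closed[OF w(1) 0(1)] 0(1)])
        fix n
        have "\<pi> \<bullet> (\<iota> (Suc n) \<bullet> g n) = Nul T (Y n) (Y 0)"
          using cmp_assoc[OF g(1) \<iota> 0(1), of n] 0(3)[of "Suc n"] nul_cmp[OF g(1) Yob] by simp
        then have "\<pi> \<bullet> (w \<bullet> \<iota> n) = \<pi> \<bullet> \<iota> n"
          using w(2) cmp_add_right[OF \<iota> neg_closed[OF ig] 0(1), of n] cmp_neg[OF ig 0(1)] neg_nul[OF Yob Yob]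
            add_nul(1)[OF cmp_closed[OF \<iota> 0(1)]] by simp
        then show "(\<pi> \<bullet> w) \<bullet> \<iota> n = \<pi> \<bullet> \<iota> n" using cmp_assoc[OF \<iota> w(1) 0(1)] by simp
      qed
      then show ?case using cmp_assoc[OF k w(1) 0(1)] \<open>w \<bullet> k = Nul T D P\<close> cmp_nul[OF 0(1) Hom_dom[OF k]] by simp
    next
      case (Suc j)
      obtain \<pi>' where \<pi>': "\<pi>' \<in> Hom T P (Y j)" "\<pi>' \<bullet> \<iota> j = Idn T (Y j)" "\<And>i. i \<noteq> j \<Longrightarrow> \<pi>' \<bullet> \<iota> i = Nul T (Y i) (Y j)"
        using coproduct_proj[OF c, of j] by auto
      have \<pi>'k: "\<pi>' \<bullet> k = Nul T D (Y j)" using Suc.IH[OF \<pi>'(1,2)] \<pi>'(3) by simp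
      note gp = cmp_closed[OF \<pi>'(1) g(1)]
      have "\<pi> \<bullet> w = Add T \<pi> (Neg T (g j \<bullet> \<pi>'))"
      proof (rule coproduct_eqI[OF c cmp_closed[OF w(1) Suc(2)] add_closed[OF Suc(2) neg_closed[OF gp]]])
        fix n
        have "\<pi> \<bullet> (\<iota> (Suc n) \<bullet> g n) = g j \<bullet> (\<pi>' \<bullet> \<iota> n)"
        proof (cases "n = j")
          case True
          then show ?thesis using cmp_assoc[OF g(1) \<iota> Suc(2), of n] Suc(3) \<pi>'(2) idn_left[OF g(1)] idn_right[OF g(1)] by simp
        next
          case False
          then show ?thesis using cmp_assoc[OF g(1) \<iota> Suc(2), of n] Suc(4)[of "Suc n"] \<pi>'(3)[of n] 
              nul_cmp[OF g(1) Yob] cmp_nul[OF g(1) Yob] by simp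
        qed
        also have "\<dots> = (g j \<bullet> \<pi>') \<bullet> \<iota> n" using cmp_assoc[OF \<iota> \<pi>'(1) g(1)] by simp
        finally have "\<pi> \<bullet> (w \<bullet> \<iota> n) = Add T \<pi> (Neg T (g j \<bullet> \<pi>')) \<bullet> \<iota> n"
          using w(2) cmp_add_right[OF \<iota> neg_closed[OF ig] Suc(2), of n] cmp_neg[OF ig Suc(2), of n] 
            cmp_add_left[OF \<iota> Suc(2) neg_closed[OF gp], of n] neg_cmp[OF \<iota> gp, of n] by simp
        then show "(\<pi> \<bullet> w) \<bullet> \<iota> n = Add T \<pi> (Neg T (g j \<bullet> \<pi>')) \<bullet> \<iota> n" using cmp_assoc[OF \<iota> w(1) Suc(2)] by simp
      qed
      moreover have "Neg T (g j \<bullet> \<pi>') \<bullet> k = Nul T D (Y (Suc j))"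
        using neg_cmp[OF k gp] cmp_assoc[OF k \<pi>'(1) g(1)] \<pi>'k cmp_nul[OF g(1) Hom_dom[OF k]] neg_nul[OF Hom_dom[OF k] Yob] by simp
      ultimately have "(\<pi> \<bullet> w) \<bullet> k = \<pi> \<bullet> k"
        using cmp_add_left[OF k Suc(2) neg_closed[OF gp]] add_nul(1)[OF cmp_closed[OF k Suc(2)]] by simp
      then show ?case using cmp_assoc[OF k w(1) Suc(2)] 0 cmp_nul[OF Suc(2) Hom_dom[OF k]] by simp
    qed
  qed
  \<comment> \<open>By \<open>winj\<close> the connecting arrow vanishes on \<open>z\<close>, so
    \<open>z\<close> comes from the coproduct \<open>P\<close>. It then comes from one stage, and
    dies in the next one since it is zero in \<open>X\<close>.\<close>
  have inj: "z = Nul T D H" if D: "D \<in> A" and z: "z \<in> Hom T D H" and bz: "b \<bullet> z = Nul T D X" for D z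
  proof -
    have Dob: "D \<in> Ob T" using Hom_dom[OF z] .
    \<comment> \<open>The connecting arrow ends in a suspension, so \<open>winj\<close> is applied
      to a desuspension of \<open>D\<close>; this is where closure of \<open>A\<close> under shifts
      is needed.\<close>
    obtain E where E: "E \<in> A" "Susp T E = D" 
      using A(3)[OF D, of "- 1"] shift_cancel(2)[OF Dob, of 1] shift_1[OF shift_ob[OF Dob]] by metis
    have dz: "\<delta> \<bullet> z \<in> Hom T (Susp T E) (Susp T P)" using cmp_closed[OF z d(3)] E by simp
    then obtain k where k: "k \<in> Hom T E P" "SuspA T k = \<delta> \<bullet> z" using suspA_surj E Aob Pob by blast
    have "Neg T (SuspA T w) \<bullet> (\<delta> \<bullet> z) = Nul T D (Susp T P)"
      using cmp_assoc[OF z d(3) neg_closed[OF suspA_hom[OF w(1)]]] tri_comp_zero[OF tri_rot[OF tri_rot[OF e]]] 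
        nul_cmp[OF z susp_ob[OF Pob]] by simp
    then have "SuspA T w \<bullet> (\<delta> \<bullet> z) = Nul T D (Susp T P)"
      using neg_cmp[OF dz suspA_hom[OF w(1)]] neg_eq_nul cmp_closed[OF dz suspA_hom[OF w(1)]] E(2) by simp
    then have "w \<bullet> k = Nul T E P"
      using suspA_cmp[OF k(1) w(1)] k(2) suspA_eq_nul[OF cmp_closed[OF k(1) w(1)]] E(2) by simp
    then have "k = Nul T E P" using winj E k by blast
    then have "\<delta> \<bullet> z = Nul T D (Susp T P)" using k(2) suspA_nul E Aob Pob by auto
    then obtain y where y: "y \<in> Hom T D P" "z = v \<bullet> y" using tri_cov[OF tri_rot[OF e] z] by blast
    \<comment> \<open>In the telescope an arrow into stage \<open>n\<close> may be replaced by its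
      image in any later stage. Two summands can thus be moved to a common stage and added
      there.\<close>
    have up: "\<exists>f'. f' \<in> Hom T D (Y m) \<and> v \<bullet> (\<iota> n \<bullet> f) = v \<bullet> (\<iota> m \<bullet> f')" if "n \<le> m" and f: "f \<in> Hom T D (Y n)" for n m f
      using that(1)
    proof (induction m rule: dec_induct)
      case base then show ?case using f by blast
    next
      case (step m)
      then obtain f' where f': "f' \<in> Hom T D (Y m)" "v \<bullet> (\<iota> n \<bullet> f) = v \<bullet> (\<iota> m \<bullet> f')" by blast
      have "v \<bullet> (\<iota> m \<bullet> f') = (v \<bullet> \<iota> m) \<bullet> f'" using cmp_assoc[OF f'(1) \<iota> d(2)] by simp
      also have "\<dots> = v \<bullet> ((\<iota> (Suc m) \<bullet> g m) \<bullet> f')" using vg[of m] cmp_assoc[OF f'(1) ig d(2)] by simp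
      also have "\<dots> = v \<bullet> (\<iota> (Suc m) \<bullet> (g m \<bullet> f'))" using cmp_assoc[OF f'(1) g(1) \<iota>] by simp
      finally show ?case using f'(2) cmp_closed[OF f'(1) g(1)] by auto
    qed
    have "\<exists>n f. f \<in> Hom T D (Y n) \<and> v \<bullet> y = v \<bullet> (\<iota> n \<bullet> f)"
    proof (rule finitary_induct[where P = "\<lambda>y. \<exists>n f. f \<in> Hom T D (Y n) \<and> v \<bullet> y = v \<bullet> (\<iota> n \<bullet> f)", OF A(2)[OF D] smn c y(1)])
      show "\<exists>n f. f \<in> Hom T D (Y n) \<and> v \<bullet> Nul T D P = v \<bullet> (\<iota> n \<bullet> f)"
        using nul_closed[OF Dob Yob] cmp_nul[OF \<iota> Dob] by metis
      show "\<exists>n f. f \<in> Hom T D (Y n) \<and> v \<bullet> (\<iota> i \<bullet> x) = v \<bullet> (\<iota> n \<bullet> f)" if "x \<in> Hom T D (Y i)" for i x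
        using that by blast
      fix x y assume x: "x \<in> Hom T D P" and y: "y \<in> Hom T D P" 
        and "\<exists>n f. f \<in> Hom T D (Y n) \<and> v \<bullet> x = v \<bullet> (\<iota> n \<bullet> f)" "\<exists>n f. f \<in> Hom T D (Y n) \<and> v \<bullet> y = v \<bullet> (\<iota> n \<bullet> f)"
      then obtain n f n' f' where f: "f \<in> Hom T D (Y n)" "v \<bullet> x = v \<bullet> (\<iota> n \<bullet> f)" "f' \<in> Hom T D (Y n')" "v \<bullet> y = v \<bullet> (\<iota> n' \<bullet> f')" by blast
      let ?m = "max n n'"
      obtain f1 f2 where f12: "f1 \<in> Hom T D (Y ?m)" "v \<bullet> x = v \<bullet> (\<iota> ?m \<bullet> f1)" "f2 \<in> Hom T D (Y ?m)" "v \<bullet> y = v \<bullet> (\<iota> ?m \<bullet> f2)"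
        using up[OF _ f(1), of ?m] up[OF _ f(3), of ?m] f(2,4) by auto
      have "v \<bullet> Add T x y = v \<bullet> (\<iota> ?m \<bullet> Add T f1 f2)"
        using cmp_add_right[OF x y d(2)] cmp_add_right[OF f12(1,3) \<iota>] 
          cmp_add_right[OF cmp_closed[OF f12(1) \<iota>] cmp_closed[OF f12(3) \<iota>] d(2)] f12 by simp
      then show "\<exists>n f. f \<in> Hom T D (Y n) \<and> v \<bullet> Add T x y = v \<bullet> (\<iota> n \<bullet> f)" using add_closed[OF f12(1,3)] by blast
    qed
    then obtain n f where f: "f \<in> Hom T D (Y n)" "z = v \<bullet> (\<iota> n \<bullet> f)" using y(2) by blast
    have z1: "z = (v \<bullet> \<iota> n) \<bullet> f" using cmp_assoc[OF f(1) \<iota> d(2)] f(2) by simp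
    then have "a n \<bullet> f = Nul T D X" using bz cmp_assoc[OF f(1) vi b(1)] bvi by simp
    then have "g n \<bullet> f = Nul T D (Y (Suc n))" using g(3) D f(1) by blast
    then have "(v \<bullet> (\<iota> (Suc n) \<bullet> g n)) \<bullet> f = Nul T D H"
      using cmp_assoc[OF f(1) ig d(2)] cmp_assoc[OF f(1) g(1) \<iota>] cmp_nul[OF \<iota> Dob] cmp_nul[OF d(2) Dob] by simp
    then show ?thesis using z1 vg by simp
  qed
  obtain L b' b'' where eb: "exact_triangle T H X L b b' b''" using tri_cone[OF b(1)] by blast
  note db = exact_triangleD[OF eb]
  \<comment> \<open>By \<open>surj\<close> and \<open>inj\<close>, composition with \<open>b\<close>
    is bijective on arrows from \<open>A\<close>. As \<open>A\<close> is stable under desuspension,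
    exactness leaves only zero arrows to the cone \<open>L\<close>.\<close>
  have "y = Nul T D L" if D: "D \<in> A" and y: "y \<in> Hom T D L" for D y
  proof -
    have Dob: "D \<in> Ob T" using Hom_dom[OF y] .
    obtain E where E: "E \<in> A" "Susp T E = D" 
      using A(3)[OF D, of "- 1"] shift_cancel(2)[OF Dob, of 1] shift_1[OF shift_ob[OF Dob]] by metis
    have bby: "b'' \<bullet> y \<in> Hom T (Susp T E) (Susp T H)" using cmp_closed[OF y db(3)] E by simp
    then obtain k where k: "k \<in> Hom T E H" "SuspA T k = b'' \<bullet> y" using suspA_surj E Aob d(6) by blast
    have "Neg T (SuspA T b) \<bullet> (b'' \<bullet> y) = Nul T D (Susp T X)"
      using cmp_assoc[OF y db(3) neg_closed[OF suspA_hom[OF b(1)]]] tri_comp_zero[OF tri_rot[OF tri_rot[OF eb]]] 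
        nul_cmp[OF y susp_ob[OF X]] by simp
    then have "SuspA T b \<bullet> (b'' \<bullet> y) = Nul T D (Susp T X)"
      using neg_cmp[OF bby suspA_hom[OF b(1)]] neg_eq_nul cmp_closed[OF bby suspA_hom[OF b(1)]] E(2) by simp
    then have "b \<bullet> k = Nul T E X"
      using suspA_cmp[OF k(1) b(1)] k(2) suspA_eq_nul[OF cmp_closed[OF k(1) b(1)]] E(2) by simp
    then have "k = Nul T E H" using inj E k by blast
    then have "b'' \<bullet> y = Nul T D (Susp T H)" using k(2) suspA_nul E Aob d(6) by auto
    then obtain x where x: "x \<in> Hom T D X" "y = b' \<bullet> x" using tri_cov[OF tri_rot[OF eb] y] by blast
    then obtain z where z: "z \<in> Hom T D H" "x = b \<bullet> z" using surj D by blast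
    show ?thesis using x z cmp_assoc[OF z(1) b(1) db(2)] tri_comp_zero[OF eb] nul_cmp[OF z(1) db(6)] by simp
  qed
  then show ?thesis using that eb HS by blast
qed

end

section \<open>Torsion in linear triangulated categories\<close>

locale linear_triangulated_category = 
  small_triangulated_category U T + R: graded_commutative_ring R + linear_structure T R \<phi>
  for U :: "'u set" and T :: "('o, 'm, 'z) triangulated_category_scheme" (structure)
    and R :: "('r, 'y) graded_ring_scheme" and \<phi> :: "int \<Rightarrow> 'r \<Rightarrow> 'o \<Rightarrow> 'm"
begin

section \<open>Homogeneous elements, primes and the action through the center\<close>

lemma grade_carrier: "s \<in> grade R n \<Longrightarrow> s \<in> carrier R"
  using additive_subgroup.a_Hcarr[OF R.grade_subgroup] by blast

lemma grade_minus: "s \<in> grade R n \<Longrightarrow> \<ominus>\<^bsub>R\<^esub> s \<in> grade R n"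
  using R.grade_subgroup additive_subgroup.a_subgroup subgroup.m_inv_closed by (metis R.abelian_group_axioms a_inv_def)

lemma Spec_proper: assumes q: "q \<in> Spec R" shows "\<one>\<^bsub>R\<^esub> \<notin> q"
  using q ideal.one_imp_carrier[of q R] by (auto simp: Spec_def)

lemma Spec_prime: 
  assumes q: "q \<in> Spec R" and "s \<in> carrier R" "t \<in> carrier R" "s \<notin> q" "t \<notin> q" shows "s \<otimes>\<^bsub>R\<^esub> t \<notin> q"
  using assms by (auto simp: Spec_def)

lemma phi_hom: "s \<in> grade R n \<Longrightarrow> X \<in> Ob T \<Longrightarrow> \<phi> n s X \<in> Hom T X (shift T n X)"
  and phi_nat: "s \<in> grade R n \<Longrightarrow> f \<in> Hom T X Y \<Longrightarrow> shiftA T n f \<bullet> \<phi> n s X = \<phi> n s Y \<bullet> f"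
  and phi_susp: "s \<in> grade R n \<Longrightarrow> X \<in> Ob T \<Longrightarrow> 
    \<phi> n s (Susp T X) = (if even n then SuspA T (\<phi> n s X) else Neg T (SuspA T (\<phi> n s X)))"
  using center_closed[of s n] by (auto simp: center_def)

lemma phi_mult: "r \<in> grade R m \<Longrightarrow> s \<in> grade R n \<Longrightarrow> X \<in> Ob T \<Longrightarrow> 
    \<phi> (m + n) (r \<otimes>\<^bsub>R\<^esub> s) X = shiftA T n (\<phi> m r X) \<bullet> \<phi> n s X"
  by (simp add: map_mult center_mult_def)

text \<open>Each suspension contributes a sign in odd degree. The sign is not recorded because
  annihilation does not depend on it.\<close>

lemma phi_shift: 
  assumes s: "s \<in> grade R n" and X: "X \<in> Ob T"
  shows "\<phi> n s (shift T k X) = shiftA T k (\<phi> n s X) \<or> \<phi> n s (shift T k X) = Neg T (shiftA T k (\<phi> n s X))"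
proof (induction k rule: int_shift_induct)
  case (2 k)
  note h = phi_hom[OF s X] and hk = phi_hom[OF s shift_ob[OF X, of k]]
  have sk: "shiftA T k (\<phi> n s X) \<in> Hom T (shift T k X) (shift T n (shift T k X))"
    using shiftA_hom[OF h, of k] shift_add[OF X, of k n] shift_add[OF X, of n k] by (simp add: add.commute)
  have "\<phi> n s (shift T (k + 1) X) = SuspA T (\<phi> n s (shift T k X)) \<or>
      \<phi> n s (shift T (k + 1) X) = Neg T (SuspA T (\<phi> n s (shift T k X)))"
    using phi_susp[OF s shift_ob[OF X, of k]] shift_Suc[OF X] by simp
  moreover have "shiftA T (k + 1) (\<phi> n s X) = SuspA T (shiftA T k (\<phi> n s X))"
    using shiftA_Suc Hom_arr[OF h] by blast
  moreover have "SuspA T (\<phi> n s (shift T k X)) = SuspA T (shiftA T k (\<phi> n s X)) \<longleftrightarrow> \<phi> n s (shift T k X) = shiftA T k (\<phi> n s X)"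
    using suspA_inj Hom_arr sk hk by metis
  moreover have "SuspA T (\<phi> n s (shift T k X)) = Neg T (SuspA T (shiftA T k (\<phi> n s X))) \<longleftrightarrow> \<phi> n s (shift T k X) = Neg T (shiftA T k (\<phi> n s X))"
    using suspA_inj Hom_arr sk hk suspA_neg neg_closed by metis
  moreover have "Neg T (SuspA T (\<phi> n s (shift T k X))) = b \<longleftrightarrow> SuspA T (\<phi> n s (shift T k X)) = Neg T b" 
    if "b \<in> Hom T (Susp T (shift T k X)) (Susp T (shift T n (shift T k X)))" for b
    using neg_neg suspA_hom[OF hk] that by metis
  ultimately show ?case using suspA_hom[OF sk] neg_closed neg_neg by metis
qed (simp add: shift_0 shiftA_0)

text \<open>Annihilation of \<open>x\<close> by \<open>s\<close>, written with \<open>Dom\<close>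
  and \<open>Cod\<close> so that it depends on the arrow alone, as
  \<open>localizing_negligible\<close> requires.\<close>

definition killed :: "int \<Rightarrow> 'r \<Rightarrow> 'm \<Rightarrow> bool" where
  "killed n s x \<longleftrightarrow> \<phi> n s (Cod T x) \<bullet> x = Nul T (Dom T x) (shift T n (Cod T x))"

lemma killed_iff: "x \<in> Hom T C X \<Longrightarrow> killed n s x \<longleftrightarrow> \<phi> n s X \<bullet> x = Nul T C (shift T n X)"
  by (auto simp: killed_def Hom_def)

lemma killed_iff': 
  "s \<in> grade R n \<Longrightarrow> x \<in> Hom T C X \<Longrightarrow> killed n s x \<longleftrightarrow> shiftA T n x \<bullet> \<phi> n s C = Nul T C (shift T n X)"
  by (simp add: killed_iff phi_nat)

lemma killed_pre:
  assumes s: "s \<in> grade R n" and x: "x \<in> Hom T C X" and y: "y \<in> Hom T D C" and k: "killed n s x"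
  shows "killed n s (x \<bullet> y)"
proof -
  note X = Hom_cod[OF x]
  show ?thesis using k cmp_assoc[OF y x phi_hom[OF s X]] nul_cmp[OF y shift_ob[OF X, of n]]
    by (simp add: killed_iff[OF x] killed_iff[OF cmp_closed[OF y x]])
qed

lemma killed_post:
  assumes s: "s \<in> grade R n" and x: "x \<in> Hom T C X" and y: "y \<in> Hom T X Y" and k: "killed n s x"
  shows "killed n s (y \<bullet> x)"
proof -
  note X = Hom_cod[OF x]
  have "\<phi> n s Y \<bullet> (y \<bullet> x) = (shiftA T n y \<bullet> \<phi> n s X) \<bullet> x" 
    using cmp_assoc[OF x y phi_hom[OF s Hom_cod[OF y]]] phi_nat[OF s y] by simp
  also have "\<dots> = shiftA T n y \<bullet> (\<phi> n s X \<bullet> x)" using cmp_assoc[OF x phi_hom[OF s X] shiftA_hom[OF y]] .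
  also have "\<dots> = Nul T C (shift T n Y)" 
    using k killed_iff[OF x] cmp_nul[OF shiftA_hom[OF y] Hom_dom[OF x]] by simp
  finally show ?thesis using killed_iff[OF cmp_closed[OF x y]] by simp
qed

lemma killed_add:
  assumes s: "s \<in> grade R n" and x: "x \<in> Hom T C X" and y: "y \<in> Hom T C X" and k: "killed n s x" "killed n s y"
  shows "killed n s (Add T x y)"
  using k cmp_add_right[OF x y phi_hom[OF s Hom_cod[OF x]]] 
    add_nul(1)[OF nul_closed[OF Hom_dom[OF x] shift_ob[OF Hom_cod[OF x], of n]]]
  by (simp add: killed_iff[OF x] killed_iff[OF y] killed_iff[OF add_closed[OF x y]])

lemma neg_cmp_nul_iff: 
  assumes "x \<in> Hom T C X" "g \<in> Hom T X Y" shows "Neg T g \<bullet> x = Nul T C Y \<longleftrightarrow> g \<bullet> x = Nul T C Y"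
  using neg_cmp[OF assms] neg_eq_nul[OF cmp_closed[OF assms]] neg_nul[OF Hom_dom[OF assms(1)] Hom_cod[OF assms(2)]] by metis

text \<open>The right-hand side is the action on the graded module \<open>Hom_star\<close>, which
  shifts the transformation at \<open>X\<close>; \<open>killed\<close> uses the transformation at
  the shifted object. The two differ at most by a sign.\<close>

lemma killed_shift_iff:
  assumes s: "s \<in> grade R n" and X: "X \<in> Ob T" and x: "x \<in> Hom T C (shift T k X)"
  shows "killed n s x \<longleftrightarrow> shiftA T k (\<phi> n s X) \<bullet> x = Nul T C (shift T (n + k) X)"
proof -
  have sk: "shiftA T k (\<phi> n s X) \<in> Hom T (shift T k X) (shift T (n + k) X)"
    using shiftA_hom[OF phi_hom[OF s X], of k] shift_add[OF X, of k n] by (simp add: add.commute)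
  show ?thesis
    unfolding killed_iff[OF x] shift_add[OF X, symmetric] 
    using phi_shift[OF s X, of k] neg_cmp_nul_iff[OF x sk] by metis
qed

lemma killed_shiftA:
  assumes s: "s \<in> grade R n" and x: "x \<in> Hom T C X"
  shows "killed n s (shiftA T k x) \<longleftrightarrow> killed n s x"
proof -
  note X = Hom_cod[OF x] and C = Hom_dom[OF x] and h = phi_hom[OF s Hom_cod[OF x]]
  have "shiftA T k (\<phi> n s X) \<bullet> shiftA T k x = shiftA T k (\<phi> n s X \<bullet> x)"
    using shiftA_cmp[OF x h] by simp
  moreover have "shift T (n + k) X = shift T k (shift T n X)" using shift_add[OF X, of k n] by (simp add: add.commute)
  ultimately show ?thesis 
    unfolding killed_shift_iff[OF s X shiftA_hom[OF x]] killed_iff[OF x]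
    using shiftA_eq_nul[OF cmp_closed[OF x h], of k] by simp
qed

lemma killed_mult_right:
  assumes r: "r \<in> grade R m" and s: "s \<in> grade R n" and x: "x \<in> Hom T C X" and k: "killed n s x"
  shows "killed (m + n) (r \<otimes>\<^bsub>R\<^esub> s) x"
proof -
  note X = Hom_cod[OF x] and C = Hom_dom[OF x]
  note h = phi_hom[OF r X] phi_hom[OF s X]
  have "\<phi> (m + n) (r \<otimes>\<^bsub>R\<^esub> s) X \<bullet> x = shiftA T n (\<phi> m r X) \<bullet> (\<phi> n s X \<bullet> x)"
    using phi_mult[OF r s X] cmp_assoc[OF x h(2) shiftA_hom[OF h(1)]] by simp
  then show ?thesis using k killed_iff[OF x] cmp_nul[OF shiftA_hom[OF h(1)] C] shift_add[OF X, of n m] 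
    by (simp add: add.commute)
qed

text \<open>Naturality of \<open>\<phi> n s\<close> along \<open>\<phi> m r X\<close> rewrites the
  action of the product as that of \<open>s\<close> following that of \<open>r\<close>.\<close>

lemma killed_mult_left:
  assumes r: "r \<in> grade R m" and s: "s \<in> grade R n" and x: "x \<in> Hom T C X" and k: "killed m r x"
  shows "killed (m + n) (r \<otimes>\<^bsub>R\<^esub> s) x"
proof -
  note X = Hom_cod[OF x] and C = Hom_dom[OF x]
  note h = phi_hom[OF r X] phi_hom[OF s X]
  have "\<phi> (m + n) (r \<otimes>\<^bsub>R\<^esub> s) X \<bullet> x = \<phi> n s (shift T m X) \<bullet> (\<phi> m r X \<bullet> x)"
    using phi_mult[OF r s X] phi_nat[OF s h(1)] cmp_assoc[OF x h(1) phi_hom[OF s shift_ob[OF X]]] by simp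
  then show ?thesis using k killed_iff[OF x] cmp_nul[OF phi_hom[OF s shift_ob[OF X]] C] shift_add[OF X, of n m] 
    by (simp add: add.commute)
qed

lemma killed_mult_cmp:
  assumes r: "r \<in> grade R m" and s: "s \<in> grade R n" and x: "x \<in> Hom T C X" and k: "killed m r (\<phi> n s X \<bullet> x)"
  shows "killed (m + n) (r \<otimes>\<^bsub>R\<^esub> s) x"
proof -
  note X = Hom_cod[OF x] and C = Hom_dom[OF x]
  note h = phi_hom[OF r X] phi_hom[OF s X]
  have "\<phi> (m + n) (r \<otimes>\<^bsub>R\<^esub> s) X \<bullet> x = shiftA T n (\<phi> m r X) \<bullet> (\<phi> n s X \<bullet> x)"
    using phi_mult[OF r s X] cmp_assoc[OF x h(2) shiftA_hom[OF h(1)]] by simp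
  then show ?thesis using k killed_iff[OF x] killed_shift_iff[OF r X cmp_closed[OF x h(2)]] by simp
qed

definition torsion :: "'r set \<Rightarrow> 'm \<Rightarrow> bool" where
  "torsion q x \<longleftrightarrow> (\<exists>n s. s \<in> grade R n \<and> s \<notin> q \<and> killed n s x)"

section \<open>Torsion of single arrows\<close>

lemma torsion_nul: assumes "q \<in> Spec R" "X \<in> Ob T" "Y \<in> Ob T" shows "torsion q (Nul T X Y)"
proof -
  have "killed 0 \<one>\<^bsub>R\<^esub> (Nul T X Y)" 
    using killed_iff[OF nul_closed[OF assms(2,3)]] cmp_nul[OF phi_hom[OF R.one_grade assms(3)] assms(2)] by simp
  then show ?thesis unfolding torsion_def using R.one_grade Spec_proper assms(1) by blast
qed

lemma torsion_pre: "x \<in> Hom T C X \<Longrightarrow> y \<in> Hom T D C \<Longrightarrow> torsion q x \<Longrightarrow> torsion q (x \<bullet> y)"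
  unfolding torsion_def using killed_pre by blast

lemma torsion_post: "x \<in> Hom T C X \<Longrightarrow> y \<in> Hom T X Y \<Longrightarrow> torsion q x \<Longrightarrow> torsion q (y \<bullet> x)"
  unfolding torsion_def using killed_post by blast

text \<open>The product of two annihilators annihilates both arrows, and it stays outside the prime
  \<open>q\<close>.\<close>

lemma torsion_add: 
  assumes q: "q \<in> Spec R" and x: "x \<in> Hom T C X" and y: "y \<in> Hom T C X" and "torsion q x" "torsion q y"
  shows "torsion q (Add T x y)"
proof -
  obtain m r n s where r: "r \<in> grade R m" "r \<notin> q" "killed m r x" and s: "s \<in> grade R n" "s \<notin> q" "killed n s y"
    using assms(4,5) unfolding torsion_def by blast
  note rs = R.mult_grade[OF r(1) s(1)]
  have "killed (m + n) (r \<otimes>\<^bsub>R\<^esub> s) (Add T x y)"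
    using killed_add[OF rs x y killed_mult_left[OF r(1) s(1) x r(3)] killed_mult_right[OF r(1) s(1) y s(3)]] .
  then show ?thesis unfolding torsion_def using rs Spec_prime[OF q] grade_carrier r s by blast
qed

lemma torsion_shiftA: "x \<in> Hom T C X \<Longrightarrow> torsion q (shiftA T k x) \<longleftrightarrow> torsion q x"
  unfolding torsion_def using killed_shiftA by blast

lemma torsion_susp: "x \<in> Hom T C X \<Longrightarrow> torsion q (SuspA T x) \<longleftrightarrow> torsion q x"
  using torsion_shiftA[of x C X q 1] shiftA_1 Hom_arr by metis

lemma torsion_mult:
  assumes q: "q \<in> Spec R" and s: "s \<in> grade R n" "s \<notin> q" and x: "x \<in> Hom T C X" and t: "torsion q (\<phi> n s X \<bullet> x)"
  shows "torsion q x"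
proof -
  obtain m r where r: "r \<in> grade R m" "r \<notin> q" "killed m r (\<phi> n s X \<bullet> x)" using t unfolding torsion_def by blast
  show ?thesis unfolding torsion_def 
    using killed_mult_cmp[OF r(1) s(1) x r(3)] R.mult_grade[OF r(1) s(1)] Spec_prime[OF q] grade_carrier r s by blast
qed

text \<open>If \<open>s\<close> annihilates \<open>g \<bullet> x\<close>, then \<open>s\<close>
  times \<open>x\<close> lifts to \<open>X\<close> up to a shift; an annihilator of the lifted arrow
  times \<open>s\<close> annihilates \<open>x\<close>. Torsion is asked of
  \<open>f \<bullet> y\<close> instead of \<open>y\<close> because in \<open>cone_torsion\<close> it
  is \<open>f\<close> itself that is torsion.\<close>

lemma torsion_ext:
  assumes q: "q \<in> Spec R" and e: "exact_triangle T X Y Z f g h" and x: "x \<in> Hom T C Y" and gx: "torsion q (g \<bullet> x)"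
    and f: "\<And>n y. y \<in> Hom T (shift T n C) X \<Longrightarrow> torsion q (f \<bullet> y)"
  shows "torsion q x"
proof -
  note d = exact_triangleD[OF e] and C = Hom_dom[OF x]
  obtain n s where s: "s \<in> grade R n" "s \<notin> q" "killed n s (g \<bullet> x)" using gx unfolding torsion_def by blast
  note h = phi_hom[OF s(1) d(5)] and gx = cmp_closed[OF x d(2)]
  have sx: "\<phi> n s Y \<bullet> x \<in> Hom T C (shift T n Y)" using cmp_closed[OF x h] .
  \<comment> \<open>The shift brings the target \<open>shift T n Y\<close> back to \<open>Y\<close>,
    where the triangle applies.\<close>
  define x' where "x' = shiftA T (- n) (\<phi> n s Y \<bullet> x)"
  have x': "x' \<in> Hom T (shift T (- n) C) Y" 
    using shiftA_hom[OF sx, of "- n"] shift_cancel(1)[OF d(5)] by (simp add: x'_def)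
  have nx': "shiftA T n x' = \<phi> n s Y \<bullet> x" using shiftA_cancel(2) Hom_arr[OF sx] by (simp add: x'_def)
  have "shiftA T n (g \<bullet> x') = shiftA T n g \<bullet> (\<phi> n s Y \<bullet> x)" using shiftA_cmp[OF x' d(2)] nx' by simp
  also have "\<dots> = \<phi> n s Z \<bullet> (g \<bullet> x)"
    using cmp_assoc[OF x h shiftA_hom[OF d(2)]] phi_nat[OF s(1) d(2)] cmp_assoc[OF x d(2) phi_hom[OF s(1) d(6)]] by simp
  also have "\<dots> = Nul T C (shift T n Z)" using s(3) killed_iff[OF gx] by simp
  finally have "g \<bullet> x' = Nul T (shift T (- n) C) Z" 
    using shiftA_eq_nul[OF cmp_closed[OF x' d(2)], of n] shift_cancel(2)[OF C] by simp
  then obtain y where y: "y \<in> Hom T (shift T (- n) C) X" "x' = f \<bullet> y" using tri_cov[OF e x'] by blast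
  then have "torsion q x'" using f by blast
  then have "torsion q (\<phi> n s Y \<bullet> x)" using torsion_shiftA[OF x', of q n] nx' by simp
  then show ?thesis using torsion_mult[OF q s(1,2) x] by blast
qed

text \<open>The vanishing of the localization of \<open>Hom_star T C X\<close> at \<open>q\<close>,
  stated for arrows. The shift is put on the source, which leaves \<open>X\<close> fixed in
  localizing conditions on \<open>X\<close>.\<close>

definition tors :: "'r set \<Rightarrow> 'o \<Rightarrow> 'o \<Rightarrow> bool" where
  "tors q C X \<longleftrightarrow> (\<forall>n. \<forall>x \<in> Hom T (shift T n C) X. torsion q x)"

lemma tors_iff:
  assumes "C \<in> Ob T" "X \<in> Ob T" shows "tors q C X \<longleftrightarrow> (\<forall>n. \<forall>x \<in> Hom T C (shift T n X). torsion q x)"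
proof
  assume t: "tors q C X"
  have "torsion q x" if x: "x \<in> Hom T C (shift T n X)" for n x
    using t torsion_shiftA[OF x, of q "- n"] shiftA_hom[OF x, of "- n"] shift_cancel(1)[OF assms(2)] 
    unfolding tors_def by auto
  then show "\<forall>n. \<forall>x \<in> Hom T C (shift T n X). torsion q x" by blast
next
  assume t: "\<forall>n. \<forall>x \<in> Hom T C (shift T n X). torsion q x"
  have "torsion q x" if x: "x \<in> Hom T (shift T n C) X" for n x
    using t torsion_shiftA[OF x, of q "- n"] shiftA_hom[OF x, of "- n"] shift_cancel(1)[OF assms(1)] by auto
  then show "tors q C X" unfolding tors_def by blast
qed

lemma tors_shift: assumes "C \<in> Ob T" shows "tors q (shift T k C) X \<longleftrightarrow> tors q C X"
proof -
  have "(\<forall>n. Q (shift T n (shift T k C))) \<longleftrightarrow> (\<forall>n. Q (shift T n C))" for Q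
    using shift_add[OF assms] by (metis diff_add_cancel)
  from this[of "\<lambda>Y. \<forall>x \<in> Hom T Y X. torsion q x"] show ?thesis by (simp add: tors_def)
qed

lemma tors_susp: "C \<in> Ob T \<Longrightarrow> tors q (Susp T C) X \<longleftrightarrow> tors q C X"
  using tors_shift[of C q 1 X] shift_1 by simp

lemma localizing_tors: 
  assumes q: "q \<in> Spec R" and A: "\<And>D. D \<in> A \<Longrightarrow> finitary D"
  shows "localizing U T {X \<in> Ob T. \<forall>D \<in> A. tors q D X}"
  unfolding tors_def
proof (rule localizing_negligible[OF A])
  show "torsion q x" if "exact_triangle T X Y Z f g h" "x \<in> Hom T C Y" "torsion q (g \<bullet> x)"
      and y: "\<And>n y. y \<in> Hom T (shift T n C) X \<Longrightarrow> torsion q y" for X Y Z f g h C x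
    using torsion_ext[OF q that(1-3)] torsion_post[OF _ exact_triangleD(1)[OF that(1)] y] by blast
qed (use torsion_nul[OF q] torsion_add[OF q] torsion_post torsion_susp in blast)+

text \<open>The counterpart of \<open>torsion_ext\<close> in the first variable: if \<open>s\<close>
  annihilates \<open>x \<bullet> g\<close>, then \<open>s\<close> times \<open>x\<close> factors
  through \<open>Susp T A\<close>.\<close>

lemma tors_cone:
  assumes q: "q \<in> Spec R" and e: "exact_triangle T A B D f g h" and A: "tors q A X" and B: "tors q B X" and X: "X \<in> Ob T"
  shows "tors q D X"
  unfolding tors_iff[OF exact_triangleD(6)[OF e] X]
proof (intro allI ballI)
  note d = exact_triangleD[OF e]
  fix k x assume x: "x \<in> Hom T D (shift T k X)"
  note Xk = shift_ob[OF X, of k]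
  have "torsion q (x \<bullet> g)" using B cmp_closed[OF d(2) x] unfolding tors_iff[OF d(5) X] by blast
  then obtain n s where s: "s \<in> grade R n" "s \<notin> q" "killed n s (x \<bullet> g)" unfolding torsion_def by blast
  note h = phi_hom[OF s(1) Xk]
  have "(\<phi> n s (shift T k X) \<bullet> x) \<bullet> g = Nul T B (shift T n (shift T k X))"
    using s(3) killed_iff[OF cmp_closed[OF d(2) x]] cmp_assoc[OF d(2) x h] by simp
  then obtain y where y: "y \<in> Hom T (Susp T A) (shift T n (shift T k X))" "\<phi> n s (shift T k X) \<bullet> x = y \<bullet> h"
    using tri_contra[OF tri_rot[OF e] cmp_closed[OF x h]] by blast
  have "tors q (Susp T A) X" using A tors_susp[OF d(4)] by simp
  then have "torsion q y" using y(1) shift_add[OF X, of n k, symmetric] unfolding tors_iff[OF susp_ob[OF d(4)] X] by auto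
  then have "torsion q (y \<bullet> h)" using torsion_pre[OF y(1) d(3)] by blast
  then show "torsion q x" using torsion_mult[OF q s(1,2) x] y(2) by simp
qed

section \<open>Objects with torsion identity\<close>

lemma torsion_idn_shift: assumes "D \<in> Ob T" shows "torsion q (Idn T (shift T n D)) \<longleftrightarrow> torsion q (Idn T D)"
  using torsion_shiftA[OF idn_closed[OF assms], of q n] shiftA_idn[OF assms] by simp

lemma torsion_of_dom: "torsion q (Idn T D) \<Longrightarrow> x \<in> Hom T D X \<Longrightarrow> torsion q x"
  using torsion_post[OF idn_closed] idn_right Hom_dom by metis

lemma torsion_of_cod: "torsion q (Idn T X) \<Longrightarrow> x \<in> Hom T D X \<Longrightarrow> torsion q x"
  using torsion_pre[OF idn_closed] idn_left Hom_cod by metis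

lemma tors_of_dom: "D \<in> Ob T \<Longrightarrow> torsion q (Idn T D) \<Longrightarrow> tors q D X"
  unfolding tors_def using torsion_of_dom torsion_idn_shift by blast

lemma tors_of_cod: "torsion q (Idn T X) \<Longrightarrow> tors q D X"
  unfolding tors_def using torsion_of_cod by blast

lemma torsion_idn: assumes "tors q D D" "D \<in> Ob T" shows "torsion q (Idn T D)"
  using assms(1) idn_closed[OF assms(2)] shift_0[of D] unfolding tors_def by metis

text \<open>\<open>s\<close> annihilates both \<open>\<beta>\<close> and \<open>\<gamma>\<close>,
  because consecutive arrows of the triangle compose to zero. The identity of the cone is an
  extension of these two and hence torsion, although \<open>s\<close> itself need not annihilate
  it.\<close>

lemma cone_torsion:
  assumes q: "q \<in> Spec R" and s: "s \<in> grade R n" "s \<notin> q" and A: "A \<in> Ob T"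
    and e: "exact_triangle T A (shift T n A) D (\<phi> n s A) \<beta> \<gamma>"
  shows "torsion q (Idn T D)"
proof (rule torsion_ext[OF q tri_rot[OF e]])
  note d = exact_triangleD[OF e] and h = phi_hom[OF s(1) A]
  show "Idn T D \<in> Hom T D D" using idn_closed d by blast
  have "SuspA T (\<phi> n s A) \<bullet> \<gamma> = Nul T D (Susp T (shift T n A))"
    using tri_comp_zero[OF tri_rot[OF tri_rot[OF e]]] neg_cmp_nul_iff[OF d(3) suspA_hom[OF h]] by simp
  moreover have "shiftA T 1 (\<phi> n s A) = SuspA T (\<phi> n s A)" using shiftA_1 Hom_arr[OF h] by blast
  moreover have "shift T (n + 1) A = Susp T (shift T n A)" using shift_Suc[OF A] .
  moreover have "\<gamma> \<in> Hom T D (shift T 1 A)" using d(3) shift_1[OF A] by simp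
  ultimately have "killed n s \<gamma>" using killed_shift_iff[OF s(1) A, of \<gamma> D 1] by simp
  then show "torsion q (\<gamma> \<bullet> Idn T D)" unfolding torsion_def using s idn_right[OF d(3)] by auto
  fix k y assume y: "y \<in> Hom T (shift T k D) (shift T n A)"
  have sb: "shiftA T n \<beta> \<in> Hom T (shift T n (shift T n A)) (shift T n D)" using shiftA_hom[OF d(2)] .
  have sh: "shiftA T n (\<phi> n s A) \<in> Hom T (shift T n A) (shift T n (shift T n A))" using shiftA_hom[OF h] .
  have 0: "shiftA T n \<beta> \<bullet> shiftA T n (\<phi> n s A) = Nul T (shift T n A) (shift T n D)"
    using shiftA_cmp[OF d(1) d(2)] tri_comp_zero[OF e] shiftA_nul[OF A d(6)] by simp
  have "shiftA T n \<beta> \<bullet> \<phi> n s (shift T n A) = Nul T (shift T n A) (shift T n D)"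
    using phi_shift[OF s(1) A, of n] cmp_neg[OF sh sb] 0 neg_nul[OF shift_ob[OF A] shift_ob[OF d(6)]] by metis
  then have "killed n s \<beta>" using killed_iff'[OF s(1) d(2)] by simp
  then have "torsion q \<beta>" unfolding torsion_def using s by blast
  then show "torsion q (\<beta> \<bullet> y)" using torsion_pre[OF d(2) y] by blast
qed

text \<open>If the localization is zero, equality of the fractions \<open>x\<close> over one and
  zero over one is an annihilator of \<open>x\<close> outside \<open>q\<close>. Conversely,
  annihilators of two numerators are combined into a common denominator that makes the fractions
  equal.\<close>

lemma localization_is_zero_iff:
  assumes q: "q \<in> Spec R" and C: "C \<in> Ob T" and X: "X \<in> Ob T"
  shows "localization_is_zero R q (Hom_star T C X) (Hom_star_act T \<phi> X) \<longleftrightarrow> tors q C X"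
proof -
  let ?M = "Hom_star T C X" and ?act = "Hom_star_act T \<phi> X"
  have M: "carrier (?M i) = Hom T C (shift T i X)" "\<one>\<^bsub>?M i\<^esub> = Nul T C (shift T i X)" for i
    by (simp_all add: Hom_star_def)
  have act_iff: "?act n i r x = Nul T C (shift T (n + i) X) \<longleftrightarrow> killed n r x"
    if "r \<in> grade R n" "x \<in> Hom T C (shift T i X)" for n i r x
    using killed_shift_iff[OF that(1) X that(2)] by (simp add: Hom_star_act_def)
  let ?F = "fractions R q ?M" and ?r = "fraction_rel R q ?M ?act"
  let ?e = "\<lambda>d. (0 :: int, \<one>\<^bsub>?M d\<^esub>, \<one>\<^bsub>R\<^esub>)"
  have one: "\<one>\<^bsub>R\<^esub> \<in> grade R 0" "\<one>\<^bsub>R\<^esub> \<notin> q" using R.one_grade Spec_proper[OF q] by auto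
  have e: "?e d \<in> ?F d" for d using one nul_closed[OF C shift_ob[OF X]] by (simp add: fractions_def M)
  show ?thesis
  proof
    assume z: "localization_is_zero R q ?M ?act"
    show "tors q C X" unfolding tors_iff[OF C X]
    proof (intro allI ballI)
      fix d x assume x: "x \<in> Hom T C (shift T d X)"
      let ?z = "(0 :: int, x, \<one>\<^bsub>R\<^esub>)"
      have zF: "?z \<in> ?F d" using one x by (simp add: fractions_def M)
      have "\<exists>l j. \<exists>a \<in> grade R l. \<exists>b \<in> grade R j. l + 0 = j + 0 \<and> a \<otimes>\<^bsub>R\<^esub> \<one>\<^bsub>R\<^esub> = b \<otimes>\<^bsub>R\<^esub> \<one>\<^bsub>R\<^esub> \<and>
          a \<otimes>\<^bsub>R\<^esub> \<one>\<^bsub>R\<^esub> \<notin> q \<and> ?act l (d + 0) a x = ?act j (d + 0) b x"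
        by (rule exI[of _ 0], rule exI[of _ 0], rule bexI[OF _ one(1)], rule bexI[OF _ one(1)])
          (use one(2) grade_carrier[OF one(1)] in simp)
      then have "(?z, ?z) \<in> ?r d" unfolding fraction_rel_def using zF by simp
      moreover have "?r d `` {?z} \<in> localization R q ?M ?act d"
        unfolding localization_def using quotientI[OF zF] .
      then have "?r d `` {?z} = ?r d `` {?e d}" using z unfolding localization_is_zero_def by simp
      ultimately have "(?e d, ?z) \<in> ?r d" by blast
      then obtain l j a b where ab: "a \<in> grade R l" "b \<in> grade R j" "l = j" "a \<otimes>\<^bsub>R\<^esub> \<one>\<^bsub>R\<^esub> = b \<otimes>\<^bsub>R\<^esub> \<one>\<^bsub>R\<^esub>" 
        "a \<otimes>\<^bsub>R\<^esub> \<one>\<^bsub>R\<^esub> \<notin> q" "?act l d a (Nul T C (shift T d X)) = ?act j d b x"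
        unfolding fraction_rel_def by (auto simp: M)
      have b: "b \<notin> q" using ab grade_carrier by simp
      have "shiftA T d (\<phi> l a X) \<in> Hom T (shift T d X) (shift T (l + d) X)"
        using shiftA_hom[OF phi_hom[OF ab(1) X], of d] shift_add[OF X, of d l] by (simp add: add.commute)
      then have "?act j d b x = Nul T C (shift T (j + d) X)"
        using ab(3,6) cmp_nul C by (simp add: Hom_star_act_def)
      then have "killed j b x" using act_iff[OF ab(2) x] by simp
      then show "torsion q x" unfolding torsion_def using ab b by blast
    qed
  next
    assume t: "tors q C X"
    \<comment> \<open>Under the torsion assumption any two fractions of the same degree are related,
      so every class is the whole set of fractions.\<close>
    have rel: "(z, w) \<in> ?r d" if z: "z \<in> ?F d" and w: "w \<in> ?F d" for z w d
    proof -
      obtain n x s k y t where zw: "z = (n, x, s)" "w = (k, y, t)" by (metis prod_cases3)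
      have s: "s \<in> grade R n" "s \<notin> q" "x \<in> Hom T C (shift T (d + n) X)" 
        and t: "t \<in> grade R k" "t \<notin> q" "y \<in> Hom T C (shift T (d + k) X)"
        using z w by (auto simp: zw fractions_def M)
      obtain i a0 j b0 where a0: "a0 \<in> grade R i" "a0 \<notin> q" "killed i a0 x" and b0: "b0 \<in> grade R j" "b0 \<notin> q" "killed j b0 y"
        using \<open>tors q C X\<close> s(3) t(3) unfolding tors_iff[OF C X] torsion_def by meson
      have bt: "b0 \<otimes>\<^bsub>R\<^esub> t \<in> grade R (j + k)" and as: "a0 \<otimes>\<^bsub>R\<^esub> s \<in> grade R (i + n)" 
        using R.mult_grade a0 b0 s t by blast+
      note cr = grade_carrier[OF a0(1)] grade_carrier[OF b0(1)] grade_carrier[OF s(1)] grade_carrier[OF t(1)]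
      \<comment> \<open>\<open>a1\<close> is \<open>a0\<close> times \<open>s\<close> with the sign
        that lets it pass \<open>b0\<close> times \<open>t\<close>. The multipliers \<open>a\<close>
        and \<open>b\<close> below end in \<open>a0\<close> and \<open>b0\<close>, so they
        annihilate \<open>x\<close> and \<open>y\<close>, and by this sign \<open>a\<close> times
        \<open>s\<close> equals \<open>b\<close> times \<open>t\<close>.\<close>
      define a1 where "a1 = (if even ((j + k) * (i + n)) then a0 \<otimes>\<^bsub>R\<^esub> s else \<ominus>\<^bsub>R\<^esub> (a0 \<otimes>\<^bsub>R\<^esub> s))"
      have a1: "a1 \<in> grade R (i + n)" using as grade_minus by (simp add: a1_def)
      have comm: "(b0 \<otimes>\<^bsub>R\<^esub> t) \<otimes>\<^bsub>R\<^esub> (a0 \<otimes>\<^bsub>R\<^esub> s) = a1 \<otimes>\<^bsub>R\<^esub> (b0 \<otimes>\<^bsub>R\<^esub> t)"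
        using R.graded_commute[OF bt as] cr by (simp add: a1_def R.l_minus)
      define a where "a = (b0 \<otimes>\<^bsub>R\<^esub> t) \<otimes>\<^bsub>R\<^esub> a0"
      define b where "b = a1 \<otimes>\<^bsub>R\<^esub> b0"
      have ga: "a \<in> grade R (j + k + i)" and gb: "b \<in> grade R (i + n + j)"
        using R.mult_grade bt a0 a1 b0 by (auto simp: a_def b_def)
      have eq: "a \<otimes>\<^bsub>R\<^esub> s = b \<otimes>\<^bsub>R\<^esub> t" 
        using comm cr grade_carrier[OF a1] by (simp add: a_def b_def R.m_assoc)
      have nq: "a \<otimes>\<^bsub>R\<^esub> s \<notin> q"
        unfolding a_def using cr a0 b0 s t Spec_prime[OF q] by simp
      have "killed (j + k + i) a x" unfolding a_def using killed_mult_right[OF bt a0(1) s(3) a0(3)] .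
      then have ax: "?act (j + k + i) (d + n) a x = Nul T C (shift T (j + k + i + (d + n)) X)"
        using act_iff[OF ga s(3)] by simp
      have "killed (i + n + j) b y" unfolding b_def using killed_mult_right[OF a1 b0(1) t(3) b0(3)] .
      then have "?act (i + n + j) (d + k) b y = Nul T C (shift T (i + n + j + (d + k)) X)"
        using act_iff[OF gb t(3)] by simp
      moreover have "i + n + j + (d + k) = j + k + i + (d + n)" by simp
      ultimately have "?act (j + k + i) (d + n) a x = ?act (i + n + j) (d + k) b y" using ax by metis
      moreover have "j + k + i + n = i + n + j + k" by simp
      ultimately show ?thesis
        using ga gb eq nq z w unfolding zw fraction_rel_def by blast
    qed
    have cls: "?r d `` {z} = ?F d" if "z \<in> ?F d" for z d
      using rel[OF that] by (auto simp: fraction_rel_def)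
    show "localization_is_zero R q ?M ?act"
      unfolding localization_is_zero_def localization_def
    proof
      fix d
      have "?F d // ?r d = (\<lambda>z. ?r d `` {z}) ` ?F d" by (auto simp: quotient_def)
      also have "\<dots> = (\<lambda>z. ?F d) ` ?F d" using cls by (intro image_cong) simp_all
      also have "\<dots> = {?F d}" using e[of d] by blast
      finally show "?F d // ?r d = {?r d `` {?e d}}" using cls[OF e] by simp
    qed
  qed
qed

lemma torsion_objects_eq:
  "torsion_objects U T R \<phi> V = {X \<in> Ob T. \<forall>q \<in> Spec R - V. \<forall>C \<in> compact_objects U T. tors q C X}"
proof -
  have "C \<in> Ob T" if "C \<in> compact_objects U T" for C using that by (simp add: compact_objects_def)
  then show ?thesis unfolding torsion_objects_def using localization_is_zero_iff by auto
qed

lemma localizing_torsion_objects: "localizing U T (torsion_objects U T R \<phi> V)"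
  unfolding torsion_objects_eq
  by (rule localizing_INT) (use localizing_tors compact_imp_finitary in blast)

end

section \<open>Koszul objects\<close>

locale noetherian_linear_category = linear_triangulated_category U T R \<phi> + noetherian_ring R
  for U :: "'u set" and T :: "('o, 'm, 'z) triangulated_category_scheme" (structure)
    and R :: "('r, 'y) graded_ring_scheme" and \<phi> :: "int \<Rightarrow> 'r \<Rightarrow> 'o \<Rightarrow> 'm" +
  fixes gens :: "'o set"
  assumes small_gens: "small U gens" and compact_gens: "gens \<subseteq> compact_objects U T"
    and generates: "Ob T = Loc U T gens" and small_R: "small U (carrier R)"
begin

text \<open>One chosen cone for each \<open>s\<close> and \<open>D\<close>: adding all isomorphic
  copies of cones could make the set of Koszul objects too large.\<close>

definition cone_obj :: "int \<Rightarrow> 'r \<Rightarrow> 'o \<Rightarrow> 'o" where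
  "cone_obj n s D = (SOME E. \<exists>\<beta> \<gamma>. exact_triangle T D (shift T n D) E (\<phi> n s D) \<beta> \<gamma>)"

definition koszul_step :: "'o set \<Rightarrow> 'o set" where
  "koszul_step B = B \<union> (\<Union>n. shift T n ` B) \<union> (\<Union>n. \<Union>s \<in> grade R n. cone_obj n s ` B)"

definition koszul :: "'o set" where
  "koszul = (\<Union>k. (koszul_step ^^ k) gens)"

lemma cone_obj: 
  assumes "s \<in> grade R n" "D \<in> Ob T" 
  obtains \<beta> \<gamma> where "exact_triangle T D (shift T n D) (cone_obj n s D) (\<phi> n s D) \<beta> \<gamma>"
proof -
  have "\<exists>E \<beta> \<gamma>. exact_triangle T D (shift T n D) E (\<phi> n s D) \<beta> \<gamma>" using tri_cone[OF phi_hom[OF assms]] by blast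
  from someI_ex[OF this] show ?thesis using that unfolding cone_obj_def by blast
qed

lemma koszul_gens: "D \<in> gens \<Longrightarrow> D \<in> koszul"
  unfolding koszul_def by (rule UN_I[of 0]) auto

lemma koszul_shift: assumes "D \<in> koszul" shows "shift T n D \<in> koszul"
proof -
  obtain k where "D \<in> (koszul_step ^^ k) gens" using assms by (auto simp: koszul_def)
  then have "shift T n D \<in> (koszul_step ^^ Suc k) gens" by (auto simp: koszul_step_def)
  then show ?thesis unfolding koszul_def by blast
qed

lemma koszul_cone: assumes "D \<in> koszul" "s \<in> grade R n" shows "cone_obj n s D \<in> koszul"
proof -
  obtain k where "D \<in> (koszul_step ^^ k) gens" using assms by (auto simp: koszul_def)
  then have "cone_obj n s D \<in> (koszul_step ^^ Suc k) gens" using assms(2) by (auto simp: koszul_step_def)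
  then show ?thesis unfolding koszul_def by blast
qed

lemma koszul_induct [consumes 1, case_names gens shift cone]:
  assumes D: "D \<in> koszul" and gens: "\<And>D. D \<in> gens \<Longrightarrow> P D" 
    and shift: "\<And>D n. P D \<Longrightarrow> P (shift T n D)"
    and cone: "\<And>D n s. P D \<Longrightarrow> s \<in> grade R n \<Longrightarrow> P (cone_obj n s D)"
  shows "P D"
proof -
  have "\<forall>D \<in> (koszul_step ^^ k) gens. P D" for k
    by (induction k) (use gens shift cone in \<open>auto simp: koszul_step_def\<close>)
  then show ?thesis using D by (auto simp: koszul_def)
qed

text \<open>There are countably many steps, each a union over integers and homogeneous elements of
  \<open>R\<close>.\<close>

lemma small_koszul: "small U koszul"
proof -
  have int: "small U (UNIV :: int set)" and nat: "small U (UNIV :: nat set)" by (rule small_countable; simp)+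
  have step: "small U (koszul_step B)" if B: "small U B" for B
  proof -
    have "small U (\<Union>n. shift T n ` B)" by (rule small_UN[OF int]) (rule small_image[OF B])
    moreover have "small U (\<Union>s \<in> grade R n. cone_obj n s ` B)" for n
    proof (rule small_UN)
      show "small U (grade R n)" by (rule small_subset[OF small_R]) (use grade_carrier in blast)
    qed (rule small_image[OF B])
    then have "small U (\<Union>n. \<Union>s \<in> grade R n. cone_obj n s ` B)" by (rule small_UN[OF int])
    ultimately show ?thesis unfolding koszul_step_def by (intro small_Un B)
  qed
  have "small U ((koszul_step ^^ k) gens)" for k
    by (induction k) (use small_gens step in simp_all)
  then show ?thesis unfolding koszul_def by (rule small_UN[OF nat])
qed

lemma koszul_finitary: assumes "D \<in> koszul" shows "finitary D"
  using assms
proof (induction rule: koszul_induct)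
  case (gens D) then show ?case using compact_imp_finitary compact_gens by blast
next
  case (shift D n) then show ?case by (rule finitary_shift)
next
  case (cone D n s)
  obtain \<beta> \<gamma> where "exact_triangle T D (shift T n D) (cone_obj n s D) (\<phi> n s D) \<beta> \<gamma>"
    using cone_obj[OF cone(2) finitary_ob[OF cone(1)]] .
  then show ?case using finitary_cone cone(1) finitary_shift by blast
qed

lemma koszul_ob: "D \<in> koszul \<Longrightarrow> D \<in> Ob T"
  using koszul_finitary finitary_ob by blast

abbreviation tobj :: "'r set set \<Rightarrow> 'o set" where
  "tobj V \<equiv> torsion_objects U T R \<phi> V"

lemma tobj_ob: "X \<in> tobj V \<Longrightarrow> X \<in> Ob T"
  by (simp add: torsion_objects_eq)

text \<open>The definition of \<open>torsion_objects\<close> tests compact objects, while Koszul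
  objects have only been shown to be finitary. The condition is therefore propagated from the
  generators through shifts and cones.\<close>

lemma tobj_tors_koszul:
  assumes X: "X \<in> tobj V" and q: "q \<in> Spec R" "q \<notin> V" and D: "D \<in> koszul" shows "tors q D X"
proof -
  have "D \<in> Ob T \<and> tors q D X" using D
  proof (induction rule: koszul_induct)
    case (gens D) then show ?case using X q compact_gens by (auto simp: torsion_objects_eq compact_objects_def)
  next
    case (shift D n) then show ?case using tors_shift shift_ob by simp
  next
    case (cone D n s)
    then obtain \<beta> \<gamma> where e: "exact_triangle T D (shift T n D) (cone_obj n s D) (\<phi> n s D) \<beta> \<gamma>"
      using cone_obj by blast
    then show ?case using tors_cone[OF q(1) e _ _ tobj_ob[OF X]] tors_shift cone(1) exact_triangleD(6)[OF e] by blast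
  qed
  then show ?thesis by blast
qed

definition koszul_in :: "'r set set \<Rightarrow> 'o set" where
  "koszul_in V = koszul \<inter> tobj V"

lemma koszul_in_shift: "D \<in> koszul_in V \<Longrightarrow> shift T n D \<in> koszul_in V"
  unfolding koszul_in_def using koszul_shift localizing_shift[OF localizing_torsion_objects] by blast

lemma koszul_in_finitary: "D \<in> koszul_in V \<Longrightarrow> finitary D"
  unfolding koszul_in_def using koszul_finitary by blast

text \<open>Such a \<open>D\<close> is both a test object and a member of \<open>tobj V\<close>, so
  its own identity is one of the arrows tested.\<close>

lemma koszul_in_torsion: 
  assumes D: "D \<in> koszul_in V" and q: "q \<in> Spec R" "q \<notin> V" shows "torsion q (Idn T D)"
  using tobj_tors_koszul[OF _ q, of D D] torsion_idn D koszul_ob unfolding koszul_in_def by blast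

text \<open>Otherwise the left orthogonal of \<open>L\<close> and its shifts, a localizing
  subcategory, contains the generators, hence also \<open>L\<close>.\<close>

lemma ex_koszul_map:
  assumes L: "L \<in> Ob T" and nz: "\<not> zero_obj T L"
  shows "\<exists>D \<in> koszul. \<exists>x \<in> Hom T D L. x \<noteq> Nul T D L"
proof (rule ccontr)
  assume "\<not> ?thesis"
  then have "gens \<subseteq> {Y \<in> Ob T. \<forall>n. \<forall>x \<in> Hom T (shift T n Y) L. x = Nul T (shift T n Y) L}"
    using koszul_gens koszul_shift koszul_ob by blast
  then have "Ob T \<subseteq> {Y \<in> Ob T. \<forall>n. \<forall>x \<in> Hom T (shift T n Y) L. x = Nul T (shift T n Y) L}"
    unfolding generates using Loc_least[OF localizing_left_orth[OF L]] by (simp add: generates)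
  then have "\<forall>x \<in> Hom T (shift T 0 L) L. x = Nul T (shift T 0 L) L" using L by blast
  then have "Idn T L = Nul T L L" using idn_closed[OF L] by (simp add: shift_0)
  then show False using zero_objI L nz by blast
qed

text \<open>
  Among the nonzero maps from Koszul objects \<open>D\<close> to \<open>L\<close>, one for which the intersection of the
  primes supporting \<open>D\<close> is maximal has its source in \<open>T\<^sub>V\<close>: otherwise it factors
  through the cone on some \<open>s\<close>, and \<open>s\<close> enlarges that intersection.
\<close>

lemma koszul_in_generates:
  assumes L: "L \<in> tobj V" and nz: "\<not> zero_obj T L"
  obtains D x where "D \<in> koszul_in V" "x \<in> Hom T D L" "x \<noteq> Nul T D L"
proof -
  have Lob: "L \<in> Ob T" using tobj_ob[OF L] .
  define W where "W D = {q \<in> Spec R. \<not> torsion q (Idn T D)}" for D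
  \<comment> \<open>Inserting \<open>carrier R\<close> makes the intersection the unit ideal when no
    prime supports \<open>D\<close>.\<close>
  define a where "a D = \<Inter>(insert (carrier R) (W D))" for D
  have aid: "ideal (a D) R" for D
    unfolding a_def using R.i_Intersect[of "insert (carrier R) (W D)"] R.oneideal by (auto simp: W_def Spec_def)
  define F where "F = {a D | D. D \<in> koszul \<and> (\<exists>x \<in> Hom T D L. x \<noteq> Nul T D L)}"
  have "F \<noteq> {}" using ex_koszul_map[OF Lob nz] unfolding F_def by auto
  \<comment> \<open>In a noetherian ring the union of a nonempty chain of ideals is a member of the
    chain, so Zorn's lemma gives a maximal \<open>a D\<close>.\<close>
  moreover have "\<Union>C \<in> F" if "C \<noteq> {}" "subset.chain F C" for C
  proof -
    have "C \<subseteq> F" using that(2) by (simp add: subset.chain_def)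
    then have "subset.chain {I. ideal I R} C" using that(2) aid by (auto simp: subset.chain_def F_def)
    then show ?thesis using ideal_chain_is_trivial[OF that(1)] \<open>C \<subseteq> F\<close> by blast
  qed
  ultimately obtain M where M: "M \<in> F" "\<And>N. N \<in> F \<Longrightarrow> M \<subseteq> N \<Longrightarrow> N = M"
    using subset_Zorn_nonempty[of F] by metis
  obtain D x where D: "D \<in> koszul" "M = a D" and x: "x \<in> Hom T D L" "x \<noteq> Nul T D L" using M(1) unfolding F_def by blast
  have Dob: "D \<in> Ob T" using koszul_ob[OF D(1)] .
  have "D \<in> tobj V"
  proof (rule ccontr)
    assume "D \<notin> tobj V"
    \<comment> \<open>The prime \<open>q\<close> supports \<open>D\<close>, since a
      \<open>q\<close>-torsion identity of \<open>D\<close> would make all arrows into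
      \<open>D\<close> \<open>q\<close>-torsion.\<close>
    then obtain C q where q: "q \<in> Spec R" "q \<notin> V" "\<not> tors q C D" using Dob unfolding torsion_objects_eq by blast
    have qW: "q \<in> W D" using tors_of_cod q by (auto simp: W_def)
    have "torsion q x" using tobj_tors_koszul[OF L q(1,2) D(1)] x(1) shift_0[of D] unfolding tors_def by metis
    then obtain n s where s: "s \<in> grade R n" "s \<notin> q" "killed n s x" unfolding torsion_def by blast
    obtain \<beta> \<gamma> where e: "exact_triangle T D (shift T n D) (cone_obj n s D) (\<phi> n s D) \<beta> \<gamma>"
      using cone_obj[OF s(1) Dob] .
    let ?E = "cone_obj n s D"
    note d = exact_triangleD[OF e]
    have "shiftA T n x \<bullet> \<phi> n s D = Nul T D (shift T n L)" using s(3) killed_iff'[OF s(1) x(1)] by simp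
    then obtain y where y: "y \<in> Hom T ?E (shift T n L)" "shiftA T n x = y \<bullet> \<beta>"
      using tri_contra[OF e shiftA_hom[OF x(1)]] by blast
    have ynz: "y \<noteq> Nul T ?E (shift T n L)"
      using y(2) nul_cmp[OF d(2) shift_ob[OF Lob]] shiftA_eq_nul[OF x(1)] x(2) by auto
    \<comment> \<open>The nonzero arrow from the cone ends in a shift of \<open>L\<close>; shifting
      its source back makes it a competitor with target \<open>L\<close>.\<close>
    define E' where "E' = shift T (- n) ?E"
    have y': "shiftA T (- n) y \<in> Hom T E' L" 
      using shiftA_hom[OF y(1), of "- n"] shift_cancel(1)[OF Lob] by (simp add: E'_def)
    have y'nz: "shiftA T (- n) y \<noteq> Nul T E' L"
      using shiftA_eq_nul[OF y(1), of "- n"] ynz shift_cancel(1)[OF Lob] by (simp add: E'_def)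
    have E': "E' \<in> koszul" unfolding E'_def using koszul_shift koszul_cone D(1) s(1) by blast
    have "a E' \<in> F" unfolding F_def using E' y' y'nz by blast
    \<comment> \<open>Primes supporting the cone contain \<open>s\<close>, because elements outside
      a prime have torsion cones there. They also support \<open>D\<close>, because torsion passes
      from \<open>D\<close> to the cone.\<close>
    have W: "s \<in> r \<and> r \<in> W D" if r: "r \<in> W E'" for r
    proof -
      have rS: "r \<in> Spec R" and nt: "\<not> torsion r (Idn T ?E)" 
        using r torsion_idn_shift[OF d(6)] by (auto simp: W_def E'_def)
      have "s \<in> r" using cone_torsion[OF rS s(1) _ Dob e] nt by blast
      moreover have "\<not> torsion r (Idn T D)"
      proof
        assume "torsion r (Idn T D)"
        then have "tors r D ?E" using tors_of_dom Dob by blast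
        then have "tors r ?E ?E" using tors_cone[OF rS e _ _ d(6)] tors_shift[OF Dob] by blast
        then show False using torsion_idn d(6) nt by blast
      qed
      ultimately show ?thesis using rS by (simp add: W_def)
    qed
    have "a D \<subseteq> a E'" unfolding a_def using W by blast
    then have "a E' = a D" using M(2) \<open>a E' \<in> F\<close> D(2) by blast
    moreover have "s \<in> a E'" unfolding a_def using W grade_carrier[OF s(1)] by blast
    moreover have "s \<notin> a D" unfolding a_def using qW s(2) by blast
    ultimately show False by blast
  qed
  then show ?thesis using that D(1) x unfolding koszul_in_def by blast
qed

section \<open>Localization triangles\<close>

definition local_objects :: "'r set set \<Rightarrow> 'o set" where
  "local_objects V = {L \<in> Ob T. \<forall>Y \<in> tobj V. Hom T Y L = {Nul T Y L}}"

lemma local_objectsD: "L \<in> local_objects V \<Longrightarrow> Y \<in> tobj V \<Longrightarrow> x \<in> Hom T Y L \<Longrightarrow> x = Nul T Y L"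
  by (auto simp: local_objects_def)

lemma local_objects_ob: "L \<in> local_objects V \<Longrightarrow> L \<in> Ob T"
  by (simp add: local_objects_def)

lemma koszul_triangle:
  assumes X: "X \<in> Ob T"
  obtains G L f g h where "exact_triangle T G X L f g h" "G \<in> Loc U T (koszul_in V)" 
    "\<And>D x. D \<in> koszul_in V \<Longrightarrow> x \<in> Hom T D L \<Longrightarrow> x = Nul T D L"
proof (rule bousfield_triangle[of "koszul_in V" X])
  show "small U (koszul_in V)" by (rule small_subset[OF small_koszul]) (simp add: koszul_in_def)
qed (use koszul_in_finitary koszul_in_shift X that in blast)+

lemma koszul_in_ob: "koszul_in V \<subseteq> Ob T"
  using koszul_in_finitary finitary_ob by blast

text \<open>For \<open>Y\<close> in \<open>tobj V\<close>, the third object of its triangle is also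
  in \<open>tobj V\<close> but receives only zero arrows from \<open>koszul_in V\<close>. By
  \<open>koszul_in_generates\<close> it is zero.\<close>

lemma tobj_eq_Loc: "tobj V = Loc U T (koszul_in V)"
proof
  show sub: "Loc U T (koszul_in V) \<subseteq> tobj V"
    by (rule Loc_least[OF localizing_torsion_objects]) (simp add: koszul_in_def)
  show "tobj V \<subseteq> Loc U T (koszul_in V)"
  proof
    fix Y assume Y: "Y \<in> tobj V"
    obtain G L f g h where e: "exact_triangle T G Y L f g h" "G \<in> Loc U T (koszul_in V)" 
      "\<And>D x. D \<in> koszul_in V \<Longrightarrow> x \<in> Hom T D L \<Longrightarrow> x = Nul T D L" 
      by (rule koszul_triangle[OF tobj_ob[OF Y], of V]) (rule that)
    have "L \<in> tobj V" using localizing_third[OF localizing_torsion_objects e(1) _ Y] sub e(2) by blast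
    then have "zero_obj T L" using koszul_in_generates e(3) by metis
    then show "Y \<in> Loc U T (koszul_in V)"
      using localizing_iso[OF localizing_Loc[OF koszul_in_ob] e(2)] tri_iso_cone_zero[OF e(1)] by blast
  qed
qed

text \<open>Locality may be tested on the small set \<open>koszul_in V\<close> because this set
  generates \<open>tobj V\<close>.\<close>

lemma local_objectsI:
  assumes L: "L \<in> Ob T" and D: "\<And>D x. D \<in> koszul_in V \<Longrightarrow> x \<in> Hom T D L \<Longrightarrow> x = Nul T D L"
  shows "L \<in> local_objects V"
proof -
  let ?S = "{Y \<in> Ob T. \<forall>n. \<forall>x \<in> Hom T (shift T n Y) L. x = Nul T (shift T n Y) L}"
  have "koszul_in V \<subseteq> ?S" using D koszul_in_shift koszul_in_ob by blast
  then have "tobj V \<subseteq> ?S" unfolding tobj_eq_Loc by (rule Loc_least[OF localizing_left_orth[OF L]])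
  then have S: "tobj V \<subseteq> ?S" .
  have "x = Nul T Y L" if Y: "Y \<in> tobj V" and x: "x \<in> Hom T Y L" for Y x
  proof -
    have "\<forall>n. \<forall>x \<in> Hom T (shift T n Y) L. x = Nul T (shift T n Y) L" using subsetD[OF S Y] by simp
    from this[rule_format, of x 0] show ?thesis using x by (simp add: shift_0)
  qed
  then show ?thesis using L nul_closed tobj_ob unfolding local_objects_def by blast
qed

text \<open>Closure under coproducts is the essential point: local objects are right orthogonal to
  finitary objects.\<close>

lemma localizing_local_objects: "localizing U T (local_objects V)"
proof -
  have "local_objects V = {L \<in> Ob T. \<forall>D \<in> koszul_in V. \<forall>n. \<forall>x \<in> Hom T (shift T n D) L. x = Nul T (Dom T x) (Cod T x)}" (is "_ = ?S")
  proof
    show "local_objects V \<subseteq> ?S"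
    proof (clarify, intro conjI ballI allI)
      fix L D n x assume L: "L \<in> local_objects V"
      show "L \<in> Ob T" using local_objects_ob L by blast
      assume "D \<in> koszul_in V" and x: "x \<in> Hom T (shift T n D) L"
      then have "shift T n D \<in> tobj V" using koszul_in_shift unfolding koszul_in_def by blast
      then show "x = Nul T (Dom T x) (Cod T x)" using local_objectsD[OF L _ x] x by (simp add: Hom_def)
    qed
    show "?S \<subseteq> local_objects V"
    proof
      fix L assume L: "L \<in> ?S"
      show "L \<in> local_objects V"
      proof (rule local_objectsI)
        show "L \<in> Ob T" using L by blast
        fix D x assume D: "D \<in> koszul_in V" and x: "x \<in> Hom T D L"
        have "\<forall>D \<in> koszul_in V. \<forall>n. \<forall>x \<in> Hom T (shift T n D) L. x = Nul T (Dom T x) (Cod T x)" using L by simp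
        from this[rule_format, OF D, of x 0] have "x = Nul T (Dom T x) (Cod T x)" using x by (simp add: shift_0)
        then show "x = Nul T D L" using x by (simp add: Hom_def)
      qed
    qed
  qed
  then show ?thesis using localizing_right_orth[of "koszul_in V"] koszul_in_finitary by simp
qed

text \<open>A triangle as required exists, so the choice in \<open>Gam\<close> and
  \<open>Lfun\<close> has the intended properties.\<close>

lemma localization_triangle:
  assumes X: "X \<in> Ob T"
  obtains f g h where "exact_triangle T (Gam U T R \<phi> V X) X (Lfun U T R \<phi> V X) f g h" 
    "Gam U T R \<phi> V X \<in> tobj V" "Lfun U T R \<phi> V X \<in> local_objects V"
proof -
  obtain G L f g h where e: "exact_triangle T G X L f g h" "G \<in> Loc U T (koszul_in V)" 
    "\<And>D x. D \<in> koszul_in V \<Longrightarrow> x \<in> Hom T D L \<Longrightarrow> x = Nul T D L" 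
    by (rule koszul_triangle[OF X, of V]) (rule that)
  have "L \<in> local_objects V" using local_objectsI[OF exact_triangleD(6)[OF e(1)] e(3)] .
  then have "localization_triangle U T R \<phi> V X (G, L)"
    unfolding localization_triangle_def local_objects_def using e by (auto simp: tobj_eq_Loc)
  then have "localization_triangle U T R \<phi> V X (Gam U T R \<phi> V X, Lfun U T R \<phi> V X)"
    unfolding Gam_def Lfun_def using someI[of "localization_triangle U T R \<phi> V X"] by simp
  then show ?thesis unfolding localization_triangle_def local_objects_def using that exact_triangleD(6) 
    by (auto simp: local_objects_def)
qed

end

section \<open>Local cohomology and support\<close>

context noetherian_linear_category
begin

abbreviation gam :: "'r set \<Rightarrow> 'o \<Rightarrow> 'o" where
  "gam p X \<equiv> Gam_at U T R \<phi> p X"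

text \<open>An annihilator \<open>s\<close> outside \<open>p\<close> lies outside every prime
  contained in \<open>p\<close>, so its cone on \<open>D\<close> is in
  \<open>tobj (Zset R p)\<close>. A shift of \<open>x\<close> factors through this cone, and the
  cone has only zero arrows to local objects.\<close>

lemma local_cancel:
  assumes p: "p \<in> Spec R" and L: "L \<in> local_objects (Zset R p)" and x: "x \<in> Hom T D L" and t: "torsion p x"
  shows "x = Nul T D L"
proof -
  have D: "D \<in> Ob T" and Lob: "L \<in> Ob T" using Hom_dom[OF x] Hom_cod[OF x] by auto
  obtain n s where s: "s \<in> grade R n" "s \<notin> p" "killed n s x" using t unfolding torsion_def by blast
  obtain E \<beta> \<gamma> where e: "exact_triangle T D (shift T n D) E (\<phi> n s D) \<beta> \<gamma>" using tri_cone[OF phi_hom[OF s(1) D]] by blast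
  note d = exact_triangleD[OF e]
  have "tors q C E" if "q \<in> Spec R - Zset R p" for q C
    using cone_torsion[OF _ s(1) _ D e, of q] that s(2) tors_of_cod by (auto simp: Zset_def)
  then have E: "E \<in> tobj (Zset R p)" using d(6) unfolding torsion_objects_eq by blast
  have "shiftA T n x \<bullet> \<phi> n s D = Nul T D (shift T n L)" using s(3) killed_iff'[OF s(1) x] by simp
  then obtain y where y: "y \<in> Hom T E (shift T n L)" "shiftA T n x = y \<bullet> \<beta>"
    using tri_contra[OF e shiftA_hom[OF x]] by blast
  have "shift T n L \<in> local_objects (Zset R p)" using localizing_shift[OF localizing_local_objects L] .
  then have "y = Nul T E (shift T n L)" using local_objectsD E y(1) by blast
  then have "shiftA T n x = Nul T (shift T n D) (shift T n L)" using y(2) nul_cmp[OF d(2) shift_ob[OF Lob]] by simp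
  then show ?thesis using shiftA_eq_nul[OF x] by simp
qed

text \<open>The fiber of the action of \<open>s\<close> maps to \<open>L\<close> by an arrow
  annihilated by \<open>s\<close>, hence by zero, so the identity of \<open>L\<close> extends along
  that action.\<close>

lemma local_left_inverse:
  assumes p: "p \<in> Spec R" and L: "L \<in> local_objects (Zset R p)" and s: "s \<in> grade R n" "s \<notin> p"
  obtains t where "t \<in> Hom T (shift T n L) L" "t \<bullet> \<phi> n s L = Idn T L"
proof -
  have Lob: "L \<in> Ob T" using local_objects_ob[OF L] .
  obtain W w h where e: "exact_triangle T W L (shift T n L) w (\<phi> n s L) h"
    using tri_fiber[OF phi_hom[OF s(1) Lob]] .
  note d = exact_triangleD[OF e]
  have "torsion p w" unfolding torsion_def using s tri_comp_zero[OF e] killed_iff[OF d(1)] by auto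
  then have "w = Nul T W L" using local_cancel[OF p L d(1)] by blast
  then have "Idn T L \<bullet> w = Nul T W L" using idn_left[OF d(1)] by simp
  then show ?thesis using tri_contra[OF e idn_closed[OF Lob]] that by metis
qed

text \<open>The arrow \<open>i\<close> is the coreflection of \<open>L\<close> into
  \<open>tobj V\<close>. This universal property supplies what functoriality of \<open>Gam\<close>
  would give.\<close>

lemma
  assumes e: "exact_triangle T M L L' i j k" and L': "L' \<in> local_objects V" and N: "N \<in> tobj V"
  shows lift_ex: "g \<in> Hom T N L \<Longrightarrow> \<exists>f \<in> Hom T N M. g = i \<bullet> f"
    and lift_unique: "f \<in> Hom T N M \<Longrightarrow> i \<bullet> f = Nul T N L \<Longrightarrow> f = Nul T N M"
proof -
  note d = exact_triangleD[OF e]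
  show "\<exists>f \<in> Hom T N M. g = i \<bullet> f" if g: "g \<in> Hom T N L"
  proof -
    have "j \<bullet> g = Nul T N L'" using local_objectsD[OF L' N cmp_closed[OF g d(2)]] .
    then show ?thesis using tri_cov[OF e g] by metis
  qed
  show "f = Nul T N M" if f: "f \<in> Hom T N M" and 0: "i \<bullet> f = Nul T N L"
  proof -
    \<comment> \<open>\<open>W\<close> is a desuspension of \<open>L'\<close> and, like
      \<open>L'\<close>, receives no nonzero arrow from \<open>tobj V\<close>.\<close>
    obtain W w where W: "W \<in> Ob T" "Susp T W = L'" "w \<in> Hom T W M" "exact_triangle T W M L w i j"
      using tri_rot_back[OF e] by blast
    obtain y where y: "y \<in> Hom T N W" "f = w \<bullet> y" using tri_cov[OF W(4) f 0] by blast
    have "Susp T N \<in> tobj V" using localizing_susp[OF localizing_torsion_objects tobj_ob[OF N]] N by blast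
    then have "SuspA T y = Nul T (Susp T N) (Susp T W)" using local_objectsD[OF L'] suspA_hom[OF y(1)] W(2) by simp
    then have "y = Nul T N W" using suspA_eq_nul[OF y(1)] by simp
    then show ?thesis using y(2) cmp_nul[OF W(3) Hom_dom[OF f]] by simp
  qed
qed

text \<open>A left inverse of the action of \<open>s\<close> on \<open>L\<close> lifts along the
  coreflection to a left inverse on \<open>Gam U T R \<phi> V L\<close>. Arrows annihilated by such
  an \<open>s\<close>, in particular those from \<open>koszul_in (Zset R p)\<close>, are therefore
  zero.\<close>

lemma Gam_local:
  assumes p: "p \<in> Spec R" and L: "L \<in> local_objects (Zset R p)"
  shows "Gam U T R \<phi> V L \<in> local_objects (Zset R p)"
proof -
  let ?M = "Gam U T R \<phi> V L" and ?L' = "Lfun U T R \<phi> V L"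
  have Lob: "L \<in> Ob T" using local_objects_ob[OF L] .
  obtain i j k where e: "exact_triangle T ?M L ?L' i j k" and M: "?M \<in> tobj V" and L': "?L' \<in> local_objects V"
    using localization_triangle[OF Lob, of V] .
  note d = exact_triangleD[OF e]
  show ?thesis
  proof (rule local_objectsI[OF d(4)])
    fix D f assume D: "D \<in> koszul_in (Zset R p)" and f: "f \<in> Hom T D ?M"
    have "torsion p (Idn T D)" using koszul_in_torsion[OF D p] by (simp add: Zset_def)
    then have "torsion p f" using torsion_of_dom f by blast
    then obtain n s where s: "s \<in> grade R n" "s \<notin> p" "killed n s f" unfolding torsion_def by blast
    note h = phi_hom[OF s(1) d(4)]
    obtain t where t: "t \<in> Hom T (shift T n L) L" "t \<bullet> \<phi> n s L = Idn T L" using local_left_inverse[OF p L s(1,2)] .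
    note si = shiftA_hom[OF d(1), of n]
    have nM: "shift T n ?M \<in> tobj V" using localizing_shift[OF localizing_torsion_objects M] .
    obtain t' where t': "t' \<in> Hom T (shift T n ?M) ?M" "t \<bullet> shiftA T n i = i \<bullet> t'"
      using lift_ex[OF e L' nM cmp_closed[OF si t(1)]] by blast
    note th = cmp_closed[OF h t'(1)] and id = idn_closed[OF d(4)]
    have "i \<bullet> (t' \<bullet> \<phi> n s ?M) = (t \<bullet> shiftA T n i) \<bullet> \<phi> n s ?M" using cmp_assoc[OF h t'(1) d(1)] t'(2) by simp
    also have "\<dots> = t \<bullet> (\<phi> n s L \<bullet> i)" using cmp_assoc[OF h si t(1)] phi_nat[OF s(1) d(1)] by simp
    also have "\<dots> = i" using cmp_assoc[OF d(1) phi_hom[OF s(1) Lob] t(1)] t(2) idn_left[OF d(1)] by simp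
    \<comment> \<open>The difference of the candidate and the identity is annihilated by
      \<open>i\<close>, so uniqueness of lifts makes it zero.\<close>
    finally have "i \<bullet> Add T (t' \<bullet> \<phi> n s ?M) (Neg T (Idn T ?M)) = Nul T ?M L"
      using cmp_add_right[OF th neg_closed[OF id] d(1)] cmp_neg[OF id d(1)] idn_right[OF d(1)] add_neg[OF d(1)] by simp
    then have "Add T (t' \<bullet> \<phi> n s ?M) (Neg T (Idn T ?M)) = Nul T ?M ?M"
      using lift_unique[OF e L' M add_closed[OF th neg_closed[OF id]]] by simp
    then have "t' \<bullet> \<phi> n s ?M = Idn T ?M" using diff_eq_nul[OF th id] by simp
    then have "f = t' \<bullet> (\<phi> n s ?M \<bullet> f)" using cmp_assoc[OF f h t'(1)] idn_left[OF f] by simp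
    then show "f = Nul T D ?M" using s(3) killed_iff[OF f] cmp_nul[OF t'(1) Hom_dom[OF f]] by simp
  qed
qed

lemma Gam_at_closed:
  assumes p: "p \<in> Spec R" and X: "X \<in> Ob T" 
  shows "gam p X \<in> tobj (Vset R p)" "gam p X \<in> local_objects (Zset R p)" "gam p X \<in> Ob T"
proof -
  let ?L = "Lfun U T R \<phi> (Zset R p) X"
  have L: "?L \<in> local_objects (Zset R p)" using localization_triangle[OF X] by blast
  show t: "gam p X \<in> tobj (Vset R p)" unfolding Gam_at_def using localization_triangle[OF local_objects_ob[OF L]] by blast
  show "gam p X \<in> local_objects (Zset R p)" unfolding Gam_at_def using Gam_local[OF p L] .
  show "gam p X \<in> Ob T" using tobj_ob[OF t] .
qed

lemma tors_local_iff:
  assumes p: "p \<in> Spec R" and L: "L \<in> local_objects (Zset R p)" and D: "D \<in> Ob T"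
  shows "tors p D L \<longleftrightarrow> (\<forall>n. \<forall>x \<in> Hom T (shift T n D) L. x = Nul T (shift T n D) L)"
  unfolding tors_def using local_cancel[OF p L] torsion_nul[OF p shift_ob[OF D] local_objects_ob[OF L]] by metis

lemma local_and_torsion_zero:
  assumes L: "L \<in> local_objects V" "L \<in> tobj V" shows "zero_obj T L"
  using local_objectsD[OF L idn_closed[OF tobj_ob[OF L(2)]]] zero_objI[OF tobj_ob[OF L(2)]] by blast

text \<open>With \<open>L\<close> the localization of \<open>X\<close> at \<open>Zset R p\<close>,
  vanishing means that \<open>L\<close> is already local for \<open>Vset R p\<close>, that is, has
  only zero arrows from Koszul objects in \<open>tobj (Vset R p)\<close>. As \<open>L\<close> is
  \<open>p\<close>-local, zero and \<open>p\<close>-torsion agree there, and torsion can be read off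
  on \<open>X\<close>.\<close>

lemma zero_Gam_at_iff:
  assumes p: "p \<in> Spec R" and X: "X \<in> Ob T" 
  shows "zero_obj T (gam p X) \<longleftrightarrow> (\<forall>D \<in> koszul_in (Vset R p). tors p D X)"
proof -
  let ?Z = "Zset R p" and ?V = "Vset R p"
  define L where "L = Lfun U T R \<phi> ?Z X"
  define M where "M = gam p X"
  define L' where "L' = Lfun U T R \<phi> ?V L"
  obtain f g h where e: "exact_triangle T (Gam U T R \<phi> ?Z X) X L f g h" and G: "Gam U T R \<phi> ?Z X \<in> tobj ?Z" 
    and L: "L \<in> local_objects ?Z"
    using localization_triangle[OF X, of ?Z] by (auto simp: L_def)
  have Lob: "L \<in> Ob T" using local_objects_ob[OF L] .
  obtain i j k where e': "exact_triangle T M L L' i j k" and M: "M \<in> tobj ?V" and L': "L' \<in> local_objects ?V"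
    using localization_triangle[OF Lob, of ?V] by (auto simp: M_def L'_def L_def Gam_at_def)
  note d' = exact_triangleD[OF e']
  have pZ: "p \<notin> ?Z" by (simp add: Zset_def)
  \<comment> \<open>The first object of the triangle is in \<open>tobj (Zset R p)\<close> and
    \<open>p\<close> is not in \<open>Zset R p\<close>, so it is \<open>p\<close>-torsion against
    Koszul objects.\<close>
  have XL: "tors p D X \<longleftrightarrow> tors p D L" if D: "D \<in> koszul" for D
  proof -
    have G': "tors p D (Gam U T R \<phi> ?Z X)" using tobj_tors_koszul[OF G p pZ D] .
    note loc = localizing_tors[OF p, of "{D}"]
    have "localizing U T {X \<in> Ob T. tors p D X}" using loc koszul_finitary[OF D] by simp
    note l = localizing_third[OF this e] localizing_second[OF this e]
    show ?thesis using l G' exact_triangleD[OF e] by blast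
  qed
  have DO: "D \<in> koszul" "D \<in> Ob T" if "D \<in> koszul_in ?V" for D 
    using that koszul_ob by (auto simp: koszul_in_def)
  have "zero_obj T M \<longleftrightarrow> L \<in> local_objects ?V"
  proof
    assume "zero_obj T M"
    then obtain b where "is_iso_arr T L' L b" using iso_arr_sym tri_iso_fiber_zero[OF e'] by blast
    then show "L \<in> local_objects ?V" using localizing_iso[OF localizing_local_objects L'] by blast
  next
    assume "L \<in> local_objects ?V"
    then have "i = Nul T M L" using local_objectsD M d'(1) by blast
    then have "Idn T M = Nul T M M"
      using lift_unique[OF e' L' M idn_closed[OF d'(4)]] idn_right[OF d'(1)] by simp
    then show "zero_obj T M" using zero_objI d'(4) by blast
  qed
  also have "L \<in> local_objects ?V \<longleftrightarrow> (\<forall>D \<in> koszul_in ?V. tors p D L)"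
  proof
    assume lv: "L \<in> local_objects ?V"
    show "\<forall>D \<in> koszul_in ?V. tors p D L"
    proof
      fix D assume D: "D \<in> koszul_in ?V"
      have "x = Nul T (shift T n D) L" if "x \<in> Hom T (shift T n D) L" for n x
        using local_objectsD[OF lv _ that] koszul_in_shift[OF D] by (simp add: koszul_in_def)
      then show "tors p D L" using tors_local_iff[OF p L DO(2)[OF D]] by blast
    qed
  next
    assume t: "\<forall>D \<in> koszul_in ?V. tors p D L"
    show "L \<in> local_objects ?V"
    proof (rule local_objectsI[OF Lob])
      fix D x assume D: "D \<in> koszul_in ?V" and x: "x \<in> Hom T D L"
      have "tors p D L" using t D by blast
      then show "x = Nul T D L" using tors_local_iff[OF p L DO(2)[OF D]] x shift_0[of D] by metis
    qed
  qed
  finally show ?thesis using XL DO(1) by (auto simp: M_def)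
qed

lemma iso_arr_cmp:
  assumes "is_iso_arr T X Y f" "is_iso_arr T Y Z g" shows "is_iso_arr T X Z (g \<bullet> f)"
proof -
  obtain f' g' where f: "f \<in> Hom T X Y" "f' \<in> Hom T Y X" "f' \<bullet> f = Idn T X" "f \<bullet> f' = Idn T Y"
    and g: "g \<in> Hom T Y Z" "g' \<in> Hom T Z Y" "g' \<bullet> g = Idn T Y" "g \<bullet> g' = Idn T Z"
    using assms by (auto simp: is_iso_arr_def)
  note gf = cmp_closed[OF f(1) g(1)] and fg = cmp_closed[OF g(2) f(2)]
  have "(f' \<bullet> g') \<bullet> (g \<bullet> f) = Idn T X"
    using cmp_assoc[OF gf g(2) f(2)] cmp_assoc[OF f(1) g(1,2)] g(3) idn_left[OF f(1)] f(3) by simp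
  moreover have "(g \<bullet> f) \<bullet> (f' \<bullet> g') = Idn T Z"
    using cmp_assoc[OF fg f(1) g(1)] cmp_assoc[OF g(2) f(2,1)] f(4) idn_left[OF g(2)] g(4) by simp
  ultimately show ?thesis using gf fg by (auto simp: is_iso_arr_def)
qed

text \<open>On an object with both properties the two localization triangles degenerate: the term to
  be removed is each time both local and torsion for the same subset, hence zero.\<close>

lemma Gam_at_image_eq:
  assumes p: "p \<in> Spec R"
  shows "Gam_at_image U T R \<phi> p = tobj (Vset R p) \<inter> local_objects (Zset R p)"
proof
  show "Gam_at_image U T R \<phi> p \<subseteq> tobj (Vset R p) \<inter> local_objects (Zset R p)"
  proof
    fix Y assume "Y \<in> Gam_at_image U T R \<phi> p"
    then obtain X f where X: "X \<in> Ob T" "is_iso_arr T Y (gam p X) f" by (auto simp: Gam_at_image_def iso_obj_def)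
    then obtain g where "is_iso_arr T (gam p X) Y g" using iso_arr_sym by blast
    then show "Y \<in> tobj (Vset R p) \<inter> local_objects (Zset R p)"
      using localizing_iso[OF localizing_Int[OF localizing_torsion_objects localizing_local_objects]] 
        Gam_at_closed[OF p X(1)] by blast
  qed
  show "tobj (Vset R p) \<inter> local_objects (Zset R p) \<subseteq> Gam_at_image U T R \<phi> p"
  proof
    let ?Z = "Zset R p" and ?V = "Vset R p"
    fix Y assume "Y \<in> tobj ?V \<inter> local_objects ?Z"
    then have Y: "Y \<in> tobj ?V" "Y \<in> local_objects ?Z" by auto
    have Yob: "Y \<in> Ob T" using tobj_ob[OF Y(1)] .
    define L where "L = Lfun U T R \<phi> ?Z Y"
    define G where "G = Gam U T R \<phi> ?Z Y"
    obtain f g h where e: "exact_triangle T G Y L f g h" and G: "G \<in> tobj ?Z" and L: "L \<in> local_objects ?Z"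
      using localization_triangle[OF Yob, of ?Z] by (auto simp: L_def G_def)
    have "G \<in> local_objects ?Z" using localizing_first[OF localizing_local_objects e Y(2) L] .
    then have g: "is_iso_arr T Y L g" using tri_iso_fiber_zero[OF e] local_and_torsion_zero G by blast
    have Lob: "L \<in> Ob T" using local_objects_ob[OF L] .
    define L' where "L' = Lfun U T R \<phi> ?V L"
    obtain i j k where e': "exact_triangle T (gam p Y) L L' i j k" and M: "gam p Y \<in> tobj ?V" and L': "L' \<in> local_objects ?V"
      using localization_triangle[OF Lob, of ?V] by (auto simp: L'_def L_def Gam_at_def)
    have "L \<in> tobj ?V" using localizing_iso[OF localizing_torsion_objects Y(1) g] .
    then have "L' \<in> tobj ?V" using localizing_third[OF localizing_torsion_objects e' M] by blast
    then have "is_iso_arr T (gam p Y) L i" using tri_iso_cone_zero[OF e'] local_and_torsion_zero L' by blast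
    then obtain i' where i': "is_iso_arr T L (gam p Y) i'" using iso_arr_sym by blast
    have "is_iso_arr T Y (gam p Y) (i' \<bullet> g)"
      using iso_arr_cmp[OF g i'] .
    then show "Y \<in> Gam_at_image U T R \<phi> p" using Yob unfolding Gam_at_image_def iso_obj_def by blast
  qed
qed

lemma localizing_Gam_at_image: "p \<in> Spec R \<Longrightarrow> localizing U T (Gam_at_image U T R \<phi> p)"
  unfolding Gam_at_image_eq by (rule localizing_Int[OF localizing_torsion_objects localizing_local_objects])

lemma Gam_at_in_image: "p \<in> Spec R \<Longrightarrow> X \<in> Ob T \<Longrightarrow> gam p X \<in> Gam_at_image U T R \<phi> p"
  using Gam_at_image_eq Gam_at_closed by blast

text \<open>The torsion criterion for vanishing is a localizing condition on \<open>X\<close>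
  because the test objects are finitary.\<close>

lemma localizing_supp_inv: "localizing U T (supp_inv U T R \<phi> W)"
proof -
  have "supp_inv U T R \<phi> W = {X \<in> Ob T. \<forall>p \<in> Spec R - W. \<forall>D \<in> koszul_in (Vset R p). tors p D X}"
    unfolding supp_inv_def supp_def using zero_Gam_at_iff by auto
  moreover have "localizing U T \<dots>"
    by (rule localizing_INT) (use localizing_tors koszul_in_finitary in blast)
  ultimately show ?thesis by simp
qed

text \<open>For \<open>q\<close> different from \<open>p\<close>, at least one of the two primes
  does not lie in the other, and each case has its own source of torsion.\<close>

lemma Gam_at_image_supp:
  assumes p: "p \<in> Spec R" and M: "M \<in> Gam_at_image U T R \<phi> p"
  shows "supp U T R \<phi> M = (if zero_obj T M then {} else {p})"
proof -
  have M': "M \<in> tobj (Vset R p)" "M \<in> local_objects (Zset R p)" using M Gam_at_image_eq[OF p] by auto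
  have Mob: "M \<in> Ob T" using tobj_ob M' by blast
  have other: "zero_obj T (gam q M)" if q: "q \<in> Spec R" "q \<noteq> p" for q
    unfolding zero_Gam_at_iff[OF q(1) Mob]
  proof
    fix D assume D: "D \<in> koszul_in (Vset R q)"
    show "tors q D M"
    proof (cases "p \<subseteq> q")
      case False
      \<comment> \<open>Here \<open>q\<close> is not in \<open>Vset R p\<close>, so \<open>M\<close>
        is \<open>q\<close>-torsion against all Koszul objects.\<close>
      then show ?thesis using tobj_tors_koszul[OF M'(1) q(1), of D] D by (simp add: Vset_def koszul_in_def)
    next
      case True
      \<comment> \<open>Now \<open>p\<close> is not in \<open>Vset R q\<close>: the test objects
        have \<open>p\<close>-torsion identity and only zero arrows to the \<open>p\<close>-local
        \<open>M\<close>.\<close>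
      then have "\<not> q \<subseteq> p" using q by blast
      then have p': "p \<notin> Vset R q" by (simp add: Vset_def)
      have "torsion p (Idn T D)" using koszul_in_torsion[OF D p p'] .
      then have "x = Nul T (shift T n D) M" if "x \<in> Hom T (shift T n D) M" for n x
        using local_cancel[OF p M'(2) that] torsion_of_dom[OF _ that] torsion_idn_shift koszul_in_ob D by blast
      then show ?thesis unfolding tors_def using torsion_nul[OF q(1) shift_ob Mob] koszul_in_ob D by blast
    qed
  qed
  have self: "zero_obj T (gam p M) \<longleftrightarrow> zero_obj T M"
  proof
    assume "zero_obj T (gam p M)"
    then have t: "\<forall>D \<in> koszul_in (Vset R p). tors p D M" using zero_Gam_at_iff[OF p Mob] by blast
    show "zero_obj T M"
    proof (rule ccontr)
      assume "\<not> zero_obj T M"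
      \<comment> \<open>Koszul objects detect \<open>M\<close>; an arrow that is both
        \<open>p\<close>-torsion and into a \<open>p\<close>-local object is zero.\<close>
      then obtain D x where D: "D \<in> koszul_in (Vset R p)" "x \<in> Hom T D M" "x \<noteq> Nul T D M"
        using koszul_in_generates[OF M'(1)] by blast
      have "torsion p x" using t D(1,2) shift_0[of D] unfolding tors_def by metis
      then show False using local_cancel[OF p M'(2) D(2)] D(3) by blast
    qed
  next
    assume z: "zero_obj T M"
    have "tors p D M" for D
      unfolding tors_def using into_zero[OF z] torsion_nul[OF p Hom_dom Mob] by metis
    then show "zero_obj T (gam p M)" using zero_Gam_at_iff[OF p Mob] by blast
  qed
  show ?thesis unfolding supp_def using other self p by auto
qed

section \<open>Stratification\<close>

abbreviation ssupp :: "'o set \<Rightarrow> 'r set set" where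
  "ssupp S \<equiv> supp_subcat U T R \<phi> S"

abbreviation gammas :: "'o \<Rightarrow> 'o set" where
  "gammas X \<equiv> {gam p X | p. p \<in> Spec R}"

lemma gammas_ob: "X \<in> Ob T \<Longrightarrow> gammas X \<subseteq> Ob T"
  using Gam_at_closed(3) by blast

text \<open>The local-global principle reduces membership of \<open>Y\<close> to that of each
  \<open>gam p Y\<close>. If this is nonzero, some \<open>X\<close> in \<open>S\<close> has nonzero
  \<open>gam p X\<close>, which lies in \<open>S\<close>; minimality then places the whole image at
  \<open>p\<close> inside \<open>S\<close>.\<close>

lemma supp_inv_supp_subcat:
  assumes st: "stratified U T R \<phi>" and S: "localizing U T S"
  shows "supp_inv U T R \<phi> (ssupp S) = S"
proof
  have Sob: "S \<subseteq> Ob T" using localizing_sub[OF S] .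
  show "S \<subseteq> supp_inv U T R \<phi> (ssupp S)" using Sob by (auto simp: supp_inv_def supp_subcat_def)
  have lg: "Loc U T {X} = Loc U T (gammas X)" if "X \<in> Ob T" for X
    using st that unfolding stratified_def local_global_principle_def by blast
  show "supp_inv U T R \<phi> (ssupp S) \<subseteq> S"
  proof
    fix Y assume "Y \<in> supp_inv U T R \<phi> (ssupp S)"
    then have Y: "Y \<in> Ob T" "supp U T R \<phi> Y \<subseteq> ssupp S" by (auto simp: supp_inv_def)
    have "gam p Y \<in> S" if p: "p \<in> Spec R" for p
    proof (cases "zero_obj T (gam p Y)")
      case True
      then show ?thesis using localizing_zero[OF S] by blast
    next
      case False
      then have "p \<in> ssupp S" using Y p by (auto simp: supp_def)
      then obtain X where X: "X \<in> S" "\<not> zero_obj T (gam p X)" by (auto simp: supp_subcat_def supp_def)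
      have Xob: "X \<in> Ob T" using X Sob by blast
      have "gam p X \<in> gammas X" using p by blast
      then have "gam p X \<in> Loc U T {X}" unfolding lg[OF Xob] by (rule subsetD[OF Loc_incl])
      moreover have "Loc U T {X} \<subseteq> S" using Loc_least[OF S] X by blast
      ultimately have gS: "gam p X \<in> S" by blast
      let ?G = "Gam_at_image U T R \<phi> p"
      have gG: "gam p X \<in> ?G" using Gam_at_in_image[OF p Xob] .
      then have "minimal_subcat U T ?G" 
        using st p X(2) unfolding stratified_def zero_subcat_def by blast
      moreover have "localizing U T (S \<inter> ?G)" using localizing_Int[OF S localizing_Gam_at_image[OF p]] .
      moreover have "\<not> zero_subcat T (S \<inter> ?G)" using gS gG X(2) by (auto simp: zero_subcat_def)
      ultimately have "S \<inter> ?G = ?G" unfolding minimal_subcat_def by blast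
      then show ?thesis using Gam_at_in_image[OF p Y(1)] by blast
    qed
    then have "Loc U T (gammas Y) \<subseteq> S" by (intro Loc_least[OF S]) blast
    then show "Y \<in> S" using lg[OF Y(1)] Loc_incl[of "{Y}"] by blast
  qed
qed

text \<open>A point \<open>p\<close> of \<open>W\<close> is realized by \<open>gam p X\<close>,
  whose support is exactly \<open>{p}\<close>.\<close>

lemma supp_subcat_supp_inv:
  assumes W: "W \<subseteq> ssupp (Ob T)" shows "ssupp (supp_inv U T R \<phi> W) = W"
proof
  show "ssupp (supp_inv U T R \<phi> W) \<subseteq> W" by (auto simp: supp_inv_def supp_subcat_def)
  show "W \<subseteq> ssupp (supp_inv U T R \<phi> W)"
  proof
    fix p assume pW: "p \<in> W"
    then obtain X where X: "X \<in> Ob T" "p \<in> Spec R" "\<not> zero_obj T (gam p X)" using W by (auto simp: supp_subcat_def supp_def)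
    have "supp U T R \<phi> (gam p X) = {p}" using Gam_at_image_supp[OF X(2) Gam_at_in_image[OF X(2,1)]] X(3) by simp
    then show "p \<in> ssupp (supp_inv U T R \<phi> W)" 
      unfolding supp_subcat_def supp_inv_def using pW Gam_at_closed(3)[OF X(2,1)] by auto
  qed
qed

text \<open>\<open>supp_inv U T R \<phi> (ssupp A)\<close> is a localizing subcategory containing
  \<open>A\<close>, so generating adds no support.\<close>

lemma supp_subcat_Loc: 
  assumes "A \<subseteq> Ob T" shows "ssupp (Loc U T A) = ssupp A"
proof
  have "A \<subseteq> supp_inv U T R \<phi> (ssupp A)" using assms by (auto simp: supp_inv_def supp_subcat_def)
  then have "Loc U T A \<subseteq> supp_inv U T R \<phi> (ssupp A)" by (rule Loc_least[OF localizing_supp_inv])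
  then show "ssupp (Loc U T A) \<subseteq> ssupp A" by (auto simp: supp_inv_def supp_subcat_def)
  show "ssupp A \<subseteq> ssupp (Loc U T A)" using Loc_incl by (auto simp: supp_subcat_def)
qed

text \<open>Injectivity is applied to two pairs with equal support: the subcategories generated by
  \<open>X\<close> and by its \<open>gammas\<close>, and a nonzero localizing subcategory of the
  image at \<open>p\<close> together with the image itself, both supported at
  \<open>{p}\<close>.\<close>

lemma stratified_if_inj:
  assumes inj: "inj_on ssupp {S. localizing U T S}"
  shows "stratified U T R \<phi>"
proof -
  have eq: "S = S'" if "localizing U T S" "localizing U T S'" "ssupp S = ssupp S'" for S S'
    using inj that by (auto simp: inj_on_def)
  have lg: "Loc U T {X} = Loc U T (gammas X)" if X: "X \<in> Ob T" for X
  proof (rule eq)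
    show "localizing U T (Loc U T {X})" using localizing_Loc X by blast
    show "localizing U T (Loc U T (gammas X))" using localizing_Loc gammas_ob[OF X] by blast
    have "ssupp (gammas X) = supp U T R \<phi> X"
    proof -
      have "supp U T R \<phi> (gam p X) = (if zero_obj T (gam p X) then {} else {p})" if "p \<in> Spec R" for p
        using Gam_at_image_supp[OF that Gam_at_in_image[OF that X]] .
      then have "ssupp (gammas X) = (\<Union>p \<in> Spec R. if zero_obj T (gam p X) then {} else {p})"
        by (auto simp: supp_subcat_def split: if_splits)
      then show ?thesis by (auto simp: supp_def split: if_splits)
    qed
    moreover have "ssupp {X} = supp U T R \<phi> X" by (simp add: supp_subcat_def)
    ultimately show "ssupp (Loc U T {X}) = ssupp (Loc U T (gammas X))"
      using supp_subcat_Loc[of "{X}"] supp_subcat_Loc[OF gammas_ob[OF X]] X by simp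
  qed
  have "minimal_subcat U T (Gam_at_image U T R \<phi> p)" 
    if p: "p \<in> Spec R" and nz: "\<not> zero_subcat T (Gam_at_image U T R \<phi> p)" for p
    unfolding minimal_subcat_def
  proof (intro conjI allI impI)
    let ?G = "Gam_at_image U T R \<phi> p"
    show "localizing U T ?G" using localizing_Gam_at_image[OF p] .
    show "\<not> zero_subcat T ?G" by (rule nz)
    have sp: "ssupp S = {p}" if S: "S \<subseteq> ?G" "\<not> zero_subcat T S" for S
    proof -
      obtain M where M: "M \<in> S" "\<not> zero_obj T M" using S(2) by (auto simp: zero_subcat_def)
      have supp: "supp U T R \<phi> N = (if zero_obj T N then {} else {p})" if "N \<in> S" for N
        using Gam_at_image_supp[OF p] S(1) that by blast
      have "ssupp S \<subseteq> {p}" unfolding supp_subcat_def using supp by (auto split: if_splits)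
      moreover have "p \<in> ssupp S" unfolding supp_subcat_def using supp[OF M(1)] M by auto
      ultimately show ?thesis by blast
    qed
    fix S assume S: "localizing U T S \<and> S \<subseteq> ?G \<and> \<not> zero_subcat T S"
    show "S = ?G" by (rule eq) (use S sp[of S] sp[of ?G] nz localizing_Gam_at_image[OF p] in auto)
  qed
  then show ?thesis unfolding stratified_def local_global_principle_def using lg by blast
qed

end

theorem theorem4p2:
  fixes U :: "'u set"
    and R :: "'r graded_ring"
    and T :: "('o, 'm) triangulated_category"
    and \<phi> :: "int \<Rightarrow> 'r \<Rightarrow> 'o \<Rightarrow> 'm"
  assumes "universe U"
    and "graded_commutative_ring R" and "noetherian_ring R" and "small U (carrier R)"
    and "triangulated_category T" and "locally_small U T" and "has_coproducts U T"
    and "compactly_generated U T"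
    and "linear_structure T R \<phi>"
  shows "(stratified U T R \<phi> \<longrightarrow>
        bij_betw (supp_subcat U T R \<phi>) {S. localizing U T S} (Pow (supp_subcat U T R \<phi> (Ob T))) \<and>
        bij_betw (supp_inv U T R \<phi>) (Pow (supp_subcat U T R \<phi> (Ob T))) {S. localizing U T S} \<and>
        (\<forall>S. localizing U T S \<longrightarrow> supp_inv U T R \<phi> (supp_subcat U T R \<phi> S) = S) \<and>
        (\<forall>W \<subseteq> supp_subcat U T R \<phi> (Ob T). supp_subcat U T R \<phi> (supp_inv U T R \<phi> W) = W) \<and>
        mono_on {S. localizing U T S} (supp_subcat U T R \<phi>) \<and>
        mono_on (Pow (supp_subcat U T R \<phi> (Ob T))) (supp_inv U T R \<phi>)) \<and>
      (inj_on (supp_subcat U T R \<phi>) {S. localizing U T S} \<longrightarrow> stratified U T R \<phi>)"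
proof -
  obtain G where G: "small U G" "G \<subseteq> compact_objects U T" "Ob T = Loc U T G"
    using assms(8) by (auto simp: compactly_generated_def)
  interpret noetherian_linear_category U T R \<phi> G
    using assms G
    by (simp add: noetherian_linear_category_def noetherian_linear_category_axioms_def linear_triangulated_category_def
        small_triangulated_category_def small_triangulated_category_axioms_def)
  let ?S = "{S. localizing U T S}" and ?P = "Pow (supp_subcat U T R \<phi> (Ob T))"
  have mono: "mono_on ?S (supp_subcat U T R \<phi>)" "mono_on ?P (supp_inv U T R \<phi>)"
    by (rule mono_onI, auto simp: supp_subcat_def supp_inv_def)+
  have SP: "supp_subcat U T R \<phi> ` ?S \<subseteq> ?P" 
    using localizing_sub by (fastforce simp: supp_subcat_def)
  have PS: "supp_inv U T R \<phi> ` ?P \<subseteq> ?S" using localizing_supp_inv by blast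
  have sw: "\<forall>W \<subseteq> supp_subcat U T R \<phi> (Ob T). supp_subcat U T R \<phi> (supp_inv U T R \<phi> W) = W"
    using supp_subcat_supp_inv by blast
  have "bij_betw (supp_subcat U T R \<phi>) ?S ?P \<and> bij_betw (supp_inv U T R \<phi>) ?P ?S \<and>
      (\<forall>S. localizing U T S \<longrightarrow> supp_inv U T R \<phi> (supp_subcat U T R \<phi> S) = S)" if "stratified U T R \<phi>"
  proof -
    have si: "\<forall>S. localizing U T S \<longrightarrow> supp_inv U T R \<phi> (supp_subcat U T R \<phi> S) = S"
      using supp_inv_supp_subcat[OF that] by blast
    have "bij_betw (supp_subcat U T R \<phi>) ?S ?P"
      by (rule bij_betw_byWitness[OF _ _ SP PS]) (use si sw in auto)
    moreover have "bij_betw (supp_inv U T R \<phi>) ?P ?S"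
      by (rule bij_betw_byWitness[OF _ _ PS SP]) (use si sw in auto)
    ultimately show ?thesis using si by blast
  qed
  then show ?thesis using mono sw stratified_if_inj by blast
qed

end
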